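(* Let $X=X(\Sigma)$ be a toric variety, let $\Psi$ be a choice of complements for $\Sigma$, let $D$ be a $\mathbb{Q}$-Cartier divisor on $X$, and let $z\in Z_k(X)_{\mathbb{Q}}$. Then the image of $D\cdot z$ in $A_{k-1}(X)_{\mathbb{Q}}$ equals $D\cdot\overline{z}$, where $D\cdot z$ is the cycle-level action defined by $\Psi$, $\overline{z}$ is the image of $z$ in $A_k(X)_{\mathbb{Q}}$, and $D\cdot\overline{z}$ is the usual intersection of a Cartier divisor with a cycle class modulo rational equivalence (extended $\mathbb{Q}$-linearly to $\mathbb{Q}$-Cartier divisors).
   Context: Setting. $N$ is a free abelian group of rank $n$, $M=\operatorname{Hom}(N,\mathbb{Z})$, $N_{\mathbb{Q}}=\mathbb{Q}\otimes N$, $M_{\mathbb{Q}}=\mathbb{Q}\otimes M$, $\Sigma$ is a fan of strongly convex rational polyhedral cones in $N_{\mathbb{Q}}$, and $X=X(\Sigma)$ is the associated toric variety over a fixed ground field. For cones, $\tau\succ\sigma$ means $\sigma$ is a proper face of $\tau$, and $\tau\to\sigma$ means $\sigma$ is a facet (maximal proper face) of $\tau$. For $\sigma\in\Sigma$, $N_\sigma$ is the subgroup of $N$ generated by $\sigma\cap N$. Write $M(\sigma)=\sigma^\perp\subset M_{\mathbb{Q}}$, $M_\tau=M_{\mathbb{Q}}/M(\tau)$, and for $\sigma\prec\tau$, $M(\sigma)_\tau=M(\sigma)/M(\tau)$, which is dual to $\mathbb{Q}\otimes(N_\tau/N_\sigma)$; $\langle\cdot,\cdot\rangle$ denotes the duality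 pairings. If $\tau\to\sigma$, $n_{\tau,\sigma}$ is the generator of $N_\tau/N_\sigma\cong\mathbb{Z}$ lying in the image of $\tau$. Cycles and divisors. For $\sigma\in\Sigma$ of dimension $n-k$, $V(\sigma)$ is the associated $k$-dimensional torus-invariant subvariety; $Z_k(X)$ is the free abelian group on the $[V(\sigma)]$ with $\dim\sigma=n-k$, and $Z_k(X)_{\mathbb{Q}}=\mathbb{Q}\otimes Z_k(X)$. $A_k(X)$ is the $k$-th Chow group. An equivariant $\mathbb{Q}$-Cartier divisor $D$ on $X$ is a collection of local equations $m_\sigma\in M_\sigma$ ($\sigma\in\Sigma$) such that for $\tau\prec\sigma$ the natural map $M_\sigma\to M_\tau$ sends $m_\sigma$ to $m_\tau$ (sign convention: $\chi^{m_\sigma}$ is a local equation for $D$ on the affine open $U_\sigma$). Choice of complements. $\Psi$ assigns to each $\sigma\in\Sigma$ a linear subspace $\Psi(\sigma)\subset M_{\mathbb{Q}}$ of dimension $\dim\sigma$ such that $\Psi(\sigma)\cap M(\sigma)=0$ (so $M_{\mathbb{Q}}=M(\sigma)\oplus\Psi(\sigma)$), and $\Psi(\tau)\subset\Psi(\sigma)$ whenever $\tau\prec\sigma$. Let $\pi_\sigma:M_{\mathbb{Q}}\to M(\sigma)$ be the projection along $\Psi(\sigma)$; for $\tau\succ\sigma$ it induces a map, also denoted $\pi_\sigma:M_\tau\to M(\sigma)_\tau$. Action. $D\cdot[V(\sigma)]=\sum_{\tau\to\sigma}\langle\pi_\sigma(m_\tau),n_{\tau,\sigma}\rangle[V(\tau)]$,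 extended linearly to a map $D\cdot{}:Z_k(X)_{\mathbb{Q}}\to Z_{k-1}(X)_{\mathbb{Q}}$. *)

theory Defs
  imports
    Complex_Main
    "HOL-Library.Poly_Mapping"
    "HOL-Library.Function_Algebras"
    "HOL-Computational_Algebra.Fraction_Field"
    "HOL-Algebra.Ideal"
begin

section \<open>Lattices and cones\<close>

text \<open>
  A basis identifies \<open>N\<close> with \<open>\<int>\<^sup>n\<close>, and the dual basis identifies \<open>M\<close> with \<open>\<int>\<^sup>n\<close>, so that
  the duality pairing becomes the dot product. Both \<open>N\<^sub>\<rat>\<close> and \<open>M\<^sub>\<rat>\<close> are the space of rational
  vectors supported on \<open>{..<n}\<close> (which allows \<open>n = 0\<close>), and \<open>N\<close>, \<open>M\<close> are the integral vectors
  in it.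
\<close>

type_synonym qvec = "nat \<Rightarrow>\<^sub>0 rat"
type_synonym cone = "qvec set"

definition qscale :: "rat \<Rightarrow> qvec \<Rightarrow> qvec" where
  "qscale c v = Poly_Mapping.map ((*) c) v"

lemma lookup_qscale [simp]: "Poly_Mapping.lookup (qscale c v) i = c * Poly_Mapping.lookup v i"
  by (simp add: qscale_def Poly_Mapping.map.rep_eq when_def)

interpretation qvec: vector_space qscale
  by unfold_locales (auto intro!: poly_mapping_eqI simp: lookup_add algebra_simps)

definition qspace :: "nat \<Rightarrow> qvec set" where
  "qspace n = {v. Poly_Mapping.keys v \<subseteq> {..<n}}"

definition lattice_pts :: "nat \<Rightarrow> qvec set" where
  "lattice_pts n = {v \<in> qspace n. \<forall>i. Poly_Mapping.lookup v i \<in> \<int>}"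

definition pairing :: "qvec \<Rightarrow> qvec \<Rightarrow> rat" where
  "pairing u v = (\<Sum>i\<in>Poly_Mapping.keys u. Poly_Mapping.lookup u i * Poly_Mapping.lookup v i)"

definition perp :: "nat \<Rightarrow> cone \<Rightarrow> qvec set" where
  "perp n \<sigma> = {u \<in> qspace n. \<forall>v\<in>\<sigma>. pairing u v = 0}"

definition dual_cone :: "nat \<Rightarrow> cone \<Rightarrow> qvec set" where
  "dual_cone n \<sigma> = {u \<in> qspace n. \<forall>v\<in>\<sigma>. pairing u v \<ge> 0}"

definition polyhedral_cone :: "nat \<Rightarrow> cone \<Rightarrow> bool" where
  "polyhedral_cone n \<sigma> \<longleftrightarrow>
     (\<exists>S. finite S \<and> S \<subseteq> qspace n \<and>
          \<sigma> = {\<Sum>s\<in>S. qscale (c s) s | c. \<forall>s\<in>S. c s \<ge> 0})"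

definition strongly_convex :: "cone \<Rightarrow> bool" where
  "strongly_convex \<sigma> \<longleftrightarrow> \<sigma> \<inter> uminus ` \<sigma> = {0}"

definition is_face :: "nat \<Rightarrow> cone \<Rightarrow> cone \<Rightarrow> bool" where
  "is_face n \<tau> \<sigma> \<longleftrightarrow> (\<exists>u\<in>dual_cone n \<sigma>. \<tau> = {v \<in> \<sigma>. pairing u v = 0})"

definition proper_face :: "nat \<Rightarrow> cone \<Rightarrow> cone \<Rightarrow> bool" where
  "proper_face n \<tau> \<sigma> \<longleftrightarrow> is_face n \<tau> \<sigma> \<and> \<tau> \<noteq> \<sigma>"

definition is_facet :: "nat \<Rightarrow> cone \<Rightarrow> cone \<Rightarrow> bool" where
  "is_facet n \<tau> \<sigma> \<longleftrightarrow>
     proper_face n \<tau> \<sigma> \<and> (\<forall>\<rho>. proper_face n \<rho> \<sigma> \<and> \<tau> \<subseteq> \<rho> \<longrightarrow> \<rho> = \<tau>)"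

definition cone_dim :: "cone \<Rightarrow> nat" where
  "cone_dim \<sigma> = qvec.dim (qvec.span \<sigma>)"

definition fan :: "nat \<Rightarrow> cone set \<Rightarrow> bool" where
  "fan n \<Sigma> \<longleftrightarrow> finite \<Sigma> \<and>
     (\<forall>\<sigma>\<in>\<Sigma>. polyhedral_cone n \<sigma> \<and> strongly_convex \<sigma>) \<and>
     (\<forall>\<sigma>\<in>\<Sigma>. \<forall>\<tau>. is_face n \<tau> \<sigma> \<longrightarrow> \<tau> \<in> \<Sigma>) \<and>
     (\<forall>\<sigma>\<in>\<Sigma>. \<forall>\<tau>\<in>\<Sigma>. is_face n (\<sigma> \<inter> \<tau>) \<sigma> \<and> is_face n (\<sigma> \<inter> \<tau>) \<tau>)"

definition cone_lattice :: "nat \<Rightarrow> cone \<Rightarrow> qvec set" where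
  "cone_lattice n \<sigma> =
     (\<lambda>H. 0 \<in> H \<and> (\<forall>a\<in>H. \<forall>b\<in>H. a - b \<in> H)) hull (\<sigma> \<inter> lattice_pts n)"

text \<open>
  A representative in \<open>N\<^sub>\<tau>\<close> of the generator \<open>n\<^bsub>\<tau>,\<sigma>\<^esub>\<close> of \<open>N\<^sub>\<tau> / N\<^sub>\<sigma>\<close>; the last clause of the
  predicate says that its class lies in the image of \<open>\<tau>\<close> modulo \<open>\<rat> \<otimes> N\<^sub>\<sigma>\<close>.
\<close>

definition is_normal_gen :: "nat \<Rightarrow> cone \<Rightarrow> cone \<Rightarrow> qvec \<Rightarrow> bool" where
  "is_normal_gen n \<tau> \<sigma> v \<longleftrightarrow> v \<in> cone_lattice n \<tau> \<and>
     (\<forall>x\<in>cone_lattice n \<tau>. \<exists>c::int. x - qscale (of_int c) v \<in> cone_lattice n \<sigma>) \<and>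
     (\<exists>s\<in>qvec.span \<sigma>. v + s \<in> \<tau>)"

definition normal_gen :: "nat \<Rightarrow> cone \<Rightarrow> cone \<Rightarrow> qvec" where
  "normal_gen n \<tau> \<sigma> = (SOME v. is_normal_gen n \<tau> \<sigma> v)"


section \<open>Invariant cycles, equivariant divisors, and the cycle-level action\<close>

text \<open>
  An element of \<open>Z\<^sub>k(X)\<^sub>\<rat>\<close>, with \<open>z \<sigma>\<close> the coefficient of \<open>[V(\<sigma>)]\<close>. The index \<open>k\<close> is an integer
  so that \<open>Z\<^sub>-\<^sub>1(X) = 0\<close> needs no special treatment.
\<close>

definition invariant_cycles :: "nat \<Rightarrow> cone set \<Rightarrow> int \<Rightarrow> (cone \<Rightarrow> rat) set" where
  "invariant_cycles n \<Sigma> k =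
     {z. \<forall>\<sigma>. z \<sigma> \<noteq> 0 \<longrightarrow> \<sigma> \<in> \<Sigma> \<and> int (cone_dim \<sigma>) = int n - k}"

text \<open>
  The vector \<open>m \<sigma> \<in> M\<^sub>\<rat>\<close> represents \<open>m\<^sub>\<sigma> \<in> M\<^sub>\<sigma> = M\<^sub>\<rat> / \<sigma>\<^sup>\<bottom>\<close>; hence compatibility is only required
  modulo \<open>\<tau>\<^sup>\<bottom>\<close>.
\<close>

definition equivariant_Q_cartier :: "nat \<Rightarrow> cone set \<Rightarrow> (cone \<Rightarrow> qvec) \<Rightarrow> bool" where
  "equivariant_Q_cartier n \<Sigma> m \<longleftrightarrow> (\<forall>\<sigma>\<in>\<Sigma>. m \<sigma> \<in> qspace n) \<and>
     (\<forall>\<sigma>\<in>\<Sigma>. \<forall>\<tau>\<in>\<Sigma>. is_face n \<tau> \<sigma> \<longrightarrow> m \<sigma> - m \<tau> \<in> perp n \<tau>)"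

definition choice_of_complements :: "nat \<Rightarrow> cone set \<Rightarrow> (cone \<Rightarrow> qvec set) \<Rightarrow> bool" where
  "choice_of_complements n \<Sigma> \<Psi> \<longleftrightarrow>
     (\<forall>\<sigma>\<in>\<Sigma>. qvec.subspace (\<Psi> \<sigma>) \<and> \<Psi> \<sigma> \<subseteq> qspace n \<and>
        qvec.dim (\<Psi> \<sigma>) = cone_dim \<sigma> \<and> \<Psi> \<sigma> \<inter> perp n \<sigma> = {0}) \<and>
     (\<forall>\<sigma>\<in>\<Sigma>. \<forall>\<tau>\<in>\<Sigma>. proper_face n \<tau> \<sigma> \<longrightarrow> \<Psi> \<tau> \<subseteq> \<Psi> \<sigma>)"

definition complement_proj :: "nat \<Rightarrow> (cone \<Rightarrow> qvec set) \<Rightarrow> cone \<Rightarrow> qvec \<Rightarrow> qvec" where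
  "complement_proj n \<Psi> \<sigma> x = (THE y. y \<in> perp n \<sigma> \<and> x - y \<in> \<Psi> \<sigma>)"

definition psi_action ::
    "nat \<Rightarrow> cone set \<Rightarrow> (cone \<Rightarrow> qvec set) \<Rightarrow> (cone \<Rightarrow> qvec) \<Rightarrow> (cone \<Rightarrow> rat) \<Rightarrow> cone \<Rightarrow> rat" where
  "psi_action n \<Sigma> \<Psi> m z \<tau> =
     (if \<tau> \<in> \<Sigma> then
        \<Sum>\<sigma> | \<sigma> \<in> \<Sigma> \<and> is_facet n \<sigma> \<tau>.
          z \<sigma> * pairing (complement_proj n \<Psi> \<sigma> (m \<tau>)) (normal_gen n \<tau> \<sigma>)
      else 0)"


section \<open>The toric variety as a set of local rings\<close>

text \<open>
  Everything takes place inside the field of fractions of the group algebra of rational vectors,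
  which contains the function field \<open>k(M)\<close> of the torus (\<open>function_field\<close> below). Since the
  exponents are linearly ordered, the group algebra is an integral domain.
\<close>

type_synonym 'k torus_field = "(qvec \<Rightarrow>\<^sub>0 'k) fract"

text \<open>
  \<open>X(\<Sigma>)\<close> is an integral separated scheme, so its points correspond bijectively to their local
  rings, viewed as subrings of the function field (Zariski's and Chevalley's notion of a model).
  A point, and hence the irreducible closed subvariety of which it is the generic point, is
  represented by its local ring.
\<close>

type_synonym 'k point = "'k torus_field set"

definition scalar :: "'k::field \<Rightarrow> 'k torus_field" where
  "scalar c = Fract (Poly_Mapping.single 0 c) 1"

definition character :: "qvec \<Rightarrow> 'k::field torus_field" where
  "character u = Fract (Poly_Mapping.single u 1) 1"

definition monomial_span :: "qvec set \<Rightarrow> 'k::field torus_field set" where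
  "monomial_span S = {Fract p 1 | p. Poly_Mapping.keys p \<subseteq> S}"

definition function_field :: "nat \<Rightarrow> 'k::field torus_field set" where
  "function_field n =
     {a / b | a b. a \<in> monomial_span (lattice_pts n) \<and> b \<in> monomial_span (lattice_pts n) \<and> b \<noteq> 0}"

definition chart_ring :: "nat \<Rightarrow> cone \<Rightarrow> 'k::field torus_field set" where
  "chart_ring n \<sigma> = monomial_span (dual_cone n \<sigma> \<inter> lattice_pts n)"

definition ring_of :: "'a::comm_ring_1 set \<Rightarrow> 'a ring" where
  "ring_of A = \<lparr>carrier = A, monoid.mult = (*), one = 1, ring.zero = 0, add = (+)\<rparr>"

definition chart_primes :: "nat \<Rightarrow> cone \<Rightarrow> 'k::field torus_field set set" where
  "chart_primes n \<sigma> = {P. primeideal P (ring_of (chart_ring n \<sigma>))}"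

definition localize :: "'a::field set \<Rightarrow> 'a set \<Rightarrow> 'a set" where
  "localize A P = {a / b | a b. a \<in> A \<and> b \<in> A \<and> b \<notin> P}"

definition chart :: "nat \<Rightarrow> cone \<Rightarrow> 'k::field point set" where
  "chart n \<sigma> = localize (chart_ring n \<sigma>) ` chart_primes n \<sigma>"

definition toric_variety :: "nat \<Rightarrow> cone set \<Rightarrow> 'k::field point set" where
  "toric_variety n \<Sigma> = (\<Union>\<sigma>\<in>\<Sigma>. chart n \<sigma>)"

definition local_units :: "'a::field set \<Rightarrow> 'a set" where
  "local_units R = {a \<in> R. a \<noteq> 0 \<and> inverse a \<in> R}"

definition max_ideal :: "'a::field set \<Rightarrow> 'a set" where
  "max_ideal R = R - local_units R"

text \<open>
  \<open>in_closure n \<Sigma> v w\<close>: the point \<open>w\<close> lies in the closure of the point \<open>v\<close>, i.e. the subvariety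
  of \<open>w\<close> is contained in that of \<open>v\<close>. Every chart around \<open>w\<close> contains \<open>v\<close>, so this can be read
  off in a single chart.
\<close>

definition in_closure :: "nat \<Rightarrow> cone set \<Rightarrow> 'k::field point \<Rightarrow> 'k point \<Rightarrow> bool" where
  "in_closure n \<Sigma> v w \<longleftrightarrow>
     (\<exists>\<sigma>\<in>\<Sigma>. \<exists>P\<in>chart_primes n \<sigma>. \<exists>Q\<in>chart_primes n \<sigma>. P \<subseteq> Q \<and>
        v = localize (chart_ring n \<sigma>) P \<and> w = localize (chart_ring n \<sigma>) Q)"

definition codim_one :: "nat \<Rightarrow> cone set \<Rightarrow> 'k::field point \<Rightarrow> 'k point \<Rightarrow> bool" where
  "codim_one n \<Sigma> v w \<longleftrightarrow> in_closure n \<Sigma> v w \<and> w \<noteq> v \<and>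
     (\<forall>u. in_closure n \<Sigma> v u \<and> in_closure n \<Sigma> u w \<longrightarrow> u = v \<or> u = w)"

text \<open>
  The dimension of a subvariety is the transcendence degree over \<open>k\<close> of its function field, which
  is the residue field of the local ring \<open>v\<close>. Elements of the residue field are represented by
  elements of \<open>v\<close>, and equality in it is congruence modulo \<open>max_ideal v\<close>.
\<close>

definition residually_alg_indep :: "'k::field point \<Rightarrow> nat \<Rightarrow> (nat \<Rightarrow> 'k torus_field) \<Rightarrow> bool" where
  "residually_alg_indep v d a \<longleftrightarrow> (\<forall>i<d. a i \<in> v) \<and>
     (\<forall>p :: (nat \<Rightarrow>\<^sub>0 nat) \<Rightarrow>\<^sub>0 'k. p \<noteq> 0 \<and> (\<forall>e\<in>Poly_Mapping.keys p. Poly_Mapping.keys e \<subseteq> {..<d}) \<longrightarrow>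
        (\<Sum>e\<in>Poly_Mapping.keys p. scalar (Poly_Mapping.lookup p e) * (\<Prod>i<d. a i ^ Poly_Mapping.lookup e i)) \<notin> max_ideal v)"

definition point_dim :: "'k::field point \<Rightarrow> nat" where
  "point_dim v = Sup {d. \<exists>a. residually_alg_indep v d a}"

text \<open>
  \<open>V(\<sigma>)\<close> is the closure of the orbit of \<open>\<sigma>\<close>, which is the closed subscheme of \<open>U\<^sub>\<sigma>\<close> cut out by the
  characters in \<open>\<sigma>\<^sup>\<or> - \<sigma>\<^sup>\<bottom>\<close>.
\<close>

definition orbit_closure :: "nat \<Rightarrow> cone \<Rightarrow> 'k::field point" where
  "orbit_closure n \<sigma> = localize (chart_ring n \<sigma>)
     (monomial_span ((dual_cone n \<sigma> - perp n \<sigma>) \<inter> lattice_pts n))"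


section \<open>Orders of vanishing and Chow groups\<close>

text \<open>
  The length of the module \<open>R / J\<close>, via chains of ideals of \<open>R\<close> containing \<open>J\<close>. It is used only
  where the length is finite.
\<close>

definition quotient_length :: "'a::comm_ring_1 set \<Rightarrow> 'a set \<Rightarrow> nat" where
  "quotient_length R J = Sup {l. \<exists>I :: nat \<Rightarrow> 'a set.
     (\<forall>i\<le>l. ideal (I i) (ring_of R) \<and> J \<subseteq> I i) \<and> (\<forall>i<l. I i \<subset> I (Suc i))}"

text \<open>
  For \<open>w\<close> of codimension one in \<open>v\<close> with subvarieties \<open>W \<subseteq> V\<close>, the local ring of \<open>V\<close> along \<open>W\<close> is
  \<open>A = w / (max_ideal v \<inter> w)\<close>. For \<open>a \<in> w\<close> with nonzero image in \<open>A\<close>, the first function is the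
  length of \<open>A / aA\<close>. A rational function on \<open>V\<close> is represented by \<open>r \<in> local_units v\<close>, and its
  order along \<open>W\<close> is the difference of these lengths for a numerator \<open>a\<close> and a denominator \<open>b\<close>.
\<close>

definition vanishing_length :: "'k::field point \<Rightarrow> 'k point \<Rightarrow> 'k torus_field \<Rightarrow> nat" where
  "vanishing_length v w a =
     quotient_length w {p + a * c | p c. p \<in> max_ideal v \<inter> w \<and> c \<in> w}"

definition ord_along :: "'k::field point \<Rightarrow> 'k point \<Rightarrow> 'k torus_field \<Rightarrow> int" where
  "ord_along v w r = (THE j. \<exists>a\<in>w - max_ideal v. \<exists>b\<in>w - max_ideal v.
     b * r - a \<in> max_ideal v \<and> j = int (vanishing_length v w a) - int (vanishing_length v w b))"

text \<open>
  The Weil divisor on the subvariety of \<open>v\<close> with local equation \<open>c w \<in> local_units v\<close> at each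
  point \<open>w\<close>.
\<close>

definition weil_divisor ::
    "nat \<Rightarrow> cone set \<Rightarrow> 'k::field point \<Rightarrow> ('k point \<Rightarrow> 'k torus_field) \<Rightarrow> 'k point \<Rightarrow> rat" where
  "weil_divisor n \<Sigma> v c w = (if codim_one n \<Sigma> v w then of_int (ord_along v w (c w)) else 0)"

definition cycles :: "nat \<Rightarrow> cone set \<Rightarrow> int \<Rightarrow> ('k::field point \<Rightarrow> rat) set" where
  "cycles n \<Sigma> k = {z. finite {v. z v \<noteq> 0} \<and>
     (\<forall>v. z v \<noteq> 0 \<longrightarrow> v \<in> toric_variety n \<Sigma> \<and> int (point_dim v) = k)}"

definition rationally_trivial :: "nat \<Rightarrow> cone set \<Rightarrow> int \<Rightarrow> ('k::field point \<Rightarrow> rat) set" where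
  "rationally_trivial n \<Sigma> k = module.span (\<lambda>c f v. c * f v)
     {weil_divisor n \<Sigma> v (\<lambda>_. r) | v r.
        v \<in> toric_variety n \<Sigma> \<and> int (point_dim v) = k + 1 \<and>
        r \<in> local_units v}"

text \<open>
  The class of a \<open>k\<close>-cycle in \<open>A\<^sub>k(X)\<^sub>\<rat>\<close>, as a coset.
\<close>

definition chow_class ::
    "nat \<Rightarrow> cone set \<Rightarrow> int \<Rightarrow> ('k::field point \<Rightarrow> rat) \<Rightarrow> ('k point \<Rightarrow> rat) set" where
  "chow_class n \<Sigma> k z = {w \<in> cycles n \<Sigma> k. w - z \<in> rationally_trivial n \<Sigma> k}"

definition geometric_cycle :: "nat \<Rightarrow> cone set \<Rightarrow> (cone \<Rightarrow> rat) \<Rightarrow> 'k::field point \<Rightarrow> rat" where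
  "geometric_cycle n \<Sigma> z v = (\<Sum>\<sigma>\<in>\<Sigma>. if v = orbit_closure n \<sigma> then z \<sigma> else 0)"


section \<open>Intersection with Cartier divisors\<close>

text \<open>
  A Cartier divisor on \<open>X\<close> is given by a local equation \<open>f x \<in> k(X)\<^sup>*\<close> at every point \<open>x\<close>, such that
  \<open>f x\<close> is a local equation at all points of some neighbourhood of \<open>x\<close>, which may be taken to be
  a principal open subset of a chart.
\<close>

definition cartier_divisor ::
    "nat \<Rightarrow> cone set \<Rightarrow> ('k::field point \<Rightarrow> 'k torus_field) \<Rightarrow> bool" where
  "cartier_divisor n \<Sigma> f \<longleftrightarrow>
     (\<forall>x\<in>toric_variety n \<Sigma>. f x \<in> function_field n - {0} \<and>
        (\<exists>\<sigma>\<in>\<Sigma>. \<exists>P\<in>chart_primes n \<sigma>. \<exists>g\<in>chart_ring n \<sigma> - P.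
           x = localize (chart_ring n \<sigma>) P \<and>
           (\<forall>Q\<in>chart_primes n \<sigma>. g \<notin> Q \<longrightarrow>
              f x / f (localize (chart_ring n \<sigma>) Q)
                \<in> local_units (localize (chart_ring n \<sigma>) Q))))"

text \<open>
  The Cartier divisor \<open>f\<close> is the multiple \<open>d D\<close> of the equivariant \<open>\<rat>\<close>-Cartier divisor \<open>D\<close> given
  by \<open>m\<close>: on each \<open>U\<^sub>\<sigma>\<close> it has a local equation \<open>\<chi>\<^sup>u\<close>, with \<open>u \<in> M\<close> representing \<open>d m\<^sub>\<sigma>\<close>.
\<close>

definition is_cartier_multiple ::
    "nat \<Rightarrow> cone set \<Rightarrow> nat \<Rightarrow> (cone \<Rightarrow> qvec) \<Rightarrow> ('k::field point \<Rightarrow> 'k torus_field) \<Rightarrow> bool" where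
  "is_cartier_multiple n \<Sigma> d m f \<longleftrightarrow> cartier_divisor n \<Sigma> f \<and>
     (\<forall>\<sigma>\<in>\<Sigma>. \<exists>u\<in>lattice_pts n. u - qscale (of_nat d) (m \<sigma>) \<in> perp n \<sigma> \<and>
        (\<forall>x\<in>chart n \<sigma>. f x / character u \<in> local_units x))"

text \<open>
  The Cartier divisor \<open>D\<close> given by \<open>f\<close> is linearly equivalent to \<open>D - div (f v)\<close>, whose support
  does not contain the subvariety \<open>V\<close> of \<open>v\<close>; its restriction to \<open>V\<close> is a Cartier divisor with
  local equations \<open>f w / f v\<close> and with line bundle isomorphic to \<open>\<O>(D)\<close> restricted to \<open>V\<close>.
  The class of the associated Weil divisor is \<open>D \<cdot> [V]\<close> (Fulton, Intersection Theory, 2.3).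
  The following cycle represents \<open>D \<cdot> z\<close> for an arbitrary cycle \<open>z\<close>.
\<close>

definition cartier_dot ::
    "nat \<Rightarrow> cone set \<Rightarrow> ('k::field point \<Rightarrow> 'k torus_field) \<Rightarrow> ('k point \<Rightarrow> rat) \<Rightarrow> 'k point \<Rightarrow> rat"
  where
  "cartier_dot n \<Sigma> f z w =
     (\<Sum>v | z v \<noteq> 0. z v * weil_divisor n \<Sigma> v (\<lambda>x. f x / f v) w)"

text \<open>
  The class in \<open>A\<^sub>k\<^sub>-\<^sub>1(X)\<^sub>\<rat>\<close> of the intersection of \<open>D\<close> with a \<open>k\<close>-cycle \<open>z\<close>. It is \<open>1/d\<close> times
  the intersection of \<open>z\<close> with a Cartier multiple \<open>d D\<close>, and does not depend on the chosen multiple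
  or on its local equations.
\<close>

definition intersection_class ::
    "nat \<Rightarrow> cone set \<Rightarrow> int \<Rightarrow> (cone \<Rightarrow> qvec) \<Rightarrow> ('k::field point \<Rightarrow> rat) \<Rightarrow> ('k point \<Rightarrow> rat) set" where
  "intersection_class n \<Sigma> k m z =
     (let (d, f) = SOME (d, f). d > 0 \<and> is_cartier_multiple n \<Sigma> d m f
      in chow_class n \<Sigma> (k - 1) (\<lambda>w. cartier_dot n \<Sigma> f z w / of_nat d))"

text \<open>
  \<open>\<Phi>\<close> is the operation \<open>D \<cdot> _ : A\<^sub>k(X)\<^sub>\<rat> \<rightarrow> A\<^sub>k\<^sub>-\<^sub>1(X)\<^sub>\<rat>\<close> induced by the preceding construction
  on representatives. That it exists, i.e. that the construction respects rational equivalence, is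
  a theorem of intersection theory (Fulton, Intersection Theory, 2.4).
\<close>

definition is_chow_intersection ::
    "nat \<Rightarrow> cone set \<Rightarrow> int \<Rightarrow> (cone \<Rightarrow> qvec) \<Rightarrow>
      (('k::field point \<Rightarrow> rat) set \<Rightarrow> ('k point \<Rightarrow> rat) set) \<Rightarrow> bool" where
  "is_chow_intersection n \<Sigma> k m \<Phi> \<longleftrightarrow>
     (\<forall>z\<in>cycles n \<Sigma> k. \<Phi> (chow_class n \<Sigma> k z) = intersection_class n \<Sigma> k m z)"

end

theory Submission
  imports Defs
begin

text \<open>
  Fix \<open>\<sigma>\<close> and let \<open>v\<close> be the generic point of \<open>V(\<sigma>)\<close>. On every chart \<open>U\<^sub>\<tau>\<close>, a Cartier
  multiple \<open>d D\<close> has as local equation the character of some \<open>u\<^sub>\<tau>\<close> representing \<open>d m\<^sub>\<tau>\<close>.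
  Modulo divisors of rational functions on \<open>V(\<sigma>)\<close>, the intersection with \<open>V(\<sigma>)\<close> is the divisor
  with local equations the characters of \<open>u\<^sub>\<tau> - u\<^sub>\<sigma> + q\<close>, for any \<open>q\<close> in \<open>\<sigma>\<^sup>\<bottom>\<close>; the choice of
  complements singles out one rational \<open>q\<close>. On the orbit of \<open>\<sigma>\<close> these characters are units, so
  only the points \<open>V(\<tau>)\<close> with \<open>\<tau> \<rightarrow> \<sigma>\<close> contribute. There the local ring of \<open>V(\<sigma>)\<close> is a discrete
  valuation ring whose uniformizer is the character that is primitive in \<open>\<sigma>\<^sup>\<bottom>\<close> modulo \<open>\<tau>\<^sup>\<bottom>\<close>,
  and the valuation of a character is its pairing with the normal generator. At all other
  points of codimension one, only invariance of the order of vanishing under units is needed,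
  so no length theory for general one-dimensional local rings enters.
\<close>

section \<open>The pairing and orthogonal complements\<close>

text \<open>The notions to be computed are given by description (\<open>THE\<close> for orders,
  \<open>SOME\<close> for the Cartier multiple, suprema for lengths and dimensions), so each value
  has to be earned. At a codimension one point of the orbit of \<open>\<sigma>\<close>, a local
  equation differs from the one at the generic point by a unit times a fixed rational function; the
  order of that function appears in both cycles and cancels uncomputed. Additivity of orders is
  proved only at the points V(\<open>\<tau>\<close>), where every element is a power of the
  uniformizer times a unit, up to the ideal of V(\<open>\<sigma>\<close>). The vector q is merely
  rational: a multiple N q is a lattice vector, and the divisor of its character is divided by N, so
  rational coefficients are essential. A divisor on V(\<open>\<sigma>\<close>) is a relation in
  degree k - 1 only if V(\<open>\<sigma>\<close>) has dimension exactly k. With dimension defined as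
  a transcendence degree, this takes two bounds: characters of a basis of
  \<open>\<sigma>\<^sup>\<bottom>\<close> give the lower one, and counting monomials against
  characters the upper one. The value 1 of the uniformizer's exponent on the normal generator is a
  divisibility statement about lattices.\<close>

lemma pairing_superset:
  assumes "finite S" "Poly_Mapping.keys u \<subseteq> S"
  shows "pairing u v = (\<Sum>i\<in>S. Poly_Mapping.lookup u i * Poly_Mapping.lookup v i)"
  unfolding pairing_def using assms
  by (intro sum.mono_neutral_left) (auto simp: in_keys_iff)

lemma pairing_commute: "pairing u v = pairing v u"
proof -
  let ?S = "Poly_Mapping.keys u \<union> Poly_Mapping.keys v"
  have "pairing u v = (\<Sum>i\<in>?S. Poly_Mapping.lookup u i * Poly_Mapping.lookup v i)"
    by (rule pairing_superset) auto
  also have "\<dots> = (\<Sum>i\<in>?S. Poly_Mapping.lookup v i * Poly_Mapping.lookup u i)"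
    by (simp add: mult.commute)
  also have "\<dots> = pairing v u"
    by (rule pairing_superset[symmetric]) auto
  finally show ?thesis .
qed

lemma pairing_add_right: "pairing u (v + w) = pairing u v + pairing u w"
  by (simp add: pairing_def lookup_add algebra_simps sum.distrib)

lemma pairing_scale_right: "pairing u (qscale c v) = c * pairing u v"
  by (simp add: pairing_def sum_distrib_left algebra_simps)

lemma pairing_add_left: "pairing (v + w) u = pairing v u + pairing w u"
  by (simp add: pairing_commute[of _ u] pairing_add_right)

lemma pairing_scale_left: "pairing (qscale c v) u = c * pairing v u"
  by (simp add: pairing_commute[of _ u] pairing_scale_right)

lemma pairing_zero_left: "pairing 0 u = 0" and pairing_zero_right: "pairing u 0 = 0"
  by (simp_all add: pairing_def)

lemma pairing_minus_left: "pairing (- v) u = - pairing v u"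
  using pairing_add_left[of v "- v" u] by (simp add: pairing_zero_left)

lemma pairing_minus_right: "pairing u (- v) = - pairing u v"
  by (simp add: pairing_commute[of u] pairing_minus_left)

lemma pairing_diff_left: "pairing (v - w) u = pairing v u - pairing w u"
  using pairing_add_left[of v "- w" u] by (simp add: pairing_minus_left)

lemma pairing_diff_right: "pairing u (v - w) = pairing u v - pairing u w"
  by (simp add: pairing_commute[of u] pairing_diff_left)

lemma pairing_sum_right: "pairing u (\<Sum>i\<in>I. f i) = (\<Sum>i\<in>I. pairing u (f i))"
  by (induction I rule: infinite_finite_induct) (simp_all add: pairing_zero_right pairing_add_right)

lemma pairing_sum_left: "pairing (\<Sum>i\<in>I. f i) u = (\<Sum>i\<in>I. pairing (f i) u)"
  by (simp add: pairing_commute[of _ u] pairing_sum_right)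

lemmas pairing_linear = pairing_add_left pairing_add_right pairing_scale_left pairing_scale_right
  pairing_zero_left pairing_zero_right pairing_minus_left pairing_minus_right
  pairing_diff_left pairing_diff_right pairing_sum_left pairing_sum_right

lemma pairing_self_nonneg: "pairing u u \<ge> 0"
  unfolding pairing_def by (intro sum_nonneg) simp

lemma pairing_self_eq_0_iff: "pairing u u = 0 \<longleftrightarrow> u = 0"
proof
  assume "pairing u u = 0"
  then have "\<forall>i\<in>Poly_Mapping.keys u. Poly_Mapping.lookup u i * Poly_Mapping.lookup u i = 0"
    unfolding pairing_def by (subst (asm) sum_nonneg_eq_0_iff) auto
  then show "u = 0"
    by (intro poly_mapping_eqI) (metis lookup_zero mult_eq_0_iff not_in_keys_iff_lookup_eq_zero)
qed (simp add: pairing_linear)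

lemma qspace_iff: "v \<in> qspace n \<longleftrightarrow> (\<forall>i\<ge>n. Poly_Mapping.lookup v i = 0)"
  unfolding qspace_def subset_iff in_keys_iff mem_Collect_eq lessThan_iff by (meson not_less)

lemma subspace_qspace: "qvec.subspace (qspace n)"
  by (simp add: qvec.subspace_def qspace_iff lookup_add)

lemmas qspace_closed =
  qvec.subspace_add[OF subspace_qspace] qvec.subspace_diff[OF subspace_qspace]
  qvec.subspace_neg[OF subspace_qspace] qvec.subspace_scale[OF subspace_qspace]
  qvec.subspace_0[OF subspace_qspace] qvec.subspace_sum[OF subspace_qspace]

lemma perp_qspace: "u \<in> perp n \<sigma> \<Longrightarrow> u \<in> qspace n"
  by (simp add: perp_def)

lemma subspace_perp: "qvec.subspace (perp n \<sigma>)"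
  unfolding qvec.subspace_def perp_def by (auto simp: pairing_linear qspace_closed)

lemmas perp_closed =
  qvec.subspace_add[OF subspace_perp] qvec.subspace_diff[OF subspace_perp]
  qvec.subspace_neg[OF subspace_perp] qvec.subspace_scale[OF subspace_perp]
  qvec.subspace_0[OF subspace_perp] qvec.subspace_sum[OF subspace_perp]

lemma perp_antimono: "\<sigma> \<subseteq> \<tau> \<Longrightarrow> perp n \<tau> \<subseteq> perp n \<sigma>"
  by (auto simp: perp_def)

text \<open>Together with \<open>span_minimal\<close> this extends vanishing from generators to
  spans.\<close>

lemma subspace_annihilator: "qvec.subspace {v. pairing u v = 0}"
  by (auto simp: qvec.subspace_def pairing_linear)

lemma perp_span: "u \<in> perp n \<sigma> \<Longrightarrow> v \<in> qvec.span \<sigma> \<Longrightarrow> pairing u v = 0"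
  using qvec.span_minimal[OF _ subspace_annihilator, of \<sigma> u] by (auto simp: perp_def)

lemma lattice_qspace: "u \<in> lattice_pts n \<Longrightarrow> u \<in> qspace n"
  by (simp add: lattice_pts_def)

lemma lattice_zero: "0 \<in> lattice_pts n"
  and lattice_add: "u \<in> lattice_pts n \<Longrightarrow> v \<in> lattice_pts n \<Longrightarrow> u + v \<in> lattice_pts n"
  and lattice_diff: "u \<in> lattice_pts n \<Longrightarrow> v \<in> lattice_pts n \<Longrightarrow> u - v \<in> lattice_pts n"
  and lattice_minus: "u \<in> lattice_pts n \<Longrightarrow> - u \<in> lattice_pts n"
  and lattice_scale: "c \<in> \<int> \<Longrightarrow> u \<in> lattice_pts n \<Longrightarrow> qscale c u \<in> lattice_pts n"
  by (auto simp: lattice_pts_def qspace_closed lookup_add lookup_minus)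

lemmas lattice_closed = lattice_zero lattice_add lattice_diff lattice_minus lattice_scale

lemma lattice_sum: "(\<And>i. i \<in> I \<Longrightarrow> f i \<in> lattice_pts n) \<Longrightarrow> sum f I \<in> lattice_pts n"
  by (induction I rule: infinite_finite_induct) (auto simp: lattice_closed)

lemma pairing_lattice_Ints: "u \<in> lattice_pts n \<Longrightarrow> v \<in> lattice_pts n \<Longrightarrow> pairing u v \<in> \<int>"
  unfolding pairing_def by (intro Ints_sum Ints_mult) (auto simp: lattice_pts_def)

lemma rat_clear_denominator: "\<exists>d::nat. d > 0 \<and> of_nat d * (x::rat) \<in> \<int>"
proof (cases x)
  case (Fract a b)
  then have "of_nat (nat b) * x = of_int a"
    by (simp add: Fract_of_int_quotient)
  then show ?thesis
    using Fract by (intro exI[of _ "nat b"]) auto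
qed

lemma finite_clear_denominators:
  "finite (X :: rat set) \<Longrightarrow> \<exists>d::nat. d > 0 \<and> (\<forall>x\<in>X. of_nat d * x \<in> \<int>)"
proof (induction rule: finite_induct)
  case (insert x X)
  then obtain d where d: "d > 0" "\<forall>x\<in>X. of_nat d * x \<in> \<int>" by blast
  obtain e :: nat where e: "e > 0" "of_nat e * x \<in> \<int>" using rat_clear_denominator by blast
  have "of_nat (d * e) * y \<in> \<int>" if "y \<in> insert x X" for y
  proof (cases "y = x")
    case True
    have "of_nat (d * e) * y = of_nat d * (of_nat e * x)" by (simp add: True)
    then show ?thesis using e by (metis Ints_mult Ints_of_nat)
  next
    case False
    have "of_nat (d * e) * y = of_nat e * (of_nat d * y)" by simp
    then show ?thesis using d that False by (metis Ints_mult Ints_of_nat insertE)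
  qed
  then show ?case using d e by (intro exI[of _ "d * e"]) auto
qed (use zero_less_one in blast)

lemma lattice_clear_denominators:
  assumes "finite S" "S \<subseteq> qspace n"
  shows "\<exists>d::nat. d > 0 \<and> (\<forall>v\<in>S. qscale (of_nat d) v \<in> lattice_pts n)"
proof -
  have "finite (\<Union>v\<in>S. Poly_Mapping.range v)" using assms by simp
  then obtain d :: nat where d: "d > 0" "\<forall>x\<in>(\<Union>v\<in>S. Poly_Mapping.range v). of_nat d * x \<in> \<int>"
    using finite_clear_denominators by blast
  have "of_nat d * Poly_Mapping.lookup v i \<in> \<int>" if "v \<in> S" for v i
    using d(2) that by (cases "i \<in> Poly_Mapping.keys v") (auto simp: in_keys_iff)
  then show ?thesis using d(1) assms(2)
    by (intro exI[of _ d]) (auto simp: lattice_pts_def qspace_closed)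
qed

text \<open>Gram-Schmidt, one vector at a time: \<open>b2\<close> is the part of the new vector
  orthogonal to the old span, and a multiple of it corrects the old projection \<open>s\<close>. The
  vectors may be dependent; if \<open>b2 = 0\<close>, the correction is zero.\<close>

lemma orthogonal_projection:
  assumes "finite S"
  shows "\<exists>s\<in>qvec.span S. \<forall>y\<in>S. pairing (x - s) y = 0"
  using assms
proof (induction arbitrary: x rule: finite_induct)
  case (insert b S)
  obtain b1 where b1: "b1 \<in> qvec.span S" "\<forall>y\<in>S. pairing (b - b1) y = 0" using insert.IH by blast
  obtain s where s: "s \<in> qvec.span S" "\<forall>y\<in>S. pairing (x - s) y = 0" using insert.IH by blast
  define b2 where "b2 = b - b1"
  define t where "t = s + qscale (pairing (x - s) b2 / pairing b2 b2) b2"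
  have sub: "qvec.span S \<subseteq> qvec.span (insert b S)" by (rule qvec.span_mono) auto
  have b: "b \<in> qvec.span (insert b S)" by (simp add: qvec.span_base)
  have t: "t \<in> qvec.span (insert b S)"
    unfolding t_def b2_def using sub s b1 b
    by (intro qvec.span_add qvec.span_scale qvec.span_diff) auto
  have orth: "pairing (x - t) y = 0" if "y \<in> S" for y
    using s b1 that by (simp add: t_def b2_def pairing_linear)
  have orth': "pairing (x - t) y = 0" if "y \<in> qvec.span S" for y
    using qvec.span_minimal[OF _ subspace_annihilator, of S "x - t"] orth that by blast
  have "pairing (x - t) b2 = 0"
    by (cases "b2 = 0")
       (simp_all add: t_def pairing_diff_left pairing_add_left pairing_scale_left pairing_zero_right
          pairing_self_eq_0_iff)
  then have "pairing (x - t) b = 0"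
    using orth'[OF b1(1)] by (simp add: b2_def pairing_diff_right)
  then show ?case using t orth by blast
qed simp

section \<open>Bases, dimension counts and orthogonal decompositions\<close>

lemma qspace_basis:
  "qvec.independent ((\<lambda>i. Poly_Mapping.single i 1) ` {..<n})"
  "qvec.span ((\<lambda>i. Poly_Mapping.single i 1) ` {..<n}) = qspace n"
proof -
  let ?e = "\<lambda>i::nat. Poly_Mapping.single i (1::rat)"
  have inj: "inj_on ?e A" for A 
    by (rule inj_onI) (metis lookup_single_eq lookup_single_not_eq zero_neq_one)
  show "qvec.independent (?e ` {..<n})"
  proof (rule qvec.independent_if_scalars_zero)
    fix f x assume 0: "(\<Sum>x\<in>?e ` {..<n}. qscale (f x) x) = 0" and "x \<in> ?e ` {..<n}"
    then obtain i where i: "i < n" "x = ?e i" by auto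
    have "0 = Poly_Mapping.lookup (\<Sum>j<n. qscale (f (?e j)) (?e j)) i"
      using 0 by (simp add: sum.reindex[OF inj])
    also have "\<dots> = (\<Sum>j<n. f (?e j) * (1 when j = i))"
      by (simp add: lookup_sum lookup_single)
    also have "\<dots> = (\<Sum>j<n. if j = i then f (?e j) else 0)"
      by (intro sum.cong) (auto simp: when_def)
    also have "\<dots> = f x" using i by simp
    finally show "f x = 0" by simp
  qed simp
  show "qvec.span (?e ` {..<n}) = qspace n"
  proof
    show "qvec.span (?e ` {..<n}) \<subseteq> qspace n"
      by (intro qvec.span_minimal subspace_qspace) (auto simp: qspace_def)
    show "qspace n \<subseteq> qvec.span (?e ` {..<n})"
    proof
      fix v assume v: "v \<in> qspace n"
      have "v = (\<Sum>j<n. qscale (Poly_Mapping.lookup v j) (?e j))"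
      proof (rule poly_mapping_eqI)
        fix i
        have "Poly_Mapping.lookup (\<Sum>j<n. qscale (Poly_Mapping.lookup v j) (?e j)) i
            = (\<Sum>j<n. if j = i then Poly_Mapping.lookup v j else 0)"
          unfolding lookup_sum by (intro sum.cong) (auto simp: lookup_single when_def)
        also have "\<dots> = Poly_Mapping.lookup v i" using v by (auto simp: qspace_iff)
        finally show "Poly_Mapping.lookup v i
          = Poly_Mapping.lookup (\<Sum>j<n. qscale (Poly_Mapping.lookup v j) (?e j)) i" ..
      qed
      also have "\<dots> \<in> qvec.span (?e ` {..<n})"
        by (intro qvec.span_sum qvec.span_scale qvec.span_base) auto
      finally show "v \<in> qvec.span (?e ` {..<n})" .
    qed
  qed
qed


lemma qspace_finite_basis:
  assumes "V \<subseteq> qspace n"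
  obtains B where "B \<subseteq> V" "finite B" "qvec.independent B" "V \<subseteq> qvec.span B" "card B = qvec.dim V"
proof -
  obtain B where B: "B \<subseteq> V" "qvec.independent B" "V \<subseteq> qvec.span B" "card B = qvec.dim V"
    by (rule qvec.basis_exists)
  have "finite B"
    using qvec.independent_span_bound[OF _ B(2), of "(\<lambda>i. Poly_Mapping.single i 1) ` {..<n}"]
      B(1) assms by (auto simp: qspace_basis)
  then show ?thesis using B that by blast
qed

lemma card_qspace_basis: "card ((\<lambda>i. Poly_Mapping.single i (1::rat)) ` {..<n}) = n"
proof -
  have "inj_on (\<lambda>i. Poly_Mapping.single i (1::rat)) {..<n}"
    by (rule inj_onI) (metis lookup_single_eq lookup_single_not_eq zero_neq_one)
  then show ?thesis by (simp add: card_image)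
qed

lemma qspace_independent_card_le:
  assumes "B \<subseteq> qspace n" "qvec.independent B"
  shows "finite B" "card B \<le> n"
  using qvec.independent_span_bound[OF _ assms(2), of "(\<lambda>i. Poly_Mapping.single i 1) ` {..<n}"]
    assms(1) by (auto simp: qspace_basis card_qspace_basis)

lemma qspace_independent_card_eq_span:
  assumes "B \<subseteq> qspace n" "qvec.independent B" "card B = n"
  shows "qspace n \<subseteq> qvec.span B"
proof
  fix x assume x: "x \<in> qspace n"
  show "x \<in> qvec.span B"
  proof (rule ccontr)
    assume "x \<notin> qvec.span B"
    then have "qvec.independent (insert x B)" "x \<notin> B"
      using assms(2) qvec.independent_insertI qvec.span_base by auto
    then show False
      using qspace_independent_card_le[of "insert x B" n] x assms by auto
  qed
qed

lemma independent_Un_trivial_Int: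
  assumes "finite B" "finite C" "qvec.independent B" "qvec.independent C"
    and "qvec.span B \<inter> qvec.span C = {0}"
  shows "qvec.independent (B \<union> C)" "B \<inter> C = {}"
proof -
  have "x = 0" if "x \<in> B \<inter> C" for x
    using that assms(5) qvec.span_base[of x B] qvec.span_base[of x C] by blast
  then show disj: "B \<inter> C = {}" using assms(3) qvec.dependent_zero by blast
  show "qvec.independent (B \<union> C)"
  proof (rule qvec.independent_if_scalars_zero)
    fix f x
    assume 0: "(\<Sum>x\<in>B \<union> C. qscale (f x) x) = 0" and x: "x \<in> B \<union> C"
    define b where "b = (\<Sum>x\<in>B. qscale (f x) x)"
    define c where "c = (\<Sum>x\<in>C. qscale (f x) x)"
    have bc: "b + c = 0"
      using 0 disj assms(1,2) by (simp add: sum.union_disjoint b_def c_def)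
    have bB: "b \<in> qvec.span B" unfolding b_def
      by (intro qvec.span_sum qvec.span_scale qvec.span_base)
    have cC: "c \<in> qvec.span C" unfolding c_def
      by (intro qvec.span_sum qvec.span_scale qvec.span_base)
    have "b = - c" using bc by (simp add: eq_neg_iff_add_eq_0)
    then have "b \<in> qvec.span B \<inter> qvec.span C" using bB qvec.span_neg[OF cC] by simp
    then have "b = 0" using assms(5) by blast
    with bc have "c = 0" by simp
    have "f x = 0" if "x \<in> B" for x
      using qvec.independentD[OF assms(3,1) order.refl _ that, of f] \<open>b = 0\<close> by (simp add: b_def)
    moreover have "f x = 0" if "x \<in> C" for x
      using qvec.independentD[OF assms(4,2) order.refl _ that, of f] \<open>c = 0\<close> by (simp add: c_def)
    ultimately show "f x = 0" using x by blast
  qed (use assms in auto)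
qed

text \<open>The dot product on rational vectors is positive definite, so with \<open>M\<close> and
  \<open>N\<close> in the same coordinate space, \<open>\<sigma>\<^sup>\<bottom>\<close> is an
  orthogonal complement of the span of \<open>\<sigma>\<close>.\<close>

lemma perp_decomposition:
  assumes "\<sigma> \<subseteq> qspace n" "x \<in> qspace n"
  obtains s where "s \<in> qvec.span \<sigma>" "s \<in> qspace n" "x - s \<in> perp n \<sigma>"
proof -
  obtain B where B: "B \<subseteq> \<sigma>" "finite B" "\<sigma> \<subseteq> qvec.span B"
    using qspace_finite_basis[OF assms(1)] by metis
  obtain s where s: "s \<in> qvec.span B" "\<forall>y\<in>B. pairing (x - s) y = 0"
    using orthogonal_projection[OF B(2)] by blast
  have "pairing (x - s) y = 0" if "y \<in> \<sigma>" for y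
    using qvec.span_minimal[OF _ subspace_annihilator, of B "x - s"] s that B(3) by blast
  moreover have "s \<in> qvec.span \<sigma>" using s(1) qvec.span_mono[OF B(1)] by blast
  moreover have "s \<in> qspace n"
    using qvec.span_minimal[OF assms(1) subspace_qspace] calculation by blast
  ultimately show thesis using assms(2) that by (auto simp: perp_def qspace_closed)
qed

lemma span_Int_perp: "qvec.span \<sigma> \<inter> perp n \<sigma> = {0}"
  using perp_span pairing_self_eq_0_iff by (fastforce simp: qvec.span_zero perp_closed)

text \<open>Double annihilator: the component of \<open>x\<close> in
  \<open>\<sigma>\<^sup>\<bottom>\<close> is orthogonal to \<open>x\<close> and to the span, hence
  to itself.\<close>

lemma span_eq_annihilator_perp:
  assumes "\<sigma> \<subseteq> qspace n" "x \<in> qspace n" "\<And>u. u \<in> perp n \<sigma> \<Longrightarrow> pairing u x = 0"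
  shows "x \<in> qvec.span \<sigma>"
proof -
  obtain s where s: "s \<in> qvec.span \<sigma>" "x - s \<in> perp n \<sigma>"
    using perp_decomposition[OF assms(1,2)] by metis
  have "pairing (x - s) (x - s) = 0"
    unfolding pairing_diff_right[of _ x s] using assms(3)[OF s(2)] perp_span[OF s(2,1)] by simp
  then have "x = s" by (simp add: pairing_self_eq_0_iff)
  then show ?thesis using s by simp
qed

text \<open>Both directions serve: forwards it computes the dimension of \<open>perp\<close>,
  backwards it shows that a complement of the right dimension fills up the space.\<close>

lemma dim_direct_sum:
  assumes "qvec.subspace U" "qvec.subspace W" "U \<subseteq> qspace n" "W \<subseteq> qspace n" "U \<inter> W = {0}"
  shows "qspace n \<subseteq> {u + w |u w. u \<in> U \<and> w \<in> W} \<longleftrightarrow> qvec.dim U + qvec.dim W = n"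
proof -
  obtain B where B: "B \<subseteq> U" "finite B" "qvec.independent B" "U \<subseteq> qvec.span B" "card B = qvec.dim U"
    using qspace_finite_basis[OF assms(3)] .
  obtain C where C: "C \<subseteq> W" "finite C" "qvec.independent C" "W \<subseteq> qvec.span C" "card C = qvec.dim W"
    using qspace_finite_basis[OF assms(4)] .
  have span: "qvec.span B = U" "qvec.span C = W"
    using qvec.span_minimal[OF B(1) assms(1)] qvec.span_minimal[OF C(1) assms(2)] B(4) C(4)
    by (simp_all add: subset_antisym)
  have ind: "qvec.independent (B \<union> C)" "B \<inter> C = {}"
    using independent_Un_trivial_Int[of B C] B C assms(5) span by auto
  have card: "card (B \<union> C) = qvec.dim U + qvec.dim W"
    using B C ind by (simp add: card_Un_disjoint)
  have sp: "{u + w |u w. u \<in> U \<and> w \<in> W} = qvec.span (B \<union> C)"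
    by (simp add: qvec.span_Un span)
  have BC: "B \<union> C \<subseteq> qspace n" using B C assms by blast
  show ?thesis
  proof
    assume "qspace n \<subseteq> {u + w |u w. u \<in> U \<and> w \<in> W}"
    then have "n \<le> card (B \<union> C)"
      using qvec.independent_span_bound[OF _ qspace_basis(1)[of n], of "B \<union> C"] B C
        qvec.span_superset[of "(\<lambda>i. Poly_Mapping.single i (1::rat)) ` {..<n}"]
      by (auto simp: sp qspace_basis card_qspace_basis)
    then show "qvec.dim U + qvec.dim W = n"
      using qspace_independent_card_le(2)[OF BC ind(1)] card by simp
  next
    assume "qvec.dim U + qvec.dim W = n"
    then show "qspace n \<subseteq> {u + w |u w. u \<in> U \<and> w \<in> W}"
      using qspace_independent_card_eq_span[OF BC ind(1)] card sp by simp
  qed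
qed

lemma dim_perp:
  assumes "\<sigma> \<subseteq> qspace n"
  shows "cone_dim \<sigma> + qvec.dim (perp n \<sigma>) = n"
proof -
  have "qspace n \<subseteq> {u + w |u w. u \<in> qvec.span \<sigma> \<and> w \<in> perp n \<sigma>}"
  proof
    fix x assume "x \<in> qspace n"
    then obtain s where "s \<in> qvec.span \<sigma>" "x - s \<in> perp n \<sigma>"
      using perp_decomposition[OF assms] by metis
    then show "x \<in> {u + w |u w. u \<in> qvec.span \<sigma> \<and> w \<in> perp n \<sigma>}"
      by (intro CollectI exI[of _ s] exI[of _ "x - s"]) auto
  qed
  moreover have "perp n \<sigma> \<subseteq> qspace n" using perp_qspace by blast
  ultimately show ?thesis
    using dim_direct_sum[of "qvec.span \<sigma>" "perp n \<sigma>" n] span_Int_perp[of \<sigma> n]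
      qvec.span_minimal[OF assms subspace_qspace]
    by (simp add: cone_dim_def subspace_perp)
qed

text \<open>This justifies the \<open>THE\<close> in the definition: the dimension count gives a
  decomposition, and the trivial intersection makes it unique.\<close>

lemma complement_proj:
  assumes "\<sigma> \<subseteq> qspace n" "qvec.subspace (\<Psi> \<sigma>)" "\<Psi> \<sigma> \<subseteq> qspace n" "qvec.dim (\<Psi> \<sigma>) = cone_dim \<sigma>"
    "\<Psi> \<sigma> \<inter> perp n \<sigma> = {0}" "x \<in> qspace n"
  shows "complement_proj n \<Psi> \<sigma> x \<in> perp n \<sigma>" "x - complement_proj n \<Psi> \<sigma> x \<in> \<Psi> \<sigma>"
proof -
  have "perp n \<sigma> \<subseteq> qspace n" using perp_qspace by blast
  then have "qspace n \<subseteq> {u + w |u w. u \<in> \<Psi> \<sigma> \<and> w \<in> perp n \<sigma>}"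
    using dim_direct_sum[OF assms(2) subspace_perp assms(3) _ assms(5)] dim_perp[OF assms(1)]
      assms(4) by simp
  then obtain p w where pw: "x = p + w" "p \<in> \<Psi> \<sigma>" "w \<in> perp n \<sigma>" using assms(6) by blast
  have "\<exists>!y. y \<in> perp n \<sigma> \<and> x - y \<in> \<Psi> \<sigma>"
  proof (rule ex1I[of _ w])
    show "w \<in> perp n \<sigma> \<and> x - w \<in> \<Psi> \<sigma>" using pw by simp
  next
    fix y assume y: "y \<in> perp n \<sigma> \<and> x - y \<in> \<Psi> \<sigma>"
    have "w - y = (x - y) - p" using pw(1) by simp
    then have "w - y \<in> \<Psi> \<sigma>" using y pw(2) assms(2) qvec.subspace_diff by metis
    moreover have "w - y \<in> perp n \<sigma>" using y pw by (simp add: perp_closed)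
    ultimately have "w - y \<in> {0}" using assms(5) by blast
    then show "y = w" by simp
  qed
  from theI'[OF this] show "complement_proj n \<Psi> \<sigma> x \<in> perp n \<sigma>" "x - complement_proj n \<Psi> \<sigma> x \<in> \<Psi> \<sigma>"
    by (auto simp: complement_proj_def)
qed

section \<open>Polyhedral cones\<close>

definition conic :: "qvec set \<Rightarrow> cone" where
  "conic G = {\<Sum>s\<in>G. qscale (c s) s | c. \<forall>s\<in>G. c s \<ge> 0}"

lemma conicI: "(\<And>s. s \<in> G \<Longrightarrow> c s \<ge> 0) \<Longrightarrow> (\<Sum>s\<in>G. qscale (c s) s) \<in> conic G"
  by (auto simp: conic_def)

lemma conicE:
  assumes "v \<in> conic G"
  obtains c where "\<forall>s\<in>G. c s \<ge> 0" "v = (\<Sum>s\<in>G. qscale (c s) s)"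
  using assms by (auto simp: conic_def)

lemma conic_add: "v \<in> conic G \<Longrightarrow> w \<in> conic G \<Longrightarrow> v + w \<in> conic G"
proof (elim conicE)
  fix c d assume *: "\<forall>s\<in>G. c s \<ge> 0" "v = (\<Sum>s\<in>G. qscale (c s) s)"
    "\<forall>s\<in>G. d s \<ge> 0" "w = (\<Sum>s\<in>G. qscale (d s) s)"
  have "v + w = (\<Sum>s\<in>G. qscale (c s + d s) s)"
    by (simp add: * qvec.scale_left_distrib sum.distrib)
  then show "v + w \<in> conic G" using conicI[of G "\<lambda>s. c s + d s"] * by simp
qed

lemma conic_scale: "v \<in> conic G \<Longrightarrow> r \<ge> 0 \<Longrightarrow> qscale r v \<in> conic G"
proof (elim conicE)
  fix c assume *: "\<forall>s\<in>G. c s \<ge> 0" "v = (\<Sum>s\<in>G. qscale (c s) s)" "r \<ge> 0"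
  have "qscale r v = (\<Sum>s\<in>G. qscale (r * c s) s)"
    by (simp add: * qvec.scale_sum_right)
  then show "qscale r v \<in> conic G" using conicI[of G "\<lambda>s. r * c s"] * by simp
qed

lemma conic_generator:
  assumes "finite G" "g \<in> G"
  shows "g \<in> conic G"
proof -
  have "g = (\<Sum>s\<in>G. qscale (if s = g then 1 else 0) s)"
    using assms by (simp add: if_distrib[of "\<lambda>c. qscale c _"] cong: if_cong)
  also have "\<dots> \<in> conic G" by (rule conicI) simp
  finally show ?thesis .
qed

lemma conic_pairing_nonneg:
  assumes "v \<in> conic G" "\<And>g. g \<in> G \<Longrightarrow> 0 \<le> pairing u g"
  shows "0 \<le> pairing u v"
proof -
  obtain c where c: "\<forall>s\<in>G. c s \<ge> 0" "v = (\<Sum>s\<in>G. qscale (c s) s)"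
    using assms(1) by (rule conicE)
  have "pairing u v = (\<Sum>s\<in>G. c s * pairing u s)" by (simp add: c pairing_linear)
  also have "\<dots> \<ge> 0" using c assms(2) by (intro sum_nonneg) auto
  finally show ?thesis .
qed

lemma conic_pairing_zero:
  assumes "v \<in> conic G" "\<And>g. g \<in> G \<Longrightarrow> pairing u g = 0"
  shows "pairing u v = 0"
proof -
  obtain c where "v = (\<Sum>s\<in>G. qscale (c s) s)" using assms(1) by (rule conicE)
  then show ?thesis using assms(2) by (simp add: pairing_linear)
qed

text \<open>A sum of nonnegative terms vanishes only termwise. Hence a face is generated by those
  generators that lie on it.\<close>

lemma conic_pairing_eq_0:
  assumes "finite G" "v \<in> conic G" "\<And>g. g \<in> G \<Longrightarrow> 0 \<le> pairing u g" "pairing u v = 0"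
  shows "v \<in> conic {g \<in> G. pairing u g = 0}"
proof -
  obtain c where c: "\<forall>s\<in>G. c s \<ge> 0" "v = (\<Sum>s\<in>G. qscale (c s) s)"
    using assms(2) by (rule conicE)
  have "(\<Sum>s\<in>G. c s * pairing u s) = 0" using assms(4) by (simp add: c pairing_linear)
  then have "\<forall>s\<in>G. c s * pairing u s = 0"
    by (subst (asm) sum_nonneg_eq_0_iff) (use assms c in auto)
  then have "v = (\<Sum>s\<in>{g \<in> G. pairing u g = 0}. qscale (c s) s)"
    unfolding c(2) using assms(1) by (intro sum.mono_neutral_right) auto
  also have "\<dots> \<in> conic {g \<in> G. pairing u g = 0}" by (intro conicI) (use c in auto)
  finally show ?thesis .
qed

lemma conic_subset_span: "conic G \<subseteq> qvec.span G"
  by (auto simp: conic_def intro!: qvec.span_sum qvec.span_scale intro: qvec.span_base)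

text \<open>Multiplying all generators by a common denominator does not change the cone, since the
  coefficients absorb positive factors.\<close>

lemma polyhedral_lattice_generators:
  assumes "polyhedral_cone n \<sigma>"
  obtains G where "finite G" "G \<subseteq> lattice_pts n" "\<sigma> = conic G"
proof -
  obtain S where S: "finite S" "S \<subseteq> qspace n" "\<sigma> = conic S"
    using assms by (auto simp: polyhedral_cone_def conic_def)
  obtain d :: nat where d: "d > 0" "\<forall>v\<in>S. qscale (of_nat d) v \<in> lattice_pts n"
    using lattice_clear_denominators[OF S(1,2)] by blast
  let ?f = "qscale (of_nat d)" and ?g = "qscale (1 / of_nat d)"
  have gf: "?g (?f v) = v" for v using d(1) by simp
  have inj: "inj_on ?f S" by (metis gf inj_onI)
  have "conic (?f ` S) = conic S"
  proof
    show "conic (?f ` S) \<subseteq> conic S"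
    proof
      fix v assume "v \<in> conic (?f ` S)"
      then obtain c where c: "\<forall>s\<in>?f ` S. c s \<ge> 0" "v = (\<Sum>s\<in>?f ` S. qscale (c s) s)"
        by (rule conicE)
      have "v = (\<Sum>s\<in>S. qscale (c (?f s) * of_nat d) s)"
        by (simp add: c(2) sum.reindex[OF inj])
      also have "\<dots> \<in> conic S" by (rule conicI) (use c in auto)
      finally show "v \<in> conic S" .
    qed
    show "conic S \<subseteq> conic (?f ` S)"
    proof
      fix v assume "v \<in> conic S"
      then obtain c where c: "\<forall>s\<in>S. c s \<ge> 0" "v = (\<Sum>s\<in>S. qscale (c s) s)"
        by (rule conicE)
      have "v = (\<Sum>s\<in>?f ` S. qscale (c (?g s) / of_nat d) s)"
        using d(1) by (simp add: c(2) sum.reindex[OF inj])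
      also have "\<dots> \<in> conic (?f ` S)" by (rule conicI) (use c gf in auto)
      finally show "v \<in> conic (?f ` S)" .
    qed
  qed
  then show thesis using that[of "?f ` S"] S d by auto
qed

lemma polyhedral_subset_qspace: "polyhedral_cone n \<sigma> \<Longrightarrow> \<sigma> \<subseteq> qspace n"
  by (auto simp: polyhedral_cone_def intro!: qspace_closed)

section \<open>Dual cones, the Farkas lemma, and separation\<close>

lemma dual_cone_conic_iff:
  "finite G \<Longrightarrow> u \<in> dual_cone n (conic G) \<longleftrightarrow> u \<in> qspace n \<and> (\<forall>g\<in>G. 0 \<le> pairing u g)"
  using conic_pairing_nonneg conic_generator by (fastforce simp: dual_cone_def)

lemma perp_conic_iff:
  "finite G \<Longrightarrow> u \<in> perp n (conic G) \<longleftrightarrow> u \<in> qspace n \<and> (\<forall>g\<in>G. pairing u g = 0)"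
  using conic_pairing_zero conic_generator by (fastforce simp: perp_def)

lemma dual_cone_add: "u \<in> dual_cone n \<sigma> \<Longrightarrow> v \<in> dual_cone n \<sigma> \<Longrightarrow> u + v \<in> dual_cone n \<sigma>"
  and dual_cone_scale: "u \<in> dual_cone n \<sigma> \<Longrightarrow> c \<ge> 0 \<Longrightarrow> qscale c u \<in> dual_cone n \<sigma>"
  and dual_cone_zero: "0 \<in> dual_cone n \<sigma>"
  by (auto simp: dual_cone_def pairing_linear qspace_closed)

lemma dual_cone_antimono: "\<sigma> \<subseteq> \<tau> \<Longrightarrow> dual_cone n \<tau> \<subseteq> dual_cone n \<sigma>"
  by (auto simp: dual_cone_def)

lemma perp_subset_dual_cone: "perp n \<sigma> \<subseteq> dual_cone n \<sigma>"
  by (auto simp: dual_cone_def perp_def)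

text \<open>Two nonnegative numbers with sum zero both vanish. So
  \<open>\<sigma>\<^sup>\<bottom>\<close> cuts out a face of the semigroup of exponents, which is
  why \<open>face_ideal\<close> will be prime.\<close>

lemma dual_cone_add_in_perp:
  assumes "\<sigma> \<subseteq> \<rho>" "u \<in> dual_cone n \<rho>" "v \<in> dual_cone n \<rho>"
  shows "u + v \<in> perp n \<sigma> \<longleftrightarrow> u \<in> perp n \<sigma> \<and> v \<in> perp n \<sigma>"
proof
  assume *: "u + v \<in> perp n \<sigma>"
  have "pairing u x = 0 \<and> pairing v x = 0" if "x \<in> \<sigma>" for x
  proof -
    have "pairing u x \<ge> 0" "pairing v x \<ge> 0" using assms that by (auto simp: dual_cone_def)
    moreover have "pairing u x + pairing v x = 0"
      using * that by (simp add: perp_def pairing_add_left)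
    ultimately show ?thesis by linarith
  qed
  then show "u \<in> perp n \<sigma> \<and> v \<in> perp n \<sigma>" using assms by (auto simp: dual_cone_def perp_def)
qed (simp add: perp_closed)

text \<open>Bartl's elementary induction on the number of generators.\<close>

lemma farkas:
  assumes "finite I" "x \<in> qspace n" "\<And>i. i \<in> I \<Longrightarrow> a i \<in> qspace n"
    and "\<And>u. u \<in> qspace n \<Longrightarrow> (\<And>i. i \<in> I \<Longrightarrow> 0 \<le> pairing u (a i)) \<Longrightarrow> 0 \<le> pairing u x"
  shows "\<exists>c. (\<forall>i\<in>I. 0 \<le> c i) \<and> x = (\<Sum>i\<in>I. qscale (c i) (a i))"
  using assms
proof (induction I arbitrary: x a rule: finite_induct)
  case empty
  \<comment> \<open>With no generators every functional is admissible, in particular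
    \<open>- x\<close>.\<close>
  have "0 \<le> pairing (- x) x" using empty by (auto simp: qspace_closed)
  then have "pairing x x = 0" using pairing_self_nonneg[of x] by (simp add: pairing_linear)
  then show ?case by (simp add: pairing_self_eq_0_iff)
next
  case (insert j I)
  show ?case
  proof (cases "\<forall>u\<in>qspace n. (\<forall>i\<in>I. 0 \<le> pairing u (a i)) \<longrightarrow> 0 \<le> pairing u x")
    case True
    then obtain c where c: "\<forall>i\<in>I. 0 \<le> c i" "x = (\<Sum>i\<in>I. qscale (c i) (a i))"
      using insert.IH[of x a] insert.prems by blast
    have "x = (\<Sum>i\<in>insert j I. qscale ((c(j := 0)) i) (a i))"
      using insert.hyps c(2) by (auto intro!: sum.cong)
    then show ?thesis using c by (intro exI[of _ "c(j := 0)"]) auto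
  next
    case False
    then obtain w where w: "w \<in> qspace n" "\<And>i. i \<in> I \<Longrightarrow> 0 \<le> pairing w (a i)" "pairing w x < 0"
      by (auto simp: not_le)
    have wj: "pairing w (a j) < 0"
    proof (rule ccontr)
      assume "\<not> pairing w (a j) < 0"
      then have "0 \<le> pairing w (a i)" if "i \<in> insert j I" for i using w that by auto
      then show False using insert.prems(3)[OF w(1)] w(3) by fastforce
    qed
    \<comment> \<open>\<open>t\<close> and \<open>y\<close> are chosen so that moving
      \<open>a i\<close> and \<open>x\<close> along \<open>a j\<close> puts them into the hyperplane
      where \<open>w\<close> vanishes; the signs of \<open>w\<close> make both nonnegative.\<close>
    define t where "t i = - pairing w (a i) / pairing w (a j)" for i
    define y where "y = pairing w x / pairing w (a j)"
    have t: "t i \<ge> 0" if "i \<in> I" for i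
      using w(2)[OF that] wj by (simp add: t_def divide_nonneg_neg divide_le_0_iff)
    have y: "y \<ge> 0" using w(3) wj by (simp add: y_def divide_nonpos_neg)
    define a' where "a' i = a i + qscale (t i) (a j)" for i
    define x' where "x' = x - qscale y (a j)"
    have "0 \<le> pairing u x'" if u: "u \<in> qspace n" "\<And>i. i \<in> I \<Longrightarrow> 0 \<le> pairing u (a' i)" for u
    proof -
      \<comment> \<open>Subtracting \<open>r\<close> times \<open>w\<close> makes \<open>u\<close>
        vanish on \<open>a j\<close>. The resulting \<open>v\<close> takes on the original vectors
        the values that \<open>u\<close> takes on the shifted ones, so the hypothesis for all
        generators applies to it.\<close>
      define r where "r = pairing u (a j) / pairing w (a j)"
      define v where "v = u - qscale r w"
      have vj: "pairing v (a j) = 0" using wj by (simp add: v_def r_def pairing_linear)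
      have vi: "pairing v (a i) = pairing u (a' i)" for i
        using wj by (simp add: v_def r_def a'_def t_def pairing_linear field_simps)
      have "0 \<le> pairing v x"
      proof (rule insert.prems(3))
        show "v \<in> qspace n" using u w(1) by (simp add: v_def qspace_closed)
        show "0 \<le> pairing v (a i)" if "i \<in> insert j I" for i
          using that vj vi u(2) by auto
      qed
      also have "pairing v x = pairing u x'"
        using wj by (simp add: v_def r_def x'_def y_def pairing_linear field_simps)
      finally show ?thesis .
    qed
    then obtain c where c: "\<forall>i\<in>I. 0 \<le> c i" "x' = (\<Sum>i\<in>I. qscale (c i) (a' i))"
      using insert.IH[of x' a'] insert.prems by (auto simp: x'_def a'_def qspace_closed)
    define d where "d = c(j := y + (\<Sum>i\<in>I. c i * t i))"
    have "x = x' + qscale y (a j)" by (simp add: x'_def)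
    also have "\<dots> = (\<Sum>i\<in>I. qscale (c i) (a i)) + qscale (y + (\<Sum>i\<in>I. c i * t i)) (a j)"
      unfolding c(2) a'_def
      by (simp add: qvec.scale_right_distrib qvec.scale_left_distrib sum.distrib qvec.scale_sum_left
          algebra_simps)
    also have "\<dots> = (\<Sum>i\<in>insert j I. qscale (d i) (a i))"
      using insert.hyps by (auto simp: d_def add.commute intro!: sum.cong)
    finally show ?thesis
      using c t y by (intro exI[of _ d]) (auto simp: d_def intro!: add_nonneg_nonneg sum_nonneg)
  qed
qed

lemma scale_to_lattice:
  assumes "u \<in> qspace n"
  obtains d :: nat where "d > 0" "qscale (of_nat d) u \<in> lattice_pts n"
  using lattice_clear_denominators[of "{u}" n] assms by auto

lemma face_subset: "is_face n \<tau> \<sigma> \<Longrightarrow> \<tau> \<subseteq> \<sigma>"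
  by (auto simp: is_face_def)

lemma face_lattice_functional:
  assumes "is_face n \<tau> \<sigma>"
  obtains u where "u \<in> dual_cone n \<sigma>" "u \<in> lattice_pts n" "\<tau> = {v \<in> \<sigma>. pairing u v = 0}"
    "u \<in> perp n \<tau>"
proof -
  obtain u where u: "u \<in> dual_cone n \<sigma>" "\<tau> = {v \<in> \<sigma>. pairing u v = 0}"
    using assms by (auto simp: is_face_def)
  then obtain d :: nat where d: "d > 0" "qscale (of_nat d) u \<in> lattice_pts n"
    by (auto simp: dual_cone_def elim: scale_to_lattice)
  show thesis
    using u d by (intro that[of "qscale (of_nat d) u"])
      (auto simp: dual_cone_scale pairing_linear perp_def qspace_closed dual_cone_def)
qed

text \<open>The combinatorial form of localization: allowing negative multiples of \<open>u\<close>
  turns the dual of \<open>\<sigma>\<close> into the dual of its face. Generators on the face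
  already pair nonnegatively with \<open>s\<close>; on the others \<open>u\<close> is positive, so a
  large multiple wins.\<close>

lemma dual_cone_face_shift:
  assumes "polyhedral_cone n \<sigma>" "u \<in> dual_cone n \<sigma>" "\<tau> = {v \<in> \<sigma>. pairing u v = 0}"
    and "s \<in> dual_cone n \<tau>"
  obtains N :: nat where "s + qscale (of_nat N) u \<in> dual_cone n \<sigma>"
proof -
  obtain G where G: "finite G" "\<sigma> = conic G"
    using assms(1) by (metis polyhedral_lattice_generators)
  \<comment> \<open>The sum of the bounds replaces their maximum, which also covers an empty
    \<open>G\<close>. Generators with \<open>pairing u g = 0\<close> contribute 0 because division
    by zero gives 0.\<close>
  define N where "N = (\<Sum>g\<in>G. nat \<lceil>\<bar>pairing s g / pairing u g\<bar>\<rceil>)"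
  have "0 \<le> pairing (s + qscale (of_nat N) u) g" if g: "g \<in> G" for g
  proof (cases "pairing u g = 0")
    case True
    then have "g \<in> \<tau>" using g G assms(3) conic_generator by blast
    then show ?thesis using assms(4) True by (simp add: pairing_linear dual_cone_def)
  next
    case False
    have ug: "pairing u g > 0"
      using False assms(2) G g dual_cone_conic_iff[of G u n] by force
    have "- (pairing s g / pairing u g) \<le> \<bar>pairing s g / pairing u g\<bar>"
      by (rule abs_ge_minus_self)
    also have "\<dots> \<le> of_nat (nat \<lceil>\<bar>pairing s g / pairing u g\<bar>\<rceil>)"
      by (rule of_nat_ceiling)
    also have "nat \<lceil>\<bar>pairing s g / pairing u g\<bar>\<rceil> \<le> N"
      unfolding N_def using G g by (intro member_le_sum) auto
    finally have "- (pairing s g / pairing u g) \<le> of_nat N" by simp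
    then have "- pairing s g \<le> of_nat N * pairing u g" using ug by (simp add: field_simps)
    then show ?thesis by (simp add: pairing_linear)
  qed
  moreover have "s + qscale (of_nat N) u \<in> qspace n"
    using assms(2,4) by (simp add: dual_cone_def qspace_closed)
  ultimately have "s + qscale (of_nat N) u \<in> dual_cone n \<sigma>"
    using G by (simp add: dual_cone_conic_iff)
  then show thesis by (rule that)
qed

text \<open>The Farkas lemma is applied to the cone of differences \<open>s - t\<close>. Each
  generator outside the common face yields a functional of the right sign everywhere and strict
  there; their sum is strict on all of them at once.\<close>

lemma separation:
  assumes \<sigma>: "polyhedral_cone n \<sigma>" and \<tau>: "polyhedral_cone n \<tau>"
    and f\<sigma>: "is_face n (\<sigma> \<inter> \<tau>) \<sigma>" and f\<tau>: "is_face n (\<sigma> \<inter> \<tau>) \<tau>"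
  obtains u where "u \<in> lattice_pts n" "u \<in> dual_cone n \<sigma>" "- u \<in> dual_cone n \<tau>"
    "\<sigma> \<inter> \<tau> = {v \<in> \<sigma>. pairing u v = 0}" "\<sigma> \<inter> \<tau> = {v \<in> \<tau>. pairing u v = 0}"
proof -
  obtain G where G: "finite G" "G \<subseteq> lattice_pts n" "\<sigma> = conic G"
    using \<sigma> by (rule polyhedral_lattice_generators)
  obtain H where H: "finite H" "H \<subseteq> lattice_pts n" "\<tau> = conic H"
    using \<tau> by (rule polyhedral_lattice_generators)
  obtain a where a: "a \<in> dual_cone n \<sigma>" "\<sigma> \<inter> \<tau> = {v \<in> \<sigma>. pairing a v = 0}"
    using f\<sigma> by (auto simp: is_face_def)
  obtain b where b: "b \<in> dual_cone n \<tau>" "\<sigma> \<inter> \<tau> = {v \<in> \<tau>. pairing b v = 0}"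
    using f\<tau> by (auto simp: is_face_def)
  let ?sep = "\<lambda>u. u \<in> qspace n \<and> (\<forall>g\<in>G. 0 \<le> pairing u g) \<and> (\<forall>h\<in>H. pairing u h \<le> 0)"
  \<comment> \<open>Tagging keeps the two families apart even if a vector of \<open>G\<close> is the
    negative of one in \<open>H\<close>.\<close>
  define I where "I = Inl ` G \<union> (Inr ` H :: (qvec + qvec) set)"
  define gen where "gen = case_sum (\<lambda>g::qvec. g) (\<lambda>h::qvec. - h)"
  have sep: "\<exists>u. ?sep u \<and> pairing u x < 0"
    if x: "x \<in> qspace n" and nex: "\<nexists>s t. s \<in> \<sigma> \<and> t \<in> \<tau> \<and> x = s - t" for x
  proof (rule ccontr)
    assume no: "\<nexists>u. ?sep u \<and> pairing u x < 0"
    have "\<exists>c. (\<forall>i\<in>I. 0 \<le> c i) \<and> x = (\<Sum>i\<in>I. qscale (c i) (gen i))"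
    proof (rule farkas[OF _ x])
      show "gen i \<in> qspace n" if "i \<in> I" for i
        using that G H lattice_qspace by (fastforce simp: I_def gen_def qspace_closed)
    next
      fix u assume u: "u \<in> qspace n" and "\<And>i. i \<in> I \<Longrightarrow> 0 \<le> pairing u (gen i)"
      then have pos: "0 \<le> pairing u (gen i)" if "i \<in> I" for i using that by blast
      have "0 \<le> pairing u g" if "g \<in> G" for g using pos[of "Inl g"] that by (auto simp: I_def gen_def)
      moreover have "pairing u h \<le> 0" if "h \<in> H" for h
        using pos[of "Inr h"] that by (auto simp: I_def gen_def pairing_linear)
      ultimately show "0 \<le> pairing u x" using no u by (meson not_le)
    qed (use G H in \<open>simp add: I_def\<close>)
    then obtain c where c: "\<forall>i\<in>I. 0 \<le> c i" "x = (\<Sum>i\<in>I. qscale (c i) (gen i))" by blast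
    have "x = (\<Sum>i\<in>Inl ` G. qscale (c i) (gen i)) + (\<Sum>i\<in>Inr ` H. qscale (c i) (gen i))"
      unfolding c(2) I_def using G H by (intro sum.union_disjoint) auto
    also have "\<dots> = (\<Sum>g\<in>G. qscale (c (Inl g)) g) - (\<Sum>h\<in>H. qscale (c (Inr h)) h)"
      by (simp add: sum.reindex gen_def sum_negf)
    finally have "x = (\<Sum>g\<in>G. qscale (c (Inl g)) g) - (\<Sum>h\<in>H. qscale (c (Inr h)) h)" .
    moreover have "(\<Sum>g\<in>G. qscale (c (Inl g)) g) \<in> \<sigma>" "(\<Sum>h\<in>H. qscale (c (Inr h)) h) \<in> \<tau>"
      using c(1) G H by (auto simp: I_def intro!: conicI)
    ultimately show False using nex by blast
  qed
  have "\<exists>u. ?sep u \<and> pairing u g > 0" if g: "g \<in> G" "g \<notin> \<tau>" for g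
  proof -
    have g': "g \<in> \<sigma>" "g \<in> qspace n" using g G conic_generator lattice_qspace by blast+
    \<comment> \<open>If \<open>- g = s - t\<close>, then \<open>t = g + s\<close> lies in both
      cones, where \<open>a\<close> vanishes; as \<open>a\<close> is nonnegative on \<open>g\<close>
      and \<open>s\<close>, it kills \<open>g\<close>, which would put \<open>g\<close> on the
      common face.\<close>
    have "\<nexists>s t. s \<in> \<sigma> \<and> t \<in> \<tau> \<and> - g = s - t"
    proof (intro notI, elim exE conjE)
      fix s t assume st: "s \<in> \<sigma>" "t \<in> \<tau>" "- g = s - t"
      then have t: "t = g + s" by (simp add: algebra_simps)
      then have "t \<in> \<sigma>" using g' st G conic_add by blast
      then have "t \<in> {v \<in> \<sigma>. pairing a v = 0}" using st(2) unfolding a(2)[symmetric] by blast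
      then have "pairing a g + pairing a s = 0" using t by (simp add: pairing_linear)
      moreover have "pairing a g \<ge> 0" "pairing a s \<ge> 0"
        using a(1) g' st by (auto simp: dual_cone_def)
      ultimately have "pairing a g = 0" by linarith
      then show False using g' g a(2) by blast
    qed
    then show ?thesis using sep[of "- g"] g' by (force simp: qspace_closed pairing_linear)
  qed
  then obtain f where f: "\<And>g. g \<in> G \<Longrightarrow> g \<notin> \<tau> \<Longrightarrow> ?sep (f g) \<and> pairing (f g) g > 0" by metis
  have "\<exists>u. ?sep u \<and> pairing u h < 0" if h: "h \<in> H" "h \<notin> \<sigma>" for h
  proof -
    have h': "h \<in> \<tau>" "h \<in> qspace n" using h H conic_generator lattice_qspace by blast+
    have "\<nexists>s t. s \<in> \<sigma> \<and> t \<in> \<tau> \<and> h = s - t"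
    proof (intro notI, elim exE conjE)
      fix s t assume st: "s \<in> \<sigma>" "t \<in> \<tau>" "h = s - t"
      then have s: "s = h + t" by (simp add: algebra_simps)
      then have "s \<in> \<tau>" using h' st H conic_add by blast
      then have "s \<in> {v \<in> \<tau>. pairing b v = 0}" using st(1) unfolding b(2)[symmetric] by blast
      then have "pairing b h + pairing b t = 0" using s by (simp add: pairing_linear)
      moreover have "pairing b h \<ge> 0" "pairing b t \<ge> 0"
        using b(1) h' st by (auto simp: dual_cone_def)
      ultimately have "pairing b h = 0" by linarith
      then show False using h' h b(2) by blast
    qed
    then show ?thesis using sep[of h] h' by blast
  qed
  then obtain f' where f': "\<And>h. h \<in> H \<Longrightarrow> h \<notin> \<sigma> \<Longrightarrow> ?sep (f' h) \<and> pairing (f' h) h < 0" by metis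
  \<comment> \<open>One strict functional for each generator off the common face. Thus the zeros of
    \<open>w\<close> in either cone are generated by generators lying in both.\<close>
  define w where "w = (\<Sum>g\<in>G - \<tau>. f g) + (\<Sum>h\<in>H - \<sigma>. f' h)"
  have wq: "w \<in> qspace n" unfolding w_def using f f' by (intro qspace_closed) auto
  have w: "pairing w x = (\<Sum>g\<in>G - \<tau>. pairing (f g) x) + (\<Sum>h\<in>H - \<sigma>. pairing (f' h) x)" for x
    by (simp add: w_def pairing_linear)
  have wG: "0 \<le> pairing w g" if "g \<in> G" for g
    unfolding w using f f' that by (intro add_nonneg_nonneg sum_nonneg) auto
  have wH: "0 \<le> pairing (- w) h" if "h \<in> H" for h
    unfolding pairing_minus_left w using f f' that
    by (simp only: neg_0_le_iff_le, intro add_nonpos_nonpos sum_nonpos) auto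
  have wG': "0 < pairing w g" if "g \<in> G" "g \<notin> \<tau>" for g
    unfolding w using f f' that G H
    by (intro add_pos_nonneg sum_nonneg) (auto intro!: sum_pos2[of _ g])
  have wH': "0 < pairing (- w) h" if h: "h \<in> H" "h \<notin> \<sigma>" for h
  proof -
    have "0 < (\<Sum>g\<in>G - \<tau>. - pairing (f g) h) + (\<Sum>k\<in>H - \<sigma>. - pairing (f' k) h)"
      using f f' h G H by (intro add_nonneg_pos sum_nonneg) (auto intro!: sum_pos2[of _ h])
    then show ?thesis by (simp add: pairing_minus_left w sum_negf)
  qed
  have w\<sigma>: "w \<in> dual_cone n \<sigma>" using wq wG G by (simp add: dual_cone_conic_iff)
  have w\<tau>: "- w \<in> dual_cone n \<tau>" using wq wH H by (simp add: dual_cone_conic_iff qspace_closed)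
  have zero: "pairing w v = 0" if "v \<in> \<sigma> \<inter> \<tau>" for v
    using w\<sigma> w\<tau> that by (force simp: dual_cone_def pairing_linear)
  have A: "\<sigma> \<inter> \<tau> = {v \<in> \<sigma>. pairing w v = 0}"
  proof (intro equalityI subsetI)
    fix v assume v: "v \<in> {v \<in> \<sigma>. pairing w v = 0}"
    then have "v \<in> conic {g \<in> G. pairing w g = 0}" using conic_pairing_eq_0[of G v w] G wG by auto
    then have "pairing a v = 0"
    proof (rule conic_pairing_zero)
      fix g assume g: "g \<in> {g \<in> G. pairing w g = 0}"
      then have "g \<in> \<tau>" using wG'[of g] by fastforce
      then have "g \<in> \<sigma> \<inter> \<tau>" using g G conic_generator by blast
      then show "pairing a g = 0" unfolding a(2) by simp
    qed
    then show "v \<in> \<sigma> \<inter> \<tau>" using v a(2) by blast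
  qed (use zero in auto)
  have B: "\<sigma> \<inter> \<tau> = {v \<in> \<tau>. pairing w v = 0}"
  proof (intro equalityI subsetI)
    fix v assume v: "v \<in> {v \<in> \<tau>. pairing w v = 0}"
    then have "v \<in> conic {h \<in> H. pairing (- w) h = 0}"
      using conic_pairing_eq_0[of H v "- w"] H wH by (auto simp: pairing_linear)
    then have "pairing b v = 0"
    proof (rule conic_pairing_zero)
      fix h assume h: "h \<in> {h \<in> H. pairing (- w) h = 0}"
      then have "h \<in> \<sigma>" using wH'[of h] by fastforce
      then have "h \<in> \<sigma> \<inter> \<tau>" using h H conic_generator by blast
      then show "pairing b h = 0" unfolding b(2) by simp
    qed
    then show "v \<in> \<sigma> \<inter> \<tau>" using v b(2) by blast
  qed (use zero in auto)
  obtain d :: nat where d: "d > 0" "qscale (of_nat d) w \<in> lattice_pts n"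
    using wq by (rule scale_to_lattice)
  show thesis
  proof (rule that[OF d(2)])
    show "qscale (of_nat d) w \<in> dual_cone n \<sigma>" using w\<sigma> by (simp add: dual_cone_scale)
    show "- qscale (of_nat d) w \<in> dual_cone n \<tau>"
      using dual_cone_scale[OF w\<tau>, of "of_nat d"] by (simp add: qvec.scale_minus_right)
    show "\<sigma> \<inter> \<tau> = {v \<in> \<sigma>. pairing (qscale (of_nat d) w) v = 0}"
      and "\<sigma> \<inter> \<tau> = {v \<in> \<tau>. pairing (qscale (of_nat d) w) v = 0}"
      using A B d(1) by (simp_all add: pairing_linear)
  qed
qed

section \<open>Facets and normal generators\<close>

lemma fan_polyhedral: "fan n \<Sigma> \<Longrightarrow> \<sigma> \<in> \<Sigma> \<Longrightarrow> polyhedral_cone n \<sigma>"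
  and fan_face: "fan n \<Sigma> \<Longrightarrow> \<sigma> \<in> \<Sigma> \<Longrightarrow> is_face n \<tau> \<sigma> \<Longrightarrow> \<tau> \<in> \<Sigma>"
  and fan_Int_face: "fan n \<Sigma> \<Longrightarrow> \<sigma> \<in> \<Sigma> \<Longrightarrow> \<tau> \<in> \<Sigma> \<Longrightarrow> is_face n (\<sigma> \<inter> \<tau>) \<sigma>"
  and fan_finite: "fan n \<Sigma> \<Longrightarrow> finite \<Sigma>"
  by (auto simp: fan_def)

lemma fan_subset_face:
  assumes "fan n \<Sigma>" "\<sigma> \<in> \<Sigma>" "\<tau> \<in> \<Sigma>" "\<sigma> \<subseteq> \<tau>"
  shows "is_face n \<sigma> \<tau>"
  using fan_Int_face[OF assms(1,3,2)] assms(4) by (simp add: inf_absorb2)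

text \<open>Division with remainder by the least positive element.\<close>

lemma int_subgroup_generator:
  fixes H :: "int set"
  assumes "\<And>a b. a \<in> H \<Longrightarrow> b \<in> H \<Longrightarrow> a - b \<in> H" "k \<in> H" "k \<noteq> 0"
  obtains g where "g > 0" "g \<in> H" "\<And>h. h \<in> H \<Longrightarrow> g dvd h"
proof -
  have zero: "0 \<in> H" using assms(1)[OF assms(2,2)] by simp
  have neg: "- a \<in> H" if "a \<in> H" for a using assms(1)[OF zero that] by simp
  have add: "a + b \<in> H" if "a \<in> H" "b \<in> H" for a b using assms(1)[OF that(1) neg[OF that(2)]] by simp
  have nat_mult: "int m * a \<in> H" if "a \<in> H" for m a
    by (induction m) (auto simp: zero algebra_simps intro: add that)
  have mult: "m * a \<in> H" if "a \<in> H" for m a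
    using nat_mult[OF that, of "nat \<bar>m\<bar>"] neg by (cases "m \<ge> 0") fastforce+
  define p where "p = (LEAST p::nat. p > 0 \<and> int p \<in> H)"
  have ex: "nat \<bar>k\<bar> > 0 \<and> int (nat \<bar>k\<bar>) \<in> H"
    using assms(2,3) neg[of k] by (cases "k \<ge> 0") auto
  have p: "p > 0 \<and> int p \<in> H"
    unfolding p_def by (rule LeastI[of "\<lambda>p. p > 0 \<and> int p \<in> H", OF ex])
  have dvd: "int p dvd h" if h: "h \<in> H" for h
  proof -
    have "h mod int p = h - (h div int p) * int p" by (simp add: minus_div_mult_eq_mod)
    then have mH: "h mod int p \<in> H" using assms(1)[OF h mult] p by simp
    have "\<not> (nat (h mod int p) > 0 \<and> int (nat (h mod int p)) \<in> H)"
      using p by (intro not_less_Least[of _ "\<lambda>p. p > 0 \<and> int p \<in> H", folded p_def]) (simp add: nat_less_iff)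
    moreover have "0 \<le> h mod int p" using p by simp
    ultimately have "h mod int p = 0" using mH by auto
    then show ?thesis by auto
  qed
  show thesis by (rule that[of "int p"]) (use p dvd in auto)
qed

text \<open>Modulo \<open>\<tau>\<^sup>\<bottom>\<close>, the space
  \<open>\<sigma>\<^sup>\<bottom>\<close> is a line. To see this, the largest multiple of
  \<open>u\<close> is subtracted from \<open>l\<close> that leaves it nonnegative on
  \<open>\<tau>\<close>. The difference vanishes on \<open>\<sigma>\<close> and on a generator off
  \<open>\<sigma>\<close>, so the face it defines is all of \<open>\<tau>\<close> by maximality of
  the facet.\<close>

lemma facet_perp:
  assumes "polyhedral_cone n \<tau>" "is_facet n \<sigma> \<tau>"
  obtains u where "u \<in> dual_cone n \<tau>" "\<sigma> = {v \<in> \<tau>. pairing u v = 0}" "u \<notin> perp n \<tau>"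
    "\<forall>l\<in>perp n \<sigma>. \<exists>c. l - qscale c u \<in> perp n \<tau>"
proof -
  obtain u where u: "u \<in> dual_cone n \<tau>" "\<sigma> = {v \<in> \<tau>. pairing u v = 0}"
    using assms(2) by (auto simp: is_facet_def proper_face_def is_face_def)
  obtain G where G: "finite G" "G \<subseteq> lattice_pts n" "\<tau> = conic G"
    using assms(1) by (rule polyhedral_lattice_generators)
  have uq: "u \<in> qspace n" using u by (simp add: dual_cone_def)
  have "u \<notin> perp n \<tau>" using u assms(2) by (auto simp: perp_def is_facet_def proper_face_def)
  then obtain g0 where g0: "g0 \<in> G" "pairing u g0 \<noteq> 0" using G uq by (auto simp: perp_conic_iff)
  have G\<tau>: "g \<in> \<tau>" if "g \<in> G" for g using that G conic_generator by blast
  define Gp where "Gp = {g \<in> G. pairing u g > 0}"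
  have Gp: "finite Gp" "Gp \<noteq> {}"
    using G g0 G\<tau> u(1) by (auto simp: Gp_def dual_cone_def order_less_le)
  have "\<exists>c. l - qscale c u \<in> perp n \<tau>" if l: "l \<in> perp n \<sigma>" for l
  proof -
    \<comment> \<open>The ratio test: \<open>c\<close> is the largest scalar for which
      \<open>l - c u\<close> stays nonnegative on \<open>Gp\<close>, and it is attained.\<close>
    define c where "c = Min ((\<lambda>g. pairing l g / pairing u g) ` Gp)"
    have c_le: "c \<le> pairing l g / pairing u g" if "g \<in> Gp" for g
      unfolding c_def using Gp that by (intro Min_le) auto
    have "c \<in> (\<lambda>g. pairing l g / pairing u g) ` Gp"
      unfolding c_def using Gp by (intro Min_in) auto
    then obtain g1 where g1: "g1 \<in> Gp" "c = pairing l g1 / pairing u g1" by auto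
    let ?w = "l - qscale c u"
    have wq: "?w \<in> qspace n" using l uq perp_qspace by (auto simp: qspace_closed)
    have w\<sigma>: "pairing ?w v = 0" if "v \<in> \<sigma>" for v
      using l that u(2) by (auto simp: pairing_linear perp_def)
    have "0 \<le> pairing ?w g" if g: "g \<in> G" for g
    proof (cases "g \<in> Gp")
      case True
      then have "c * pairing u g \<le> pairing l g"
        using c_le[OF True] by (simp add: Gp_def field_simps)
      then show ?thesis by (simp add: pairing_linear)
    next
      case False
      then have "pairing u g = 0" using g G\<tau> u(1) by (force simp: Gp_def dual_cone_def)
      then show ?thesis using w\<sigma>[of g] G\<tau> g u(2) by simp
    qed
    then have wd: "?w \<in> dual_cone n \<tau>" using G wq by (simp add: dual_cone_conic_iff)
    define \<rho> where "\<rho> = {v \<in> \<tau>. pairing ?w v = 0}"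
    have f: "is_face n \<rho> \<tau>" using wd by (auto simp: is_face_def \<rho>_def)
    have sub: "\<sigma> \<subseteq> \<rho>" using w\<sigma> u(2) by (auto simp: \<rho>_def)
    have "g1 \<in> \<rho>" "g1 \<notin> \<sigma>"
      using g1 G\<tau> u(2) by (auto simp: \<rho>_def Gp_def pairing_linear)
    then have "\<rho> = \<tau>" using f sub assms(2) by (auto simp: is_facet_def proper_face_def)
    then have "?w \<in> perp n \<tau>" using wq by (auto simp: \<rho>_def perp_def)
    then show ?thesis by blast
  qed
  then show thesis using that u \<open>u \<notin> perp n \<tau>\<close> by blast
qed

text \<open>The lattice refinement: evaluation at one lattice vector \<open>g\<close> of
  \<open>\<tau>\<close> off \<open>\<sigma>\<close> embeds the line
  \<open>\<sigma>\<^sup>\<bottom>\<close> modulo \<open>\<tau>\<^sup>\<bottom>\<close> into the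
  rationals. Lattice points have integral values, and \<open>u\<close> realizes the positive
  generator of the group of these values.\<close>

lemma facet_lattice_generator:
  assumes "polyhedral_cone n \<tau>" "is_facet n \<sigma> \<tau>"
  obtains u where "u \<in> lattice_pts n" "u \<in> dual_cone n \<tau>" "u \<in> perp n \<sigma>" "u \<notin> perp n \<tau>"
    "\<sigma> = {v \<in> \<tau>. pairing u v = 0}"
    "\<forall>l\<in>perp n \<sigma> \<inter> lattice_pts n. \<exists>j::int. l - qscale (of_int j) u \<in> perp n \<tau>"
proof -
  obtain w where w: "w \<in> dual_cone n \<tau>" "\<sigma> = {v \<in> \<tau>. pairing w v = 0}" "w \<notin> perp n \<tau>"
    "\<forall>l\<in>perp n \<sigma>. \<exists>c. l - qscale c w \<in> perp n \<tau>"
    using facet_perp[OF assms] .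
  obtain G where G: "finite G" "G \<subseteq> lattice_pts n" "\<tau> = conic G"
    using assms(1) by (rule polyhedral_lattice_generators)
  have wq: "w \<in> qspace n" using w by (simp add: dual_cone_def)
  have w\<sigma>: "w \<in> perp n \<sigma>" using w wq by (auto simp: perp_def)
  obtain g where g: "g \<in> G" "pairing w g \<noteq> 0" using G w(3) wq by (auto simp: perp_conic_iff)
  then have gpos: "pairing w g > 0" "g \<in> \<tau>" "g \<in> lattice_pts n"
    using w(1) G conic_generator[OF G(1), of g] by (auto simp: dual_cone_def order_less_le)
  define H where "H = {k::int. \<exists>l\<in>perp n \<sigma> \<inter> lattice_pts n. pairing l g = of_int k}"
  obtain d :: nat where d: "d > 0" "qscale (of_nat d) w \<in> lattice_pts n"
    using wq by (rule scale_to_lattice)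
  have "qscale (of_nat d) w \<in> perp n \<sigma>" using w\<sigma> by (simp add: perp_closed)
  moreover obtain k where k: "pairing (qscale (of_nat d) w) g = of_int k"
    using pairing_lattice_Ints[OF d(2) gpos(3)] by (auto elim: Ints_cases)
  ultimately have kH: "k \<in> H" using d by (auto simp: H_def)
  have k0: "k \<noteq> 0" using k d(1) gpos(1) by (auto simp: pairing_linear)
  have diff: "a - b \<in> H" if "a \<in> H" "b \<in> H" for a b
  proof -
    from that obtain l l' where "l \<in> perp n \<sigma> \<inter> lattice_pts n" "pairing l g = of_int a"
      "l' \<in> perp n \<sigma> \<inter> lattice_pts n" "pairing l' g = of_int b" by (auto simp: H_def)
    then show ?thesis unfolding H_def
      by (intro CollectI bexI[of _ "l - l'"]) (auto simp: pairing_linear perp_closed lattice_closed)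
  qed
  obtain p where p: "p > 0" "p \<in> H" "\<And>h. h \<in> H \<Longrightarrow> p dvd h"
    using int_subgroup_generator[OF diff kH k0] by blast
  obtain u where u: "u \<in> perp n \<sigma>" "u \<in> lattice_pts n" "pairing u g = of_int p"
    using p(2) by (auto simp: H_def)
  \<comment> \<open>Evaluation at \<open>g\<close> is injective modulo
    \<open>\<tau>\<^sup>\<bottom>\<close>.\<close>
  have zero: "l \<in> perp n \<tau>" if l: "l \<in> perp n \<sigma>" "pairing l g = 0" for l
  proof -
    obtain c where c: "l - qscale c w \<in> perp n \<tau>" using bspec[OF w(4) l(1)] by blast
    then have "pairing (l - qscale c w) g = 0" using gpos by (simp add: perp_def)
    then have "c = 0" using that(2) gpos by (simp add: pairing_linear)
    then show ?thesis using c by simp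
  qed
  \<comment> \<open>Modulo \<open>\<tau>\<^sup>\<bottom>\<close>, \<open>u\<close> is the positive
    multiple \<open>r\<close> of \<open>w\<close>, so it inherits sign and zero set on
    \<open>\<tau>\<close>.\<close>
  define r where "r = of_int p / pairing w g"
  have r: "r > 0" using p gpos by (simp add: r_def)
  have diff': "u - qscale r w \<in> perp n \<tau>"
    using u w\<sigma> gpos by (intro zero) (auto simp: perp_closed r_def pairing_linear)
  have uw: "pairing u v = r * pairing w v" if "v \<in> \<tau>" for v
    using diff' that by (auto simp: perp_def pairing_linear)
  show thesis
  proof (rule that[OF u(2) _ u(1)])
    show "u \<in> dual_cone n \<tau>"
      using uw r w(1) lattice_qspace[OF u(2)] by (auto simp: dual_cone_def)
    show "u \<notin> perp n \<tau>" using u(3) gpos(2) p(1) by (auto simp: perp_def intro!: bexI[of _ g])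
    show "\<sigma> = {v \<in> \<tau>. pairing u v = 0}" using w(2) uw r by auto
  next
    show "\<forall>l\<in>perp n \<sigma> \<inter> lattice_pts n. \<exists>j::int. l - qscale (of_int j) u \<in> perp n \<tau>"
    proof
      fix l assume "l \<in> perp n \<sigma> \<inter> lattice_pts n"
      then have l: "l \<in> perp n \<sigma>" "l \<in> lattice_pts n" by auto
      obtain h where h: "pairing l g = of_int h"
        using pairing_lattice_Ints[OF l(2) gpos(3)] by (auto elim: Ints_cases)
      then have "h \<in> H" using l by (auto simp: H_def)
      then obtain j where "h = p * j" using p(3) by (auto elim: dvdE)
      then have "l - qscale (of_int j) u \<in> perp n \<tau>"
        using l u h by (intro zero) (auto simp: perp_closed pairing_linear)
      then show "\<exists>j::int. l - qscale (of_int j) u \<in> perp n \<tau>" ..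
    qed
  qed
qed

section \<open>Divisibility of integral functionals and the normal generator\<close>

lemma pairing_single: "pairing (Poly_Mapping.single i 1) v = Poly_Mapping.lookup v i"
  by (simp add: pairing_def)

lemma dim_psubset_qspace:
  assumes "qvec.subspace U" "U \<subset> W" "W \<subseteq> qspace n"
  shows "qvec.dim U < qvec.dim W"
proof -
  obtain B where B: "B \<subseteq> U" "finite B" "qvec.independent B" "U \<subseteq> qvec.span B" "card B = qvec.dim U"
    using qspace_finite_basis[of U n] assms(2,3) by auto
  obtain C where C: "C \<subseteq> W" "finite C" "qvec.independent C" "W \<subseteq> qvec.span C" "card C = qvec.dim W"
    using qspace_finite_basis[of W n] assms(3) by auto
  obtain x where x: "x \<in> W" "x \<notin> U" using assms(2) by blast
  then have "x \<notin> qvec.span B" using qvec.span_minimal[OF B(1) assms(1)] by blast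
  then have "qvec.independent (insert x B)" "x \<notin> B"
    using B(3) qvec.independent_insertI qvec.span_base by auto
  moreover have "insert x B \<subseteq> qvec.span C" using x B(1) assms(2) C(4) by blast
  ultimately have "card (insert x B) \<le> card C"
    using qvec.independent_span_bound[OF C(2), of "insert x B"] by blast
  then show ?thesis using B C \<open>x \<notin> B\<close> by simp
qed

text \<open>
  The rank of \<open>W\<close> is lowered by splitting off a primitive lattice vector \<open>x\<close> together with an integral
  functional \<open>y\<close> with \<open>\<langle>y, x\<rangle> = 1\<close>, which exists by Bezout.
\<close>

lemma lattice_functional_divisible:
  assumes "qvec.subspace W" "W \<subseteq> qspace n" "u \<in> lattice_pts n" "b \<noteq> 0"
    and "\<And>x. x \<in> W \<Longrightarrow> x \<in> lattice_pts n \<Longrightarrow> \<exists>k::int. pairing u x = of_int (b * k)"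
  shows "\<exists>u'\<in>lattice_pts n. u - qscale (of_int b) u' \<in> perp n W"
  using assms
proof (induction "qvec.dim W" arbitrary: W rule: less_induct)
  case less
  show ?case
  proof (cases "W \<subseteq> {0}")
    case True
    then show ?thesis
      using less.prems lattice_qspace
      by (intro bexI[of _ 0]) (auto simp: perp_def lattice_closed pairing_linear)
  next
    case False
    then obtain x0 where x0: "x0 \<in> W" "x0 \<noteq> 0" by blast
    then obtain d :: nat where d: "d > 0" "qscale (of_nat d) x0 \<in> lattice_pts n"
      using less.prems(2) scale_to_lattice by blast
    define x1 where "x1 = qscale (of_nat d) x0"
    have x1: "x1 \<in> W" "x1 \<in> lattice_pts n" "x1 \<noteq> 0"
      using x0 d less.prems(1) by (auto simp: x1_def qvec.subspace_scale)
    \<comment> \<open>This is the ideal generated by the coordinates of \<open>x1\<close>. Its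
      generator \<open>g\<close> is their greatest common divisor, so dividing \<open>x1\<close> by
      \<open>g\<close> gives a primitive vector.\<close>
    define H where "H = {k::int. \<exists>y\<in>lattice_pts n. pairing y x1 = of_int k}"
    have diff: "a - c \<in> H" if "a \<in> H" "c \<in> H" for a c
    proof -
      from that obtain l l' where "l \<in> lattice_pts n" "pairing l x1 = of_int a"
        "l' \<in> lattice_pts n" "pairing l' x1 = of_int c" by (auto simp: H_def)
      then show ?thesis unfolding H_def
        by (intro CollectI bexI[of _ "l - l'"]) (auto simp: pairing_linear lattice_closed)
    qed
    have coord: "\<exists>k\<in>H. Poly_Mapping.lookup x1 i = of_int k" for i
    proof (cases "i < n")
      case True
      then have "Poly_Mapping.single i 1 \<in> lattice_pts n"
        by (auto simp: lattice_pts_def qspace_def lookup_single when_def)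
      moreover obtain k where "Poly_Mapping.lookup x1 i = of_int k"
        using x1(2) by (auto simp: lattice_pts_def elim: Ints_cases)
      ultimately show ?thesis unfolding H_def
        by (intro bexI[of _ k] CollectI bexI[of _ "Poly_Mapping.single i 1"]) (auto simp: pairing_single)
    next
      case False
      then have "Poly_Mapping.lookup x1 i = 0"
        using lattice_qspace[OF x1(2)] by (simp add: qspace_iff)
      moreover have "0 \<in> H" by (auto simp: H_def pairing_linear intro: bexI[of _ 0] lattice_zero)
      ultimately show ?thesis by (intro bexI[of _ 0]) auto
    qed
    obtain i where "Poly_Mapping.lookup x1 i \<noteq> 0"
      using x1(3) by (metis lookup_zero poly_mapping_eqI)
    with coord[of i] obtain k where k: "k \<in> H" "k \<noteq> 0" by auto
    obtain g where g: "g > 0" "g \<in> H" "\<And>h. h \<in> H \<Longrightarrow> g dvd h"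
      using int_subgroup_generator[OF diff k] by blast
    obtain y where y: "y \<in> lattice_pts n" "pairing y x1 = of_int g" using g by (auto simp: H_def)
    define x where "x = qscale (1 / of_int g) x1"
    have yx: "pairing y x = 1" using y g by (simp add: x_def pairing_linear)
    have xW: "x \<in> W" using x1 less.prems(1) by (simp add: x_def qvec.subspace_scale)
    have "Poly_Mapping.lookup x i \<in> \<int>" for i
    proof -
      obtain h where h: "h \<in> H" "Poly_Mapping.lookup x1 i = of_int h" using coord by blast
      then obtain j where "h = g * j" using g(3) by (auto elim: dvdE)
      then show ?thesis using h g by (simp add: x_def)
    qed
    then have xM: "x \<in> lattice_pts n" using xW less.prems(2) by (auto simp: lattice_pts_def)
    define W' where "W' = W \<inter> {v. pairing y v = 0}"
    have sub': "qvec.subspace W'"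
      unfolding W'_def by (intro qvec.subspace_inter less.prems(1) subspace_annihilator)
    have "x \<notin> W'" using yx by (simp add: W'_def)
    then have "W' \<subset> W" using xW by (auto simp: W'_def)
    then have dim: "qvec.dim W' < qvec.dim W" using dim_psubset_qspace[OF sub'] less.prems(2) by blast
    have "\<exists>k::int. pairing u z = of_int (b * k)" if "z \<in> W'" "z \<in> lattice_pts n" for z
      using less.prems(5) that by (auto simp: W'_def)
    then obtain u1 where u1: "u1 \<in> lattice_pts n" "u - qscale (of_int b) u1 \<in> perp n W'"
      using less.hyps[OF dim sub' _ less.prems(3,4)] less.prems(2) by (auto simp: W'_def)
    obtain k1 where k1: "pairing u x = of_int (b * k1)" using less.prems(5) xW xM by blast
    obtain k2 where k2: "pairing u1 x = of_int k2"
      using pairing_lattice_Ints[OF u1(1) xM] by (auto elim: Ints_cases)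
    \<comment> \<open>Since \<open>y\<close> vanishes on \<open>W'\<close> and is 1 at
      \<open>x\<close>, the added multiple only moves the value at \<open>x\<close>, from
      \<open>k2\<close> to the required \<open>k1\<close>.\<close>
    define u' where "u' = u1 + qscale (of_int (k1 - k2)) y"
    have "u' \<in> lattice_pts n" unfolding u'_def using u1 y by (intro lattice_closed) auto
    moreover have "u - qscale (of_int b) u' \<in> perp n W"
      unfolding perp_def
    proof (intro CollectI conjI ballI)
      show "u - qscale (of_int b) u' \<in> qspace n"
        using less.prems(3) \<open>u' \<in> lattice_pts n\<close> lattice_qspace by (auto simp: qspace_closed)
      fix v assume v: "v \<in> W"
      define z where "z = v - qscale (pairing y v) x"
      have "z \<in> W'" using v xW yx less.prems(1)
        by (auto simp: z_def W'_def pairing_linear qvec.subspace_diff qvec.subspace_scale)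
      then have "pairing (u - qscale (of_int b) u1) z = 0" "pairing y z = 0"
        using u1 by (auto simp: perp_def W'_def)
      then have "pairing (u - qscale (of_int b) u') z = 0" by (simp add: u'_def pairing_linear)
      moreover have "pairing (u - qscale (of_int b) u') x = 0"
        by (simp add: u'_def pairing_linear k1 k2 yx algebra_simps)
      moreover have "v = z + qscale (pairing y v) x" by (simp add: z_def)
      ultimately show "pairing (u - qscale (of_int b) u') v = 0"
        by (metis pairing_add_right pairing_scale_right mult_zero_right add_0)
    qed
    ultimately show ?thesis by blast
  qed
qed

text \<open>A lattice vector in the span enters the cone after adding a large multiple of the sum of
  lattice generators, so it is a difference of two lattice points of the cone.\<close>

lemma cone_lattice_eq:
  assumes "polyhedral_cone n \<sigma>"
  shows "cone_lattice n \<sigma> = qvec.span \<sigma> \<inter> lattice_pts n"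
proof
  show "cone_lattice n \<sigma> \<subseteq> qvec.span \<sigma> \<inter> lattice_pts n"
    unfolding cone_lattice_def
    by (rule hull_minimal) (auto intro: qvec.span_base qvec.span_zero qvec.span_diff lattice_closed)
  show "qvec.span \<sigma> \<inter> lattice_pts n \<subseteq> cone_lattice n \<sigma>"
  proof
    fix x assume x: "x \<in> qvec.span \<sigma> \<inter> lattice_pts n"
    obtain G where G: "finite G" "G \<subseteq> lattice_pts n" "\<sigma> = conic G"
      using assms by (rule polyhedral_lattice_generators)
    have "x \<in> qvec.span G"
      using x qvec.span_minimal[OF conic_subset_span qvec.subspace_span, of G] G by blast
    then obtain c where c: "x = (\<Sum>g\<in>G. qscale (c g) g)"
      using qvec.span_finite[OF G(1)] by auto
    define K where "K = (\<Sum>g\<in>G. nat \<lceil>\<bar>c g\<bar>\<rceil>)"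
    have K: "0 \<le> c g + of_nat K" if "g \<in> G" for g
    proof -
      have "- c g \<le> \<bar>c g\<bar>" by (rule abs_ge_minus_self)
      also have "\<dots> \<le> of_nat (nat \<lceil>\<bar>c g\<bar>\<rceil>)" by (rule of_nat_ceiling)
      also have "nat \<lceil>\<bar>c g\<bar>\<rceil> \<le> K" unfolding K_def using G that by (intro member_le_sum) auto
      finally show ?thesis by simp
    qed
    define q where "q = (\<Sum>g\<in>G. qscale (of_nat K) g)"
    have q: "q \<in> \<sigma> \<inter> lattice_pts n"
      unfolding q_def G(3) using G(2) by (auto intro!: conicI lattice_sum lattice_scale)
    have "x + q = (\<Sum>g\<in>G. qscale (c g + of_nat K) g)"
      by (simp add: c q_def qvec.scale_left_distrib sum.distrib)
    also have "\<dots> \<in> \<sigma>" unfolding G(3) by (intro conicI) (use K in auto)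
    finally have p: "x + q \<in> \<sigma> \<inter> lattice_pts n" using x q by (simp add: lattice_closed)
    show "x \<in> cone_lattice n \<sigma>"
      unfolding cone_lattice_def hull_def
    proof safe
      fix T assume T: "\<sigma> \<inter> lattice_pts n \<subseteq> T" "\<forall>a\<in>T. \<forall>b\<in>T. a - b \<in> T"
      then have "(x + q) - q \<in> T" using p q by blast
      then show "x \<in> T" by simp
    qed
  qed
qed

text \<open>This shows that the \<open>SOME\<close> in the definition has a witness and ties it to
  the primitive functional \<open>u\<close> of the facet. The crux is that \<open>u\<close> takes
  the value 1 on \<open>N\<^sub>\<tau>\<close>; primitivity in
  \<open>\<sigma>\<^sup>\<bottom>\<close> has to be carried over to the dual side.\<close>

lemma normal_gen:
  assumes "polyhedral_cone n \<tau>" "is_facet n \<sigma> \<tau>"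
  obtains u where "u \<in> lattice_pts n" "u \<in> dual_cone n \<tau>" "u \<in> perp n \<sigma>" "u \<notin> perp n \<tau>"
    "\<sigma> = {v \<in> \<tau>. pairing u v = 0}"
    "\<forall>l\<in>perp n \<sigma> \<inter> lattice_pts n. \<exists>j::int. l - qscale (of_int j) u \<in> perp n \<tau>"
    "pairing u (normal_gen n \<tau> \<sigma>) = 1"
    "normal_gen n \<tau> \<sigma> \<in> qvec.span \<tau>"
proof -
  obtain u where u: "u \<in> lattice_pts n" "u \<in> dual_cone n \<tau>" "u \<in> perp n \<sigma>" "u \<notin> perp n \<tau>"
    "\<sigma> = {v \<in> \<tau>. pairing u v = 0}"
    "\<forall>l\<in>perp n \<sigma> \<inter> lattice_pts n. \<exists>j::int. l - qscale (of_int j) u \<in> perp n \<tau>"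
    by (rule facet_lattice_generator[OF assms])
  have \<tau>q: "\<tau> \<subseteq> qspace n" by (rule polyhedral_subset_qspace[OF assms(1)])
  have \<sigma>\<tau>: "\<sigma> \<subseteq> \<tau>" using u(5) by blast
  \<comment> \<open>The facet is generated by the generators of \<open>\<tau>\<close> on which
    \<open>u\<close> vanishes.\<close>
  have "polyhedral_cone n \<sigma>"
  proof -
    obtain G where G: "finite G" "G \<subseteq> lattice_pts n" "\<tau> = conic G"
      using assms(1) by (rule polyhedral_lattice_generators)
    let ?G = "{g \<in> G. pairing u g = 0}"
    have "\<sigma> = conic ?G"
    proof
      show "\<sigma> \<subseteq> conic ?G"
        using conic_pairing_eq_0[OF G(1), of _ u] u(2,5) G
        by (auto simp: dual_cone_conic_iff)
      show "conic ?G \<subseteq> \<sigma>"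
      proof
        fix x assume x: "x \<in> conic ?G"
        then have 0: "pairing u x = 0" by (rule conic_pairing_zero) simp
        obtain c where c: "\<forall>s\<in>?G. c s \<ge> 0" "x = (\<Sum>s\<in>?G. qscale (c s) s)"
          using x by (rule conicE)
        have "x = (\<Sum>s\<in>G. qscale (if pairing u s = 0 then c s else 0) s)"
          unfolding c(2) using G(1) by (intro sum.mono_neutral_cong_left) auto
        also have "\<dots> \<in> conic G" using c(1) by (intro conicI) auto
        finally show "x \<in> \<sigma>" using 0 u(5) G by simp
      qed
    qed
    moreover have "finite ?G" "?G \<subseteq> qspace n" using G lattice_qspace by auto
    ultimately show ?thesis unfolding polyhedral_cone_def conic_def by blast
  qed
  note cl\<sigma> = cone_lattice_eq[OF this] and cl\<tau> = cone_lattice_eq[OF assms(1)]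
  have \<sigma>q: "\<sigma> \<subseteq> qspace n" using \<sigma>\<tau> \<tau>q by blast
  \<comment> \<open>Modulo \<open>\<tau>\<^sup>\<bottom>\<close> every \<open>l\<close> in
    \<open>\<sigma>\<^sup>\<bottom>\<close> is a multiple of \<open>w\<close>, and \<open>u\<close>
    is a nonzero one. Hence a zero of \<open>u\<close> in the span of \<open>\<tau>\<close> is
    killed by all of \<open>\<sigma>\<^sup>\<bottom>\<close>.\<close>
  have ker: "x \<in> qvec.span \<sigma>" if x: "x \<in> qvec.span \<tau>" "pairing u x = 0" for x
  proof (rule span_eq_annihilator_perp[OF \<sigma>q])
    show "x \<in> qspace n" using x qvec.span_minimal[OF \<tau>q subspace_qspace] by blast
    obtain w where w: "w \<in> dual_cone n \<tau>" "\<sigma> = {v \<in> \<tau>. pairing w v = 0}" "w \<notin> perp n \<tau>"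
      "\<forall>l\<in>perp n \<sigma>. \<exists>c. l - qscale c w \<in> perp n \<tau>"
      using facet_perp[OF assms] .
    obtain c where c: "u - qscale c w \<in> perp n \<tau>" using w(4) u(3) by blast
    have "c \<noteq> 0" using c u(4) by auto
    moreover have "pairing (u - qscale c w) x = 0" using perp_span[OF c x(1)] .
    ultimately have wx: "pairing w x = 0" using x(2) by (simp add: pairing_linear)
    fix l assume "l \<in> perp n \<sigma>"
    then obtain e where "l - qscale e w \<in> perp n \<tau>" using w(4) by blast
    from perp_span[OF this x(1)] wx show "pairing l x = 0" by (simp add: pairing_linear)
  qed
  define H where "H = {k::int. \<exists>x\<in>cone_lattice n \<tau>. pairing u x = of_int k}"
  have diff: "a - b \<in> H" if "a \<in> H" "b \<in> H" for a b
  proof -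
    from that obtain x y where "x \<in> cone_lattice n \<tau>" "pairing u x = of_int a"
      "y \<in> cone_lattice n \<tau>" "pairing u y = of_int b" by (auto simp: H_def)
    then show ?thesis unfolding H_def cl\<tau>
      by (intro CollectI bexI[of _ "x - y"]) (auto simp: pairing_linear lattice_closed qvec.span_diff)
  qed
  obtain t where t: "t \<in> \<tau>" "pairing u t > 0"
    using u(2,4) by (auto simp: dual_cone_def perp_def order_less_le)
  obtain d :: nat where d: "d > 0" "qscale (of_nat d) t \<in> lattice_pts n"
    using t \<tau>q scale_to_lattice by blast
  obtain k where k: "pairing u (qscale (of_nat d) t) = of_int k"
    using pairing_lattice_Ints[OF u(1) d(2)] by (auto elim: Ints_cases)
  have "k \<in> H" using k d t by (auto simp: H_def cl\<tau> intro!: qvec.span_scale intro: qvec.span_base)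
  moreover have "k \<noteq> 0" using k d t by (auto simp: pairing_linear)
  ultimately obtain b where b: "b > 0" "b \<in> H" "\<And>h. h \<in> H \<Longrightarrow> b dvd h"
    using int_subgroup_generator[OF diff] by blast
  \<comment> \<open>If \<open>b\<close> divides all values of \<open>u\<close> on
    \<open>N\<^sub>\<tau>\<close>, then \<open>u\<close> agrees on the span of \<open>\<tau>\<close>
    with \<open>b\<close> times an integral functional \<open>u'\<close>. The latter is in turn
    \<open>j\<close> times \<open>u\<close> modulo \<open>\<tau>\<^sup>\<bottom>\<close>, so
    \<open>b * j = 1\<close>.\<close>
  have b1: "b = 1"
  proof -
    have "\<exists>k::int. pairing u x = of_int (b * k)" if x: "x \<in> qvec.span \<tau>" "x \<in> lattice_pts n" for x
    proof -
      obtain h where h: "pairing u x = of_int h"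
        using pairing_lattice_Ints[OF u(1) x(2)] by (auto elim: Ints_cases)
      then have "h \<in> H" using x by (auto simp: H_def cl\<tau>)
      then obtain j where "h = b * j" using b(3) by (auto elim: dvdE)
      then show ?thesis using h by blast
    qed
    then obtain u' where u': "u' \<in> lattice_pts n" "u - qscale (of_int b) u' \<in> perp n (qvec.span \<tau>)"
      using lattice_functional_divisible[OF qvec.subspace_span _ u(1), of \<tau> b] b(1)
        qvec.span_minimal[OF \<tau>q subspace_qspace] by auto
    then have bu: "pairing u x = of_int b * pairing u' x" if "x \<in> \<tau>" for x
      using qvec.span_base[OF that] by (auto simp: perp_def pairing_linear)
    have "u' \<in> perp n \<sigma>"
      using bu \<sigma>\<tau> u(5) b(1) lattice_qspace[OF u'(1)] by (auto simp: perp_def)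
    then obtain j :: int where j: "u' - qscale (of_int j) u \<in> perp n \<tau>" using u(6) u' by blast
    then have "pairing u' t = of_int j * pairing u t" using t by (auto simp: perp_def pairing_linear)
    with bu[OF t(1)] have "pairing u t = of_int (b * j) * pairing u t" by simp
    then have "of_int (b * j) = (1::rat)" using t(2) by simp
    then have "b * j = 1" by (simp only: of_int_eq_1_iff)
    then show "b = 1" using b(1) by (simp add: zmult_eq_1_iff)
  qed
  obtain x where x: "x \<in> cone_lattice n \<tau>" "pairing u x = 1" using b(2) by (auto simp: H_def b1)
  have "is_normal_gen n \<tau> \<sigma> x"
    unfolding is_normal_gen_def
  proof (intro conjI ballI)
    fix y assume y: "y \<in> cone_lattice n \<tau>"
    obtain c where c: "pairing u y = of_int c"
      using pairing_lattice_Ints[OF u(1)] y by (auto simp: cl\<tau> elim: Ints_cases)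
    have "y - qscale (of_int c) x \<in> qvec.span \<tau>" "y - qscale (of_int c) x \<in> lattice_pts n"
      using x y by (auto simp: cl\<tau> lattice_closed intro!: qvec.span_diff qvec.span_scale)
    moreover have "pairing u (y - qscale (of_int c) x) = 0" using x c by (simp add: pairing_linear)
    ultimately have "y - qscale (of_int c) x \<in> cone_lattice n \<sigma>" unfolding cl\<sigma> using ker by blast
    then show "\<exists>c::int. y - qscale (of_int c) x \<in> cone_lattice n \<sigma>" ..
  next
    \<comment> \<open>The point \<open>t\<close> of the cone, rescaled to the level
      \<open>u = 1\<close>, differs from \<open>x\<close> by an element of the span of
      \<open>\<sigma>\<close>.\<close>
    let ?s = "qscale (1 / pairing u t) t - x"
    have "?s \<in> qvec.span \<sigma>"
      using x t by (intro ker) (auto simp: cl\<tau> pairing_linear intro!: qvec.span_diff qvec.span_scale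
          intro: qvec.span_base)
    moreover have "x + ?s \<in> \<tau>"
    proof -
      obtain G where "finite G" "\<tau> = conic G"
        using assms(1) by (rule polyhedral_lattice_generators)
      then show ?thesis using t by (auto intro!: conic_scale)
    qed
    ultimately show "\<exists>s\<in>qvec.span \<sigma>. x + s \<in> \<tau>" by blast
  qed (rule x)
  then have ng: "is_normal_gen n \<tau> \<sigma> (normal_gen n \<tau> \<sigma>)"
    unfolding normal_gen_def by (rule someI)
  let ?v = "normal_gen n \<tau> \<sigma>"
  have v\<tau>: "?v \<in> qvec.span \<tau>" "?v \<in> lattice_pts n" using ng by (auto simp: is_normal_gen_def cl\<tau>)
  \<comment> \<open>Now for the vector actually chosen: generating the quotient forces its value
    under \<open>u\<close> to be 1 or -1, and meeting the image of \<open>\<tau>\<close> fixes the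
    sign.\<close>
  obtain c :: int where "x - qscale (of_int c) ?v \<in> cone_lattice n \<sigma>"
    using ng x by (auto simp: is_normal_gen_def)
  then have "pairing u (x - qscale (of_int c) ?v) = 0" using perp_span[OF u(3)] by (simp add: cl\<sigma>)
  then have c: "of_int c * pairing u ?v = 1" using x(2) by (simp add: pairing_linear)
  obtain h where h: "pairing u ?v = of_int h"
    using pairing_lattice_Ints[OF u(1) v\<tau>(2)] by (auto elim: Ints_cases)
  obtain s where s: "s \<in> qvec.span \<sigma>" "?v + s \<in> \<tau>" using ng by (auto simp: is_normal_gen_def)
  have "0 \<le> pairing u (?v + s)" using s(2) u(2) by (simp add: dual_cone_def)
  then have "h \<ge> 0" using perp_span[OF u(3) s(1)] h by (simp add: pairing_linear)
  have "of_int (c * h) = (1::rat)" using c h by simp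
  then have "c * h = 1" by (simp only: of_int_eq_1_iff)
  then have "h = 1" using \<open>h \<ge> 0\<close> by (auto simp: zmult_eq_1_iff)
  then show thesis using that u v\<tau> h by simp
qed

section \<open>Subrings of a field and localization\<close>

text \<open>All rings in play are subsets of one ambient field with its own operations. Closure
  conditions on sets are easier to handle than carrier-based structures;
  \<open>ideal_ring_of_iff\<close> and \<open>primeideal_ring_of_iff\<close> translate.\<close>

definition subring_of_field :: "'a::field set \<Rightarrow> bool" where
  "subring_of_field A \<longleftrightarrow> 1 \<in> A \<and> (\<forall>a\<in>A. \<forall>b\<in>A. a - b \<in> A \<and> a * b \<in> A)"

lemma subring_one: "subring_of_field A \<Longrightarrow> 1 \<in> A"
  and subring_diff: "subring_of_field A \<Longrightarrow> a \<in> A \<Longrightarrow> b \<in> A \<Longrightarrow> a - b \<in> A"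
  and subring_mult: "subring_of_field A \<Longrightarrow> a \<in> A \<Longrightarrow> b \<in> A \<Longrightarrow> a * b \<in> A"
  by (auto simp: subring_of_field_def)

lemma subring_zero: "subring_of_field A \<Longrightarrow> 0 \<in> A"
  using subring_diff[of A 1 1] subring_one by auto

lemma subring_uminus: "subring_of_field A \<Longrightarrow> a \<in> A \<Longrightarrow> - a \<in> A"
  using subring_diff[of A 0 a] subring_zero by auto

lemma subring_add: "subring_of_field A \<Longrightarrow> a \<in> A \<Longrightarrow> b \<in> A \<Longrightarrow> a + b \<in> A"
  using subring_diff[of A a "- b"] subring_uminus by auto

lemma subring_power: "subring_of_field A \<Longrightarrow> a \<in> A \<Longrightarrow> a ^ k \<in> A"
  by (induction k) (auto simp: subring_one subring_mult)

lemma subring_prod: "subring_of_field A \<Longrightarrow> (\<And>i. i \<in> I \<Longrightarrow> f i \<in> A) \<Longrightarrow> prod f I \<in> A"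
  by (induction I rule: infinite_finite_induct) (auto simp: subring_one subring_mult)

lemmas subring_closed = subring_one subring_zero subring_diff subring_add subring_mult
  subring_uminus subring_power

section \<open>Ideals and primes as plain subsets\<close>

definition ideal_in :: "'a::field set \<Rightarrow> 'a set \<Rightarrow> bool" where
  "ideal_in A I \<longleftrightarrow> I \<subseteq> A \<and> 0 \<in> I \<and> (\<forall>a\<in>I. \<forall>b\<in>I. a + b \<in> I) \<and> (\<forall>a\<in>I. \<forall>x\<in>A. x * a \<in> I)"

lemma cring_ring_of:
  assumes "subring_of_field A"
  shows "cring (ring_of A)"
proof (rule cringI)
  show "abelian_group (ring_of A)"
    using assms by (intro abelian_groupI)
      (auto simp: ring_of_def subring_closed algebra_simps intro!: bexI[of _ "- x" for x])
  show "comm_monoid (ring_of A)"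
    using assms by (intro comm_monoidI) (auto simp: ring_of_def subring_closed algebra_simps)
qed (auto simp: ring_of_def algebra_simps)

lemma a_inv_ring_of:
  assumes "subring_of_field A" "a \<in> A"
  shows "\<ominus>\<^bsub>ring_of A\<^esub> a = - a"
proof -
  interpret cring "ring_of A" by (rule cring_ring_of[OF assms(1)])
  show ?thesis
    by (rule minus_equality) (use assms in \<open>auto simp: ring_of_def subring_closed\<close>)
qed

lemma ideal_ring_of_iff:
  assumes "subring_of_field A"
  shows "ideal I (ring_of A) \<longleftrightarrow> ideal_in A I"
proof
  assume "ideal I (ring_of A)"
  then interpret ideal I "ring_of A" .
  show "ideal_in A I"
    using a_subset additive_subgroup.zero_closed[OF additive_subgroup_axioms]
      additive_subgroup.a_closed[OF additive_subgroup_axioms] I_l_closed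
    unfolding ideal_in_def by (auto simp: ring_of_def)
next
  assume I: "ideal_in A I"
  interpret cring "ring_of A" by (rule cring_ring_of[OF assms])
  have minus: "- a \<in> I" if "a \<in> I" for a
  proof -
    have "(- 1) * a \<in> I" using I that subring_uminus[OF assms subring_one[OF assms]] unfolding ideal_in_def by blast
    then show ?thesis by simp
  qed
  show "ideal I (ring_of A)"
  proof (rule idealI)
    show "subgroup I (add_monoid (ring_of A))"
    proof (rule add.subgroupI)
      show "\<And>a. a \<in> I \<Longrightarrow> \<ominus>\<^bsub>ring_of A\<^esub> a \<in> I"
        using I minus assms by (auto simp: a_inv_ring_of ideal_in_def)
    qed (use I in \<open>auto simp: ideal_in_def ring_of_def\<close>)
  qed (use I ring_axioms in \<open>auto simp: ideal_in_def ring_of_def mult.commute\<close>)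
qed

definition prime_in :: "'a::field set \<Rightarrow> 'a set \<Rightarrow> bool" where
  "prime_in A P \<longleftrightarrow> ideal_in A P \<and> 1 \<notin> P \<and> (\<forall>a\<in>A. \<forall>b\<in>A. a * b \<in> P \<longrightarrow> a \<in> P \<or> b \<in> P)"

lemma primeideal_ring_of_iff:
  assumes A: "subring_of_field A"
  shows "primeideal P (ring_of A) \<longleftrightarrow> prime_in A P"
proof
  assume "primeideal P (ring_of A)"
  then interpret primeideal P "ring_of A" .
  have I: "ideal_in A P" using ideal_axioms ideal_ring_of_iff[OF A] by blast
  have "1 \<notin> P"
  proof
    assume "1 \<in> P"
    then have "A = P" using I by (force simp: ideal_in_def)
    then show False using I_notcarr by (simp add: ring_of_def)
  qed
  then show "prime_in A P" using I I_prime by (auto simp: prime_in_def ring_of_def)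
next
  assume P: "prime_in A P"
  show "primeideal P (ring_of A)"
  proof (rule primeidealI)
    show "ideal P (ring_of A)" using P ideal_ring_of_iff[OF A] by (simp add: prime_in_def)
    show "cring (ring_of A)" by (rule cring_ring_of[OF A])
  qed (use P A in \<open>auto simp: prime_in_def ring_of_def subring_closed\<close>)
qed

lemma ideal_in_zero: "ideal_in A I \<Longrightarrow> 0 \<in> I"
  and ideal_in_add: "ideal_in A I \<Longrightarrow> a \<in> I \<Longrightarrow> b \<in> I \<Longrightarrow> a + b \<in> I"
  and ideal_in_mult_left: "ideal_in A I \<Longrightarrow> a \<in> I \<Longrightarrow> x \<in> A \<Longrightarrow> x * a \<in> I"
  and ideal_in_mult_right: "ideal_in A I \<Longrightarrow> a \<in> I \<Longrightarrow> x \<in> A \<Longrightarrow> a * x \<in> I"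
  and ideal_in_subset: "ideal_in A I \<Longrightarrow> a \<in> I \<Longrightarrow> a \<in> A"
  by (auto simp: ideal_in_def mult.commute)

lemma ideal_in_uminus: "subring_of_field A \<Longrightarrow> ideal_in A I \<Longrightarrow> a \<in> I \<Longrightarrow> - a \<in> I"
  using ideal_in_mult_left[of A I a "- 1"] by (auto simp: subring_closed)

lemma ideal_in_diff: "subring_of_field A \<Longrightarrow> ideal_in A I \<Longrightarrow> a \<in> I \<Longrightarrow> b \<in> I \<Longrightarrow> a - b \<in> I"
  using ideal_in_add[of A I a "- b"] ideal_in_uminus by auto

lemma ideal_in_sum: "ideal_in A I \<Longrightarrow> (\<And>i. i \<in> K \<Longrightarrow> f i \<in> I) \<Longrightarrow> sum f K \<in> I"
  by (induction K rule: infinite_finite_induct) (auto simp: ideal_in_zero ideal_in_add)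

lemmas ideal_in_closed = ideal_in_zero ideal_in_add ideal_in_mult_left ideal_in_mult_right

lemma prime_in_ideal: "prime_in A P \<Longrightarrow> ideal_in A P"
  by (simp add: prime_in_def)

lemma prime_in_mult:
  "subring_of_field A \<Longrightarrow> prime_in A P \<Longrightarrow> a \<in> A - P \<Longrightarrow> b \<in> A - P \<Longrightarrow> a * b \<in> A - P"
  by (auto simp: prime_in_def subring_closed)

lemma prime_in_one: "subring_of_field A \<Longrightarrow> prime_in A P \<Longrightarrow> 1 \<in> A - P"
  by (auto simp: prime_in_def subring_closed)

lemma prime_in_nonzero: "prime_in A P \<Longrightarrow> a \<in> A - P \<Longrightarrow> a \<noteq> 0"
  by (auto simp: prime_in_def ideal_in_def)

lemma prime_in_power:
  "subring_of_field A \<Longrightarrow> prime_in A P \<Longrightarrow> a \<in> A - P \<Longrightarrow> a ^ k \<in> A - P"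
proof (induction k)
  case (Suc k)
  then show ?case using prime_in_mult[of A P a "a ^ k"] by simp
qed (use prime_in_one in auto)

lemma prime_in_prod:
  "subring_of_field A \<Longrightarrow> prime_in A P \<Longrightarrow> (\<And>i. i \<in> I \<Longrightarrow> f i \<in> A - P) \<Longrightarrow> prod f I \<in> A - P"
proof (induction I rule: infinite_finite_induct)
  case (insert i I)
  have "f i * prod f I \<in> A - P" by (rule prime_in_mult) (use insert in auto)
  then show ?case using insert by simp
qed (use prime_in_one in auto)

section \<open>Units, local rings and localization at a prime\<close>

lemma local_units_mult: "subring_of_field R \<Longrightarrow> a \<in> local_units R \<Longrightarrow> b \<in> local_units R \<Longrightarrow> a * b \<in> local_units R"
  and local_units_inverse: "a \<in> local_units R \<Longrightarrow> inverse a \<in> local_units R"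
  and local_units_one: "subring_of_field R \<Longrightarrow> 1 \<in> local_units R"
  and local_units_nonzero: "a \<in> local_units R \<Longrightarrow> a \<noteq> 0"
  and local_units_mem: "a \<in> local_units R \<Longrightarrow> a \<in> R"
  and local_units_mono: "R \<subseteq> S \<Longrightarrow> local_units R \<subseteq> local_units S"
  by (auto simp: local_units_def subring_closed)

lemma local_units_power: "subring_of_field R \<Longrightarrow> a \<in> local_units R \<Longrightarrow> a ^ k \<in> local_units R"
  by (induction k) (auto simp: local_units_one local_units_mult)

definition local_subring :: "'a::field set \<Rightarrow> bool" where
  "local_subring R \<longleftrightarrow> subring_of_field R \<and> ideal_in R (max_ideal R)"

lemma local_subring_subring: "local_subring R \<Longrightarrow> subring_of_field R"
  and local_subring_ideal: "local_subring R \<Longrightarrow> ideal_in R (max_ideal R)"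
  by (auto simp: local_subring_def)

lemma in_max_ideal_iff: "a \<in> R \<Longrightarrow> a \<in> max_ideal R \<longleftrightarrow> a \<notin> local_units R"
  by (auto simp: max_ideal_def)

lemma max_ideal_subset: "a \<in> max_ideal R \<Longrightarrow> a \<in> R"
  by (auto simp: max_ideal_def)

lemma max_ideal_mono: "R \<subseteq> S \<Longrightarrow> max_ideal S \<inter> R \<subseteq> max_ideal R"
  using local_units_mono by (auto simp: max_ideal_def)

text \<open>Contraction of a maximal ideal; primality holds because a product of units is a
  unit.\<close>

lemma prime_in_max_ideal_Int:
  assumes R: "local_subring R" and B: "subring_of_field B" "B \<subseteq> R"
  shows "prime_in B (max_ideal R \<inter> B)"
  unfolding prime_in_def ideal_in_def
proof (intro conjI ballI impI)
  note [simp] = local_subring_subring[OF R] local_subring_ideal[OF R] B(1)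
  show "0 \<in> max_ideal R \<inter> B" using ideal_in_zero[of R] by (auto simp: subring_closed)
  show "a + b \<in> max_ideal R \<inter> B" if "a \<in> max_ideal R \<inter> B" "b \<in> max_ideal R \<inter> B" for a b
    using ideal_in_add[of R] that by (auto simp: subring_closed)
  show "x * a \<in> max_ideal R \<inter> B" if "a \<in> max_ideal R \<inter> B" "x \<in> B" for a x
    using ideal_in_mult_left[of R] that B(2) by (auto simp: subring_closed)
  show "1 \<notin> max_ideal R \<inter> B" using local_units_one[of R] by (auto simp: max_ideal_def)
  show "a \<in> max_ideal R \<inter> B \<or> b \<in> max_ideal R \<inter> B"
    if "a \<in> B" "b \<in> B" "a * b \<in> max_ideal R \<inter> B" for a b
    using that B(2) local_units_mult[of R a b] by (auto simp: max_ideal_def)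
qed auto

context
  fixes A P :: "'a::field set"
  assumes A: "subring_of_field A" and P: "prime_in A P"
begin

lemma localizeI: "a \<in> A \<Longrightarrow> b \<in> A - P \<Longrightarrow> a / b \<in> localize A P"
  by (auto simp: localize_def)

lemma localizeE:
  assumes "r \<in> localize A P"
  obtains a b where "a \<in> A" "b \<in> A - P" "b \<noteq> 0" "r = a / b"
  using assms prime_in_nonzero[OF P] by (auto simp: localize_def)

lemma subset_localize: "A \<subseteq> localize A P"
  using localizeI[of _ 1] prime_in_one[OF A P] by auto

lemma subring_localize: "subring_of_field (localize A P)"
  unfolding subring_of_field_def
proof (intro conjI ballI)
  show "1 \<in> localize A P" using subset_localize A subring_one by blast
  fix x y assume "x \<in> localize A P" "y \<in> localize A P"
  then obtain a b c d where x: "a \<in> A" "b \<in> A - P" "b \<noteq> 0" "x = a / b"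
    and y: "c \<in> A" "d \<in> A - P" "d \<noteq> 0" "y = c / d"
    by (elim localizeE)
  have bd: "b * d \<in> A - P" by (rule prime_in_mult[OF A P x(2) y(2)])
  have "x - y = (a * d - c * b) / (b * d)" using x y by (simp add: field_simps)
  also have "\<dots> \<in> localize A P" using A x y bd by (intro localizeI) (auto intro!: subring_closed)
  finally show "x - y \<in> localize A P" .
  have "x * y = (a * c) / (b * d)" using x y by simp
  also have "\<dots> \<in> localize A P" using A x y bd by (intro localizeI) (auto intro!: subring_closed)
  finally show "x * y \<in> localize A P" .
qed

lemma divide_in_units_localize_iff:
  assumes "a \<in> A" "b \<in> A - P"
  shows "a / b \<in> local_units (localize A P) \<longleftrightarrow> a \<notin> P"
proof
  assume "a \<notin> P"
  then show "a / b \<in> local_units (localize A P)"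
    using assms localizeI[of a b] localizeI[of b a] prime_in_nonzero[OF P]
    by (auto simp: local_units_def)
next
  assume u: "a / b \<in> local_units (localize A P)"
  then obtain c d where cd: "c \<in> A" "d \<in> A - P" "d \<noteq> 0" "inverse (a / b) = c / d" "a \<noteq> 0"
    by (auto simp: local_units_def elim: localizeE)
  have "b * d = a * c" using cd assms(2) prime_in_nonzero[OF P] by (auto simp: field_simps)
  then show "a \<notin> P"
    using prime_in_mult[OF A P assms(2) cd(2)] ideal_in_mult_right[OF prime_in_ideal[OF P]] cd(1) by auto
qed

lemma max_ideal_localizeE:
  assumes "r \<in> max_ideal (localize A P)"
  obtains a b where "a \<in> P" "b \<in> A - P" "b \<noteq> 0" "r = a / b"
proof -
  have "r \<in> localize A P" using assms by (simp add: max_ideal_def)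
  then obtain a b where ab: "a \<in> A" "b \<in> A - P" "b \<noteq> 0" "r = a / b" by (rule localizeE)
  moreover have "a \<in> P"
    using assms divide_in_units_localize_iff[OF ab(1,2)] ab by (auto simp: max_ideal_def)
  ultimately show thesis using that by blast
qed

lemma max_ideal_localizeI: "a \<in> P \<Longrightarrow> b \<in> A - P \<Longrightarrow> a / b \<in> max_ideal (localize A P)"
  using divide_in_units_localize_iff[of a b] localizeI[of a b] ideal_in_subset[OF prime_in_ideal[OF P]]
  by (auto simp: max_ideal_def)

lemma local_subring_localize: "local_subring (localize A P)"
  unfolding local_subring_def ideal_in_def
proof (intro conjI ballI subring_localize)
  note I = prime_in_ideal[OF P]
  show "max_ideal (localize A P) \<subseteq> localize A P" by (auto simp: max_ideal_def)
  show "0 \<in> max_ideal (localize A P)"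
    using max_ideal_localizeI[of 0 1] prime_in_one[OF A P] ideal_in_zero[OF I] by simp
  fix x assume "x \<in> max_ideal (localize A P)"
  then obtain a b where x: "a \<in> P" "b \<in> A - P" "b \<noteq> 0" "x = a / b" by (rule max_ideal_localizeE)
  have aA: "a \<in> A" using x ideal_in_subset[OF I] by blast
  {
    fix y assume "y \<in> max_ideal (localize A P)"
    then obtain c d where y: "c \<in> P" "d \<in> A - P" "d \<noteq> 0" "y = c / d" by (rule max_ideal_localizeE)
    have "x + y = (a * d + c * b) / (b * d)" using x y by (simp add: field_simps)
    also have "\<dots> \<in> max_ideal (localize A P)"
      using x y prime_in_mult[OF A P x(2) y(2)]
      by (intro max_ideal_localizeI ideal_in_add[OF I] ideal_in_mult_right[OF I]) auto
    finally show "x + y \<in> max_ideal (localize A P)" .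
  }
  fix y assume "y \<in> localize A P"
  then obtain c d where y: "c \<in> A" "d \<in> A - P" "d \<noteq> 0" "y = c / d" by (rule localizeE)
  have "y * x = (c * a) / (d * b)" using x y by simp
  also have "\<dots> \<in> max_ideal (localize A P)"
    using x y prime_in_mult[OF A P y(2) x(2)]
    by (intro max_ideal_localizeI ideal_in_mult_left[OF I]) auto
  finally show "y * x \<in> max_ideal (localize A P)" .
qed

lemma max_ideal_localize_Int: "max_ideal (localize A P) \<inter> A = P"
proof -
  have "a \<in> local_units (localize A P) \<longleftrightarrow> a \<notin> P" if "a \<in> A" for a
    using divide_in_units_localize_iff[OF that prime_in_one[OF A P]] by simp
  then show ?thesis
    using subset_localize ideal_in_subset[OF prime_in_ideal[OF P]] by (auto simp: max_ideal_def)
qed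

text \<open>Elements of \<open>B\<close> outside the maximal ideal are already invertible in the
  localization. So passing to a larger coordinate ring inside the same local ring does not change
  the point; this is how points move to smaller charts.\<close>

lemma localize_intermediate:
  assumes B: "subring_of_field B" "A \<subseteq> B" "B \<subseteq> localize A P"
  shows "localize B (max_ideal (localize A P) \<inter> B) = localize A P"
proof
  let ?Q = "max_ideal (localize A P) \<inter> B"
  show "localize A P \<subseteq> localize B ?Q"
  proof
    fix r assume "r \<in> localize A P"
    then obtain a b where "a \<in> A" "b \<in> A - P" "r = a / b" by (auto elim: localizeE)
    then show "r \<in> localize B ?Q"
      using B(2) max_ideal_localize_Int by (auto simp: localize_def)
  qed
  show "localize B ?Q \<subseteq> localize A P"
  proof
    fix r assume "r \<in> localize B ?Q"
    then obtain a b where ab: "a \<in> B" "b \<in> B" "b \<notin> max_ideal (localize A P)" "r = a / b"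
      by (auto simp: localize_def)
    then have "inverse b \<in> localize A P" using B(3) by (auto simp: max_ideal_def local_units_def)
    then show "r \<in> localize A P"
      using ab B(3) subring_mult[OF subring_localize, of a "inverse b"] by (auto simp: divide_inverse)
  qed
qed

end

section \<open>Orders of vanishing\<close>

text \<open>Multiplication by a unit does not change the ideal whose colength is taken.\<close>

lemma vanishing_length_unit_mult:
  assumes w: "local_subring w" and s: "s \<in> local_units w"
  shows "vanishing_length v w (s * a) = vanishing_length v w a"
proof -
  note R = local_subring_subring[OF w]
  have "{p + s * a * c |p c. p \<in> max_ideal v \<inter> w \<and> c \<in> w}
      = {p + a * c |p c. p \<in> max_ideal v \<inter> w \<and> c \<in> w}" (is "?L = ?R")
  proof
    show "?L \<subseteq> ?R"
    proof
      fix x assume "x \<in> ?L"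
      then obtain p c where pc: "x = p + s * a * c" "p \<in> max_ideal v \<inter> w" "c \<in> w" by auto
      then have "x = p + a * (s * c)" "s * c \<in> w"
        using s R by (auto simp: algebra_simps subring_mult local_units_mem)
      then show "x \<in> ?R" using pc by blast
    qed
    show "?R \<subseteq> ?L"
    proof
      fix x assume "x \<in> ?R"
      then obtain p c where pc: "x = p + a * c" "p \<in> max_ideal v \<inter> w" "c \<in> w" by auto
      then have "x = p + s * a * (inverse s * c)" "inverse s * c \<in> w"
        using s R local_units_mem[OF local_units_inverse[OF s]] local_units_nonzero[OF s]
        by (auto simp: subring_mult)
      then show "x \<in> ?L" using pc by blast
    qed
  qed
  then show ?thesis by (simp add: vanishing_length_def)
qed

text \<open>Congruent elements generate the same ideal together with the prime of the
  subvariety.\<close>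

lemma vanishing_length_cong:
  assumes v: "local_subring v" and w: "local_subring w" and wv: "w \<subseteq> v"
    and ab: "a \<in> w" "b \<in> w" "a - b \<in> max_ideal v"
  shows "vanishing_length v w a = vanishing_length v w b"
proof -
  note R = local_subring_subring[OF w]
  let ?P = "max_ideal v \<inter> w"
  have I: "ideal_in w ?P" using prime_in_max_ideal_Int[OF v R wv] by (simp add: prime_in_def)
  have *: "{p + a * c |p c. p \<in> ?P \<and> c \<in> w} \<subseteq> {p + b * c |p c. p \<in> ?P \<and> c \<in> w}"
    if "a \<in> w" "b \<in> w" "a - b \<in> ?P" for a b
  proof
    fix x assume "x \<in> {p + a * c |p c. p \<in> ?P \<and> c \<in> w}"
    then obtain p c where pc: "x = p + a * c" "p \<in> ?P" "c \<in> w" by auto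
    have "x = (p + (a - b) * c) + b * c" using pc by (simp add: algebra_simps)
    moreover have "p + (a - b) * c \<in> ?P"
      by (rule ideal_in_add[OF I pc(2) ideal_in_mult_right[OF I that(3) pc(3)]])
    ultimately show "x \<in> {p + b * c |p c. p \<in> ?P \<and> c \<in> w}" using pc(3) by blast
  qed
  have abP: "a - b \<in> ?P" using ab R by (simp add: subring_diff)
  have "b - a \<in> ?P" using ideal_in_uminus[OF R I abP] by simp
  then show ?thesis
    using *[OF ab(1,2) abP] *[OF ab(2,1)] unfolding vanishing_length_def by (simp add: subset_antisym)
qed

text \<open>The predicates under the two \<open>THE\<close> operators coincide: the numerator is
  multiplied by \<open>s\<close> and keeps its length. Hence the values agree even at points where
  existence or uniqueness of such a number is not established.\<close>

lemma ord_along_unit_mult: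
  assumes v: "local_subring v" and w: "local_subring w" and wv: "w \<subseteq> v" and s: "s \<in> local_units w"
  shows "ord_along v w (s * r) = ord_along v w r"
proof -
  note Rv = local_subring_subring[OF v] and Rw = local_subring_subring[OF w]
  note I = local_subring_ideal[OF v]
  let ?p = "\<lambda>r j. \<exists>a\<in>w - max_ideal v. \<exists>b\<in>w - max_ideal v.
    b * r - a \<in> max_ideal v \<and> j = int (vanishing_length v w a) - int (vanishing_length v w b)"
  have *: "?p (s * r) j" if p: "?p r j" and s: "s \<in> local_units w" for s r j
  proof -
    obtain a b where ab: "a \<in> w - max_ideal v" "b \<in> w - max_ideal v" "b * r - a \<in> max_ideal v"
      "j = int (vanishing_length v w a) - int (vanishing_length v w b)" using p by blast
    have sv: "s \<in> local_units v" using s local_units_mono[OF wv] by blast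
    have "b * (s * r) - s * a = s * (b * r - a)" by (simp add: algebra_simps)
    also have "\<dots> \<in> max_ideal v"
      using sv ab(3) by (intro ideal_in_mult_left[OF I]) (auto intro: local_units_mem)
    finally have 1: "b * (s * r) - s * a \<in> max_ideal v" .
    have "a \<in> local_units v" using ab(1) wv by (auto simp: max_ideal_def)
    then have "s * a \<in> local_units v" using local_units_mult[OF Rv sv] by blast
    then have 2: "s * a \<in> w - max_ideal v"
      using s ab(1) Rw by (auto simp: max_ideal_def subring_mult local_units_mem)
    show ?thesis
      using 1 2 ab vanishing_length_unit_mult[OF w s] by metis
  qed
  have "?p (s * r) = ?p r"
  proof
    fix j
    have "inverse s * (s * r) = r" using local_units_nonzero[OF s] by simp
    \<comment> \<open>The reverse implication is the same claim for the unit
      \<open>inverse s\<close>.\<close>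
    then show "?p (s * r) j = ?p r j"
      using *[OF _ s, of r j] *[OF _ local_units_inverse[OF s], of "s * r" j] by metis
  qed
  then show ?thesis unfolding ord_along_def by simp
qed

text \<open>Reduced to the function 1, where uniqueness is immediate: numerator and denominator are
  congruent, so their lengths agree.\<close>

lemma ord_along_unit:
  assumes v: "local_subring v" and w: "local_subring w" and wv: "w \<subseteq> v" and s: "s \<in> local_units w"
  shows "ord_along v w s = 0"
proof -
  have "ord_along v w (s * 1) = ord_along v w 1" by (rule ord_along_unit_mult[OF v w wv s])
  also have "ord_along v w 1 = 0"
    unfolding ord_along_def
  proof (rule the_equality)
    have "1 \<in> w - max_ideal v"
      using local_subring_subring[OF v] local_subring_subring[OF w]
      by (auto simp: max_ideal_def subring_one local_units_one)
    then show "\<exists>a\<in>w - max_ideal v. \<exists>b\<in>w - max_ideal v. b * 1 - a \<in> max_ideal v \<and>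
        0 = int (vanishing_length v w a) - int (vanishing_length v w b)"
      using ideal_in_zero[OF local_subring_ideal[OF v]] by (intro bexI[of _ 1]) auto
  next
    fix j assume "\<exists>a\<in>w - max_ideal v. \<exists>b\<in>w - max_ideal v. b * 1 - a \<in> max_ideal v \<and>
        j = int (vanishing_length v w a) - int (vanishing_length v w b)"
    then obtain a b where "a \<in> w" "b \<in> w" "b - a \<in> max_ideal v"
      "j = int (vanishing_length v w a) - int (vanishing_length v w b)" by auto
    then show "j = 0" using vanishing_length_cong[OF v w wv, of b a] by simp
  qed
  finally show ?thesis by simp
qed

text \<open>The local ring of the subvariety of \<open>v\<close> along that of \<open>w\<close> has uniformizer \<open>t\<close>.\<close>

locale uniformizer =
  fixes v w :: "'k::field point" and t :: "'k torus_field"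
  assumes v: "local_subring v" and w: "local_subring w" and wv: "w \<subseteq> v"
    and t_max: "t \<in> max_ideal w" and t_unit: "t \<in> local_units v"
    and normal_form: "\<And>a. a \<in> w - max_ideal v \<Longrightarrow> \<exists>j. \<exists>s\<in>local_units w. a - t ^ j * s \<in> max_ideal v"
    and quotients: "\<And>r. r \<in> local_units v \<Longrightarrow>
      \<exists>a\<in>w - max_ideal v. \<exists>b\<in>w - max_ideal v. b * r - a \<in> max_ideal v"
begin

lemmas Rv = local_subring_subring[OF v] and Rw = local_subring_subring[OF w]
  and Iv = local_subring_ideal[OF v] and Iw = local_subring_ideal[OF w]

lemma t_in_w: "t \<in> w"
  using t_max by (rule max_ideal_subset)

definition P where "P = max_ideal v \<inter> w"

text \<open>The preimages in \<open>w\<close> of the powers of the maximal ideal of the discrete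
  valuation ring \<open>w / P\<close>.\<close>

definition J where "J j = {p + t ^ j * c |p c. p \<in> P \<and> c \<in> w}"

lemma ideal_P: "ideal_in w P"
  unfolding P_def using prime_in_max_ideal_Int[OF v Rw wv] by (simp add: prime_in_def)

lemma power_in_J: "t ^ j \<in> J j"
  unfolding J_def using ideal_in_zero[OF ideal_P] subring_one[OF Rw] by force

lemma P_subset_J: "P \<subseteq> J j"
  unfolding J_def using subring_zero[OF Rw] by force

lemma ideal_J: "ideal_in w (J j)"
  unfolding ideal_in_def
proof (intro conjI ballI)
  show "J j \<subseteq> w"
    unfolding J_def using t_in_w ideal_in_subset[OF ideal_P] Rw by (auto intro!: subring_closed)
  show "0 \<in> J j" using P_subset_J ideal_in_zero[OF ideal_P] by blast
  fix a assume "a \<in> J j"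
  then obtain p c where a: "a = p + t ^ j * c" "p \<in> P" "c \<in> w" by (auto simp: J_def)
  {
    fix b assume "b \<in> J j"
    then obtain q d where b: "b = q + t ^ j * d" "q \<in> P" "d \<in> w" by (auto simp: J_def)
    have "a + b = (p + q) + t ^ j * (c + d)" using a b by (simp add: algebra_simps)
    then show "a + b \<in> J j"
      unfolding J_def using ideal_in_add[OF ideal_P a(2) b(2)] subring_add[OF Rw a(3) b(3)] by blast
  }
  fix x assume x: "x \<in> w"
  have "x * a = x * p + t ^ j * (x * c)" using a by (simp add: algebra_simps)
  then show "x * a \<in> J j"
    unfolding J_def using ideal_in_mult_left[OF ideal_P a(2) x] subring_mult[OF Rw x a(3)] by blast
qed

text \<open>Otherwise \<open>t ^ j * (1 - t * c)\<close> would lie in \<open>P\<close>, although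
  \<open>1 - t * c\<close> is a unit of \<open>w\<close> and \<open>t\<close> is a unit of
  \<open>v\<close>.\<close>

lemma power_notin_J_Suc: "t ^ j \<notin> J (Suc j)"
proof
  assume "t ^ j \<in> J (Suc j)"
  then obtain p c where pc: "t ^ j = p + t ^ Suc j * c" "p \<in> P" "c \<in> w" by (auto simp: J_def)
  have "t * c \<in> max_ideal w" by (rule ideal_in_mult_right[OF Iw t_max pc(3)])
  moreover have "1 \<in> local_units w" using Rw by (rule local_units_one)
  ultimately have "1 - t * c \<notin> max_ideal w"
    using ideal_in_add[OF Iw, of "t * c" "1 - t * c"] by (auto simp: max_ideal_def)
  moreover have "1 - t * c \<in> w" using t_in_w pc(3) Rw by (auto intro!: subring_closed)
  ultimately have "1 - t * c \<in> local_units v"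
    using local_units_mono[OF wv] by (auto simp: max_ideal_def)
  then have "t ^ j * (1 - t * c) \<in> local_units v"
    using t_unit Rv by (intro local_units_mult local_units_power) auto
  moreover have "t ^ j * (1 - t * c) = p" using pc(1) by (simp add: algebra_simps)
  ultimately show False using pc(2) by (auto simp: P_def max_ideal_def)
qed

lemma J_antimono: "i \<le> j \<Longrightarrow> J j \<subseteq> J i"
proof
  fix x assume ij: "i \<le> j" and "x \<in> J j"
  then obtain p c where x: "x = p + t ^ j * c" "p \<in> P" "c \<in> w" by (auto simp: J_def)
  have "x = p + t ^ i * (t ^ (j - i) * c)" using x ij by (simp add: power_add[symmetric] mult.assoc[symmetric])
  then show "x \<in> J i" unfolding J_def using x t_in_w Rw by (blast intro: subring_mult subring_power)
qed

text \<open>By the normal form, each element of \<open>I\<close> off \<open>P\<close> is a unit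
  times a power of \<open>t\<close> modulo \<open>P\<close>, and that power then lies in
  \<open>I\<close> itself. So \<open>I\<close> is determined by the least power it contains.\<close>

lemma ideal_eq_J:
  assumes I: "ideal_in w I" and JI: "J j \<subseteq> I"
  shows "I = J (LEAST i. t ^ i \<in> I)"
proof
  define i where "i = (LEAST i. t ^ i \<in> I)"
  have "t ^ j \<in> I" using JI power_in_J by blast
  then have ti: "t ^ i \<in> I" unfolding i_def by (rule LeastI)
  have PI: "P \<subseteq> I" using JI P_subset_J by blast
  show "J (LEAST i. t ^ i \<in> I) \<subseteq> I"
    unfolding i_def[symmetric] J_def using PI ti I by (auto intro!: ideal_in_closed)
  show "I \<subseteq> J (LEAST i. t ^ i \<in> I)"
    unfolding i_def[symmetric]
  proof
    fix a assume a: "a \<in> I"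
    then have aw: "a \<in> w" using I ideal_in_subset by blast
    show "a \<in> J i"
    proof (cases "a \<in> max_ideal v")
      case True
      then show ?thesis using aw P_subset_J by (auto simp: P_def)
    next
      case False
      then obtain k s where ks: "s \<in> local_units w" "a - t ^ k * s \<in> max_ideal v"
        using normal_form aw by blast
      have "t ^ k * s \<in> w"
        by (rule subring_mult[OF Rw subring_power[OF Rw t_in_w] local_units_mem[OF ks(1)]])
      with ks have p: "a - t ^ k * s \<in> P" unfolding P_def using subring_diff[OF Rw aw] by blast
      have "a - (a - t ^ k * s) \<in> I" using ideal_in_diff[OF Rw I a] p PI by blast
      then have "t ^ k * s \<in> I" by simp
      then have "(t ^ k * s) * inverse s \<in> I"
        by (rule ideal_in_mult_right[OF I _ local_units_mem[OF local_units_inverse[OF ks(1)]]])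
      then have "t ^ k \<in> I" using local_units_nonzero[OF ks(1)] by (simp add: mult.assoc)
      then have "i \<le> k" unfolding i_def by (rule Least_le)
      have "a = (a - t ^ k * s) + t ^ k * s" by simp
      then have "a \<in> J k" unfolding J_def using p local_units_mem[OF ks(1)] by blast
      then show ?thesis using J_antimono[OF \<open>i \<le> k\<close>] by blast
    qed
  qed
qed

text \<open>The powers of \<open>t\<close> give a chain with \<open>j\<close> steps. Conversely,
  along any strict chain the exponents strictly decrease from at most \<open>j\<close>, which yields
  the bound \<open>x i + i \<le> j\<close>.\<close>

lemma quotient_length_J: "quotient_length w (J j) = j"
proof -
  define S where "S = {l. \<exists>I :: nat \<Rightarrow> 'k torus_field set.
     (\<forall>i\<le>l. ideal (I i) (ring_of w) \<and> J j \<subseteq> I i) \<and> (\<forall>i<l. I i \<subset> I (Suc i))}"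
  have "j \<in> S"
    unfolding S_def
  proof (intro CollectI exI[of _ "\<lambda>i. J (j - i)"] conjI allI impI)
    fix i assume "i < j"
    then have "j - i = Suc (j - Suc i)" by simp
    then show "J (j - i) \<subset> J (j - Suc i)"
      using J_antimono[of "j - Suc i" "j - i"] power_in_J[of "j - Suc i"] power_notin_J_Suc[of "j - Suc i"]
      by auto
  qed (auto simp: ideal_ring_of_iff[OF Rw] ideal_J dest: J_antimono[OF diff_le_self, THEN subsetD])
  moreover have "l \<le> j" if "l \<in> S" for l
  proof -
    obtain I :: "nat \<Rightarrow> 'k torus_field set"
      where I: "\<And>i. i \<le> l \<Longrightarrow> ideal_in w (I i)" "\<And>i. i \<le> l \<Longrightarrow> J j \<subseteq> I i"
        "\<And>i. i < l \<Longrightarrow> I i \<subset> I (Suc i)"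
      using \<open>l \<in> S\<close> unfolding S_def ideal_ring_of_iff[OF Rw] by blast
    define x where "x i = (LEAST k. t ^ k \<in> I i)" for i
    have Ix: "I i = J (x i)" if "i \<le> l" for i
      unfolding x_def by (rule ideal_eq_J[OF I(1,2)[OF that]])
    have "x i + i \<le> j" if "i \<le> l" for i
      using that
    proof (induction i)
      case 0
      have "t ^ j \<in> I 0" using I(2)[of 0] power_in_J by auto
      then show ?case unfolding x_def by (simp add: Least_le)
    next
      case (Suc i)
      have sub: "I i \<subset> I (Suc i)" using I(3) Suc by simp
      have "t ^ x i \<in> I (Suc i)" using sub Ix[of i] Suc power_in_J by auto
      then have "x (Suc i) \<le> x i" unfolding x_def[of "Suc i"] by (rule Least_le)
      moreover have "x (Suc i) \<noteq> x i" using sub Ix[of i] Ix[of "Suc i"] Suc by auto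
      ultimately show ?case using Suc by simp
    qed
    from this[of l] show "l \<le> j" by simp
  qed
  ultimately have "Sup S = j" by (intro cSup_eq_maximum) auto
  then show ?thesis unfolding quotient_length_def S_def .
qed

lemma vanishing_length_eq:
  assumes "a \<in> w" "s \<in> local_units w" "a - t ^ j * s \<in> max_ideal v"
  shows "vanishing_length v w a = j"
proof -
  have "s * t ^ j \<in> w"
    by (rule subring_mult[OF Rw local_units_mem[OF assms(2)] subring_power[OF Rw t_in_w]])
  then have "vanishing_length v w a = vanishing_length v w (s * t ^ j)"
    using assms by (intro vanishing_length_cong[OF v w wv]) (auto simp: mult.commute)
  also have "\<dots> = vanishing_length v w (t ^ j)" by (rule vanishing_length_unit_mult[OF w assms(2)])
  also have "\<dots> = quotient_length w (J j)" by (simp add: vanishing_length_def J_def P_def)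
  finally show ?thesis by (simp add: quotient_length_J)
qed

lemma vanishing_length_mult:
  assumes "a \<in> w - max_ideal v" "b \<in> w - max_ideal v"
  shows "vanishing_length v w (a * b) = vanishing_length v w a + vanishing_length v w b"
proof -
  obtain i s where a: "s \<in> local_units w" "a - t ^ i * s \<in> max_ideal v" using normal_form assms(1) by blast
  obtain j s' where b: "s' \<in> local_units w" "b - t ^ j * s' \<in> max_ideal v" using normal_form assms(2) by blast
  have bs: "b \<in> v" "t ^ i * s \<in> v"
    using assms(2) wv t_in_w local_units_mem[OF a(1)]
    by (auto intro!: subring_mult[OF Rv] subring_power[OF Rv])
  have "a * b - t ^ (i + j) * (s * s') = (a - t ^ i * s) * b + t ^ i * s * (b - t ^ j * s')"
    by (simp add: algebra_simps power_add)
  also have "\<dots> \<in> max_ideal v"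
    by (intro ideal_in_add[OF Iv] ideal_in_mult_right[OF Iv a(2)] ideal_in_mult_left[OF Iv b(2)] bs)
  finally show ?thesis
    using vanishing_length_eq[of "a * b" "s * s'" "i + j"] vanishing_length_eq[of a s i]
      vanishing_length_eq[of b s' j] a b assms local_units_mult[OF Rw a(1) b(1)]
      subring_mult[OF Rw, of a b] by auto
qed

lemma notin_max_mult:
  assumes "a \<in> w - max_ideal v" "b \<in> w - max_ideal v"
  shows "a * b \<in> w - max_ideal v"
proof -
  have "a \<in> w - P" "b \<in> w - P" using assms by (auto simp: P_def)
  then have "a * b \<in> w - P"
    using prime_in_mult[OF Rw, of P] prime_in_max_ideal_Int[OF v Rw wv] by (simp add: P_def)
  then show ?thesis by (auto simp: P_def)
qed

text \<open>Independence of the representing fraction: cross multiplication gives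
  \<open>a * b'\<close> congruent to \<open>b * a'\<close>, and lengths are additive here.\<close>

lemma ord_along_eq:
  assumes r: "r \<in> v" and ab: "a \<in> w - max_ideal v" "b \<in> w - max_ideal v" "b * r - a \<in> max_ideal v"
  shows "ord_along v w r = int (vanishing_length v w a) - int (vanishing_length v w b)"
  unfolding ord_along_def
proof (rule the_equality)
  fix j assume "\<exists>a\<in>w - max_ideal v. \<exists>b\<in>w - max_ideal v. b * r - a \<in> max_ideal v \<and>
      j = int (vanishing_length v w a) - int (vanishing_length v w b)"
  then obtain a' b' where ab': "a' \<in> w - max_ideal v" "b' \<in> w - max_ideal v"
    "b' * r - a' \<in> max_ideal v"
    and j: "j = int (vanishing_length v w a') - int (vanishing_length v w b')" by blast
  have "a * b' - b * a' = b * (b' * r - a') + (- b') * (b * r - a)" by (simp add: algebra_simps)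
  also have "\<dots> \<in> max_ideal v"
    using ab ab' wv Rv by (intro ideal_in_add[OF Iv] ideal_in_mult_left[OF Iv] subring_uminus) auto
  finally have "vanishing_length v w (a * b') = vanishing_length v w (b * a')"
    using ab ab' Rw by (intro vanishing_length_cong[OF v w wv]) (auto intro!: subring_mult)
  then show "j = int (vanishing_length v w a) - int (vanishing_length v w b)"
    using vanishing_length_mult[OF ab(1) ab'(2)] vanishing_length_mult[OF ab(2) ab'(1)] j by simp
qed (use ab in blast)

lemma ord_along_mult:
  assumes "r \<in> local_units v" "r' \<in> local_units v"
  shows "ord_along v w (r * r') = ord_along v w r + ord_along v w r'"
proof -
  obtain a b where ab: "a \<in> w - max_ideal v" "b \<in> w - max_ideal v" "b * r - a \<in> max_ideal v"
    using quotients assms(1) by blast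
  obtain a' b' where ab': "a' \<in> w - max_ideal v" "b' \<in> w - max_ideal v" "b' * r' - a' \<in> max_ideal v"
    using quotients assms(2) by blast
  have rv: "r \<in> v" "r' \<in> v" using assms local_units_mem by auto
  have "(b * b') * (r * r') - a * a' = b' * r' * (b * r - a) + a * (b' * r' - a')"
    by (simp add: algebra_simps)
  also have "\<dots> \<in> max_ideal v"
    using ab ab' wv Rv rv by (intro ideal_in_add[OF Iv] ideal_in_mult_left[OF Iv] subring_mult) auto
  finally have "ord_along v w (r * r')
      = int (vanishing_length v w (a * a')) - int (vanishing_length v w (b * b'))"
    using rv Rv notin_max_mult[OF ab(1) ab'(1)] notin_max_mult[OF ab(2) ab'(2)]
    by (intro ord_along_eq) (auto intro: subring_mult)
  then show ?thesis
    using ord_along_eq[OF rv(1) ab] ord_along_eq[OF rv(2) ab']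
      vanishing_length_mult[OF ab(1) ab'(1)] vanishing_length_mult[OF ab(2) ab'(2)] by simp
qed

lemma ord_along_t: "ord_along v w t = 1"
proof -
  have 1: "1 \<in> w - max_ideal v" using Rw Rv by (auto simp: max_ideal_def subring_one local_units_one)
  have t: "t \<in> w - max_ideal v" using t_in_w t_unit by (auto simp: max_ideal_def)
  have 0: "0 \<in> max_ideal v" by (rule ideal_in_zero[OF Iv])
  have "ord_along v w t = int (vanishing_length v w t) - int (vanishing_length v w 1)"
    using 1 t 0 wv by (intro ord_along_eq) auto
  moreover have "vanishing_length v w t = 1"
    using 0 t_in_w local_units_one[OF Rw] by (intro vanishing_length_eq[of _ 1]) auto
  moreover have "vanishing_length v w 1 = 0"
    using 0 subring_one[OF Rw] local_units_one[OF Rw] by (intro vanishing_length_eq[of _ 1]) auto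
  ultimately show ?thesis by simp
qed

lemma ord_along_t_powi: "ord_along v w (t powi j) = j"
proof -
  have nat: "ord_along v w (t ^ k) = int k" for k
  proof (induction k)
    case 0
    then show ?case using ord_along_unit[OF v w wv local_units_one[OF Rw]] by simp
  next
    case (Suc k)
    then show ?case using ord_along_mult[OF t_unit local_units_power[OF Rv t_unit, of k]] ord_along_t by simp
  qed
  show ?thesis
  proof (cases "j \<ge> 0")
    case True
    then show ?thesis using nat[of "nat j"] by (simp add: power_int_def)
  next
    case False
    have u: "t ^ nat (- j) \<in> local_units v" by (rule local_units_power[OF Rv t_unit])
    have "ord_along v w (t ^ nat (- j) * inverse (t ^ nat (- j))) = 0"
      using local_units_nonzero[OF t_unit] ord_along_unit[OF v w wv local_units_one[OF Rw]] by simp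
    then have "ord_along v w (inverse (t ^ nat (- j))) = j"
      using ord_along_mult[OF u local_units_inverse[OF u]] nat[of "nat (- j)"] False by simp
    then show ?thesis using False by (simp add: power_int_def power_inverse)
  qed
qed

end

section \<open>Semigroup algebras\<close>

definition to_field :: "(qvec \<Rightarrow>\<^sub>0 'k::field) \<Rightarrow> 'k torus_field" where
  "to_field p = Fract p 1"

lemma to_field_zero: "to_field 0 = 0"
  and to_field_one: "to_field 1 = 1"
  and to_field_add: "to_field (p + q) = to_field p + to_field q"
  and to_field_diff: "to_field (p - q) = to_field p - to_field q"
  and to_field_mult: "to_field (p * q) = to_field p * to_field q"
  by (simp_all add: to_field_def Zero_fract_def One_fract_def)

lemma to_field_sum: "to_field (\<Sum>i\<in>I. f i) = (\<Sum>i\<in>I. to_field (f i))"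
  by (induction I rule: infinite_finite_induct) (simp_all add: to_field_zero to_field_add)

lemma to_field_prod: "to_field (\<Prod>i\<in>I. f i) = (\<Prod>i\<in>I. to_field (f i))"
  by (induction I rule: infinite_finite_induct) (simp_all add: to_field_one to_field_mult)

lemma to_field_power: "to_field (p ^ k) = to_field p ^ k"
  by (induction k) (simp_all add: to_field_one to_field_mult)

lemma to_field_eq_iff: "to_field p = to_field q \<longleftrightarrow> p = q"
  by (simp add: to_field_def eq_fract)

lemma character_to_field: "character u = to_field (Poly_Mapping.single u 1)"
  and scalar_to_field: "scalar c = to_field (Poly_Mapping.single 0 c)"
  by (simp_all add: character_def scalar_def to_field_def)

lemma monomial_span_eq: "monomial_span S = to_field ` {p. Poly_Mapping.keys p \<subseteq> S}"
  by (auto simp: monomial_span_def to_field_def)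

lemma to_field_in_span_iff: "to_field p \<in> monomial_span S \<longleftrightarrow> Poly_Mapping.keys p \<subseteq> S"
  by (auto simp: monomial_span_eq to_field_eq_iff)

lemma monomial_spanE:
  assumes "a \<in> monomial_span S"
  obtains p where "a = to_field p" "Poly_Mapping.keys p \<subseteq> S"
  using assms by (auto simp: monomial_span_eq)

lemma character_in_span_iff: "character u \<in> monomial_span S \<longleftrightarrow> u \<in> S"
  by (simp add: character_to_field to_field_in_span_iff)

lemma scalar_in_span: "0 \<in> S \<Longrightarrow> scalar c \<in> monomial_span S"
  by (simp add: scalar_to_field to_field_in_span_iff)

lemma character_add: "character (u + v) = character u * character v"
  by (simp add: character_to_field to_field_mult[symmetric] mult_single)

lemma character_zero: "character 0 = 1"
  by (simp add: character_to_field to_field_one)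

lemma character_nonzero: "character u \<noteq> (0 :: 'k::field torus_field)"
proof -
  have "character u * character (- u) = (1 :: 'k torus_field)"
    by (simp add: character_add[symmetric] character_zero)
  then show ?thesis by auto
qed

lemma character_minus: "character (- u) = inverse (character u)"
proof -
  have "character u * character (- u) = (1 :: 'a torus_field)"
    by (simp add: character_add[symmetric] character_zero)
  then show ?thesis by (simp add: inverse_unique)
qed

lemma character_diff: "character (u - v) = character u / character v"
  using character_add[of u "- v"] by (simp add: character_minus divide_inverse)

lemma qscale_of_nat_Suc: "qscale (of_nat (Suc k)) u = u + qscale (of_nat k) u"
  by (simp add: qvec.scale_left_distrib)

lemma character_power: "character (qscale (of_nat k) u) = character u ^ k"
proof (induction k)
  case (Suc k)
  show ?case unfolding qscale_of_nat_Suc character_add Suc by simp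
qed (simp add: character_zero)

lemma character_powi: "character (qscale (of_int j) u) = character u powi j"
proof (cases "j \<ge> 0")
  case True
  then show ?thesis using character_power[of "nat j" u] by (simp add: power_int_def)
next
  case False
  then have "of_int j = - (of_nat (nat (- j)) :: rat)" by simp
  then have "qscale (of_int j) u = - qscale (of_nat (nat (- j))) u"
    by (simp only: qvec.scale_minus_left)
  then have "character (qscale (of_int j) u) = inverse (character u ^ nat (- j))"
    by (simp only: character_minus character_power)
  then show ?thesis using False by (simp add: power_int_def power_inverse)
qed

lemma poly_mapping_sum_single: "p = (\<Sum>k\<in>Poly_Mapping.keys p. Poly_Mapping.single k (Poly_Mapping.lookup p k))"
proof (rule poly_mapping_eqI)
  fix i
  have "Poly_Mapping.lookup (\<Sum>k\<in>Poly_Mapping.keys p. Poly_Mapping.single k (Poly_Mapping.lookup p k)) i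
      = (\<Sum>k\<in>Poly_Mapping.keys p. if k = i then Poly_Mapping.lookup p k else 0)"
    unfolding lookup_sum by (intro sum.cong) (auto simp: lookup_single when_def)
  also have "\<dots> = Poly_Mapping.lookup p i" by (simp add: in_keys_iff)
  finally show "Poly_Mapping.lookup p i = Poly_Mapping.lookup
      (\<Sum>k\<in>Poly_Mapping.keys p. Poly_Mapping.single k (Poly_Mapping.lookup p k)) i" ..
qed

lemma to_field_sum_characters:
  "to_field p = (\<Sum>k\<in>Poly_Mapping.keys p. scalar (Poly_Mapping.lookup p k) * character k)"
proof -
  have "to_field p = (\<Sum>k\<in>Poly_Mapping.keys p. to_field (Poly_Mapping.single k (Poly_Mapping.lookup p k)))"
    by (subst poly_mapping_sum_single[of p]) (rule to_field_sum)
  also have "\<dots> = (\<Sum>k\<in>Poly_Mapping.keys p. scalar (Poly_Mapping.lookup p k) * character k)"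
    by (simp add: scalar_to_field character_to_field to_field_mult[symmetric] mult_single)
  finally show ?thesis .
qed

text \<open>Used with \<open>S\<close> an orthogonal complement, where it separates the part of a
  polynomial that survives on an orbit closure from the part in its ideal.\<close>

lemma poly_mapping_split:
  fixes p :: "'a \<Rightarrow>\<^sub>0 'b::ab_group_add"
  obtains q r where "p = q + r" "Poly_Mapping.keys q = Poly_Mapping.keys p \<inter> S"
    "Poly_Mapping.keys r = Poly_Mapping.keys p - S"
proof -
  define q where "q = Poly_Mapping.mapp (\<lambda>k c. c when k \<in> S) p"
  have q: "Poly_Mapping.lookup q k = (if k \<in> S then Poly_Mapping.lookup p k else 0)" for k
    by (auto simp: q_def lookup_mapp when_def in_keys_iff)
  show thesis
  proof (rule that[of q "p - q"])
    show "Poly_Mapping.keys q = Poly_Mapping.keys p \<inter> S" by (auto simp: in_keys_iff q split: if_splits)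
    show "Poly_Mapping.keys (p - q) = Poly_Mapping.keys p - S"
      by (auto simp: in_keys_iff q lookup_minus split: if_splits)
  qed simp
qed

text \<open>Polynomials are scalar combinations of characters, so inclusions need only be tested on
  characters.\<close>

lemma monomial_span_subset_ideal:
  fixes I :: "'k::field torus_field set"
  assumes "ideal_in R I" "\<And>c. scalar c \<in> R" "\<And>k. k \<in> S \<Longrightarrow> character k \<in> I"
  shows "monomial_span S \<subseteq> I"
proof
  fix a :: "'k torus_field" assume "a \<in> monomial_span S"
  then obtain p where p: "a = to_field p" "Poly_Mapping.keys p \<subseteq> S" by (rule monomial_spanE)
  show "a \<in> I"
    unfolding p(1) to_field_sum_characters
    using p(2) assms(2,3) by (auto intro!: ideal_in_sum[OF assms(1)] ideal_in_mult_left[OF assms(1)])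
qed

lemma monomial_span_subset_subring:
  fixes R :: "'k::field torus_field set"
  assumes "subring_of_field R" "\<And>c. scalar c \<in> R" "\<And>k. k \<in> S \<Longrightarrow> character k \<in> R"
  shows "monomial_span S \<subseteq> R"
  using assms by (intro monomial_span_subset_ideal[of R]) (auto simp: ideal_in_def subring_closed)

lemma keys_mult_closed:
  fixes p q :: "qvec \<Rightarrow>\<^sub>0 'k::field"
  assumes "Poly_Mapping.keys p \<subseteq> S" "Poly_Mapping.keys q \<subseteq> T" "\<And>a b. a \<in> S \<Longrightarrow> b \<in> T \<Longrightarrow> a + b \<in> U"
  shows "Poly_Mapping.keys (p * q) \<subseteq> U"
  using keys_mult[of p q] assms by blast

lemma subring_monomial_span:
  assumes "0 \<in> S" "\<And>a b. a \<in> S \<Longrightarrow> b \<in> S \<Longrightarrow> a + b \<in> S"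
  shows "subring_of_field (monomial_span S :: 'k::field torus_field set)"
  unfolding subring_of_field_def
proof (intro conjI ballI)
  show "1 \<in> (monomial_span S :: 'k torus_field set)"
    using assms(1) by (simp add: to_field_one[symmetric] to_field_in_span_iff)
  fix a b :: "'k torus_field" assume "a \<in> monomial_span S" "b \<in> monomial_span S"
  then obtain p q where p: "a = to_field p" "Poly_Mapping.keys p \<subseteq> S"
    and q: "b = to_field q" "Poly_Mapping.keys q \<subseteq> S" by (metis monomial_spanE)
  show "a - b \<in> monomial_span S"
    using p q keys_diff[of p q] by (auto simp: to_field_diff[symmetric] to_field_in_span_iff)
  show "a * b \<in> monomial_span S"
    using p q keys_mult_closed[of p S q S S] assms(2)
    by (auto simp: to_field_mult[symmetric] to_field_in_span_iff)
qed

section \<open>Affine charts\<close>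

lemma zero_in_dual_lattice: "0 \<in> dual_cone n \<sigma> \<inter> lattice_pts n"
  by (simp add: dual_cone_zero lattice_zero)

lemma subring_chart_ring: "subring_of_field (chart_ring n \<sigma>)"
  unfolding chart_ring_def
  by (intro subring_monomial_span) (auto simp: zero_in_dual_lattice dual_cone_add lattice_add
      dual_cone_zero lattice_zero)

lemma scalar_in_chart_ring: "scalar c \<in> chart_ring n \<sigma>"
  unfolding chart_ring_def by (intro scalar_in_span zero_in_dual_lattice)

lemma character_in_chart_ring_iff:
  "character u \<in> chart_ring n \<sigma> \<longleftrightarrow> u \<in> dual_cone n \<sigma> \<and> u \<in> lattice_pts n"
  by (simp add: chart_ring_def character_in_span_iff)

lemma chart_ring_antimono: "\<tau> \<subseteq> \<sigma> \<Longrightarrow> chart_ring n \<sigma> \<subseteq> chart_ring n \<tau>"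
  unfolding chart_ring_def monomial_span_eq using dual_cone_antimono[of \<tau> \<sigma> n] by blast

lemma character_unit_chart_ring:
  "u \<in> perp n \<sigma> \<Longrightarrow> u \<in> lattice_pts n \<Longrightarrow> character u \<in> local_units (chart_ring n \<sigma>)"
  using perp_subset_dual_cone[of n \<sigma>] perp_closed(3)[of u n \<sigma>] lattice_minus[of u n]
  by (auto simp: local_units_def character_nonzero character_minus[symmetric] character_in_chart_ring_iff)

text \<open>The prime ideal of \<open>V(\<tau>) \<inter> U\<^sub>\<sigma>\<close> for a face \<open>\<tau>\<close> of \<open>\<sigma>\<close>.\<close>

definition face_ideal :: "nat \<Rightarrow> cone \<Rightarrow> cone \<Rightarrow> 'k::field torus_field set" where
  "face_ideal n \<sigma> \<tau> = monomial_span ((dual_cone n \<sigma> - perp n \<tau>) \<inter> lattice_pts n)"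

lemma face_ideal_subset: "face_ideal n \<sigma> \<tau> \<subseteq> chart_ring n \<sigma>"
  by (auto simp: face_ideal_def chart_ring_def monomial_span_eq)

lemma character_in_face_ideal_iff:
  "character u \<in> face_ideal n \<sigma> \<tau> \<longleftrightarrow> u \<in> dual_cone n \<sigma> \<and> u \<notin> perp n \<tau> \<and> u \<in> lattice_pts n"
  by (simp add: face_ideal_def character_in_span_iff)

text \<open>Modulo the ideal, only the parts \<open>p0\<close> and \<open>q0\<close> with exponents
  in \<open>\<tau>\<^sup>\<bottom>\<close> count. If the product is in the ideal, the exponents of
  \<open>p0 * q0\<close> lie both inside and outside \<open>\<tau>\<^sup>\<bottom>\<close>, so
  \<open>p0 * q0 = 0\<close>, and the group algebra is a domain.\<close>

lemma prime_face_ideal: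
  assumes "\<tau> \<subseteq> \<sigma>"
  shows "prime_in (chart_ring n \<sigma>) (face_ideal n \<sigma> \<tau> :: 'k::field torus_field set)"
proof -
  let ?D = "dual_cone n \<sigma> \<inter> lattice_pts n" and ?F = "(dual_cone n \<sigma> - perp n \<tau>) \<inter> lattice_pts n"
  have add: "a + b \<in> ?F" if "a \<in> ?D" "b \<in> ?F" for a b
    using that dual_cone_add_in_perp[OF assms] by (auto simp: dual_cone_add lattice_add)
  have ideal: "ideal_in (chart_ring n \<sigma>) (face_ideal n \<sigma> \<tau> :: 'k torus_field set)"
    unfolding ideal_in_def
  proof (intro conjI ballI face_ideal_subset)
    show "0 \<in> (face_ideal n \<sigma> \<tau> :: 'k torus_field set)"
      by (simp add: face_ideal_def to_field_zero[symmetric] to_field_in_span_iff)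
    fix a :: "'k torus_field" assume "a \<in> face_ideal n \<sigma> \<tau>"
    then obtain p where p: "a = to_field p" "Poly_Mapping.keys p \<subseteq> ?F"
      unfolding face_ideal_def by (rule monomial_spanE)
    {
      fix b :: "'k torus_field" assume "b \<in> face_ideal n \<sigma> \<tau>"
      then obtain q where q: "b = to_field q" "Poly_Mapping.keys q \<subseteq> ?F"
        unfolding face_ideal_def by (rule monomial_spanE)
      then show "a + b \<in> face_ideal n \<sigma> \<tau>"
        using p keys_add[of p q] unfolding face_ideal_def
        by (auto simp: to_field_add[symmetric] to_field_in_span_iff)
    }
    fix b :: "'k torus_field" assume "b \<in> chart_ring n \<sigma>"
    then obtain q where q: "b = to_field q" "Poly_Mapping.keys q \<subseteq> ?D"
      unfolding chart_ring_def by (rule monomial_spanE)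
    have "Poly_Mapping.keys (q * p) \<subseteq> ?F" by (rule keys_mult_closed[OF q(2) p(2) add])
    then show "b * a \<in> face_ideal n \<sigma> \<tau>"
      unfolding p q face_ideal_def by (simp add: to_field_mult[symmetric] to_field_in_span_iff)
  qed
  show ?thesis
    unfolding prime_in_def
  proof (intro conjI ballI impI ideal)
    show "1 \<notin> (face_ideal n \<sigma> \<tau> :: 'k torus_field set)"
      by (simp add: character_zero[symmetric] character_in_face_ideal_iff perp_closed)
    fix a b :: "'k torus_field"
    assume ab: "a \<in> chart_ring n \<sigma>" "b \<in> chart_ring n \<sigma>" "a * b \<in> face_ideal n \<sigma> \<tau>"
    from ab(1) obtain p where p: "a = to_field p" "Poly_Mapping.keys p \<subseteq> ?D"
      unfolding chart_ring_def by (rule monomial_spanE)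
    from ab(2) obtain q where q: "b = to_field q" "Poly_Mapping.keys q \<subseteq> ?D"
      unfolding chart_ring_def by (rule monomial_spanE)
    obtain p0 p1 where p01: "p = p0 + p1" "Poly_Mapping.keys p0 = Poly_Mapping.keys p \<inter> perp n \<tau>"
      "Poly_Mapping.keys p1 = Poly_Mapping.keys p - perp n \<tau>" by (rule poly_mapping_split)
    obtain q0 q1 where q01: "q = q0 + q1" "Poly_Mapping.keys q0 = Poly_Mapping.keys q \<inter> perp n \<tau>"
      "Poly_Mapping.keys q1 = Poly_Mapping.keys q - perp n \<tau>" by (rule poly_mapping_split)
    have p1: "to_field p1 \<in> face_ideal n \<sigma> \<tau>" and q1: "to_field q1 \<in> face_ideal n \<sigma> \<tau>"
      using p q p01 q01 by (auto simp: face_ideal_def to_field_in_span_iff)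
    have p0: "to_field p0 \<in> chart_ring n \<sigma>"
      using p p01 by (auto simp: chart_ring_def to_field_in_span_iff)
    have "to_field (p0 * q0) = a * b - to_field p0 * to_field q1 - to_field p1 * b"
      by (simp add: p q p01 q01 to_field_add to_field_mult algebra_simps)
    also have "\<dots> \<in> face_ideal n \<sigma> \<tau>"
      using ab p0 p1 q1
      by (intro ideal_in_diff[OF subring_chart_ring ideal] ideal_in_mult_left[OF ideal q1]
          ideal_in_mult_right[OF ideal p1]) auto
    finally have "Poly_Mapping.keys (p0 * q0) \<subseteq> ?F" by (simp add: face_ideal_def to_field_in_span_iff)
    moreover have "Poly_Mapping.keys (p0 * q0) \<subseteq> perp n \<tau>"
      by (rule keys_mult_closed[of _ "perp n \<tau>" _ "perp n \<tau>"]) (auto simp: p01 q01 perp_closed)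
    ultimately have "Poly_Mapping.keys (p0 * q0) = {}" by blast
    then have "p0 = 0 \<or> q0 = 0" by simp
    then show "a \<in> face_ideal n \<sigma> \<tau> \<or> b \<in> face_ideal n \<sigma> \<tau>"
      using p1 q1 by (auto simp: p q p01 q01)
  qed
qed

lemma chart_iff: "x \<in> chart n \<sigma> \<longleftrightarrow> (\<exists>P. prime_in (chart_ring n \<sigma>) P \<and> x = localize (chart_ring n \<sigma>) P)"
  by (auto simp: chart_def chart_primes_def primeideal_ring_of_iff[OF subring_chart_ring])

lemma chart_primes_iff: "P \<in> chart_primes n \<sigma> \<longleftrightarrow> prime_in (chart_ring n \<sigma>) P"
  by (simp add: chart_primes_def primeideal_ring_of_iff[OF subring_chart_ring])

text \<open>The prime of a point is the contraction of its maximal ideal. From here on points are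
  handled as local rings, and primes are recovered when wanted.\<close>

lemma
  assumes "x \<in> chart n \<sigma>"
  shows chart_local: "local_subring x"
    and chart_ring_subset: "chart_ring n \<sigma> \<subseteq> x"
    and chart_prime: "prime_in (chart_ring n \<sigma>) (max_ideal x \<inter> chart_ring n \<sigma>)"
    and chart_localize: "localize (chart_ring n \<sigma>) (max_ideal x \<inter> chart_ring n \<sigma>) = x"
proof -
  obtain P where P: "prime_in (chart_ring n \<sigma>) P" "x = localize (chart_ring n \<sigma>) P"
    using assms by (auto simp: chart_iff)
  show "local_subring x" "chart_ring n \<sigma> \<subseteq> x"
    unfolding P(2) by (rule local_subring_localize[OF subring_chart_ring P(1)]
        subset_localize[OF subring_chart_ring P(1)])+
  have "max_ideal x \<inter> chart_ring n \<sigma> = P"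
    unfolding P(2) by (rule max_ideal_localize_Int[OF subring_chart_ring P(1)])
  then show "prime_in (chart_ring n \<sigma>) (max_ideal x \<inter> chart_ring n \<sigma>)"
    and "localize (chart_ring n \<sigma>) (max_ideal x \<inter> chart_ring n \<sigma>) = x"
    using P by simp_all
qed

lemma chart_intermediate:
  assumes "x \<in> chart n \<sigma>" "\<tau> \<subseteq> \<sigma>" "chart_ring n \<tau> \<subseteq> x"
  shows "x \<in> chart n \<tau>"
proof -
  let ?P = "max_ideal x \<inter> chart_ring n \<sigma>"
  have "localize (chart_ring n \<tau>) (max_ideal x \<inter> chart_ring n \<tau>) = x"
    using localize_intermediate[OF subring_chart_ring chart_prime[OF assms(1)] subring_chart_ring
        chart_ring_antimono[OF assms(2)]] assms(3) chart_localize[OF assms(1)] by simp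
  then show ?thesis
    using prime_in_max_ideal_Int[OF chart_local[OF assms(1)] subring_chart_ring assms(3)]
    by (auto simp: chart_iff)
qed

lemma scalar_in_chart: "x \<in> chart n \<sigma> \<Longrightarrow> scalar c \<in> x"
  using chart_ring_subset scalar_in_chart_ring by blast

lemma character_in_point: "x \<in> chart n \<sigma> \<Longrightarrow> u \<in> dual_cone n \<sigma> \<Longrightarrow> u \<in> lattice_pts n \<Longrightarrow> character u \<in> x"
  using chart_ring_subset character_in_chart_ring_iff by blast

lemma character_unit_point:
  "x \<in> chart n \<sigma> \<Longrightarrow> u \<in> perp n \<sigma> \<Longrightarrow> u \<in> lattice_pts n \<Longrightarrow> character u \<in> local_units x"
  using character_unit_chart_ring local_units_mono[OF chart_ring_subset] by blast

section \<open>Passing between the charts of a cone and of a face\<close>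

lemma face_shift_keys:
  assumes "polyhedral_cone n \<sigma>" "u \<in> dual_cone n \<sigma>" "\<tau> = {v \<in> \<sigma>. pairing u v = 0}"
    and "finite K" "K \<subseteq> dual_cone n \<tau>"
  obtains N :: nat where "\<And>k. k \<in> K \<Longrightarrow> k + qscale (of_nat N) u \<in> dual_cone n \<sigma>"
proof -
  have "\<exists>N::nat. \<forall>k\<in>K. k + qscale (of_nat N) u \<in> dual_cone n \<sigma>"
    using assms(4,5)
  proof (induction rule: finite_induct)
    case (insert x K)
    then obtain N :: nat where N: "\<forall>k\<in>K. k + qscale (of_nat N) u \<in> dual_cone n \<sigma>" by auto
    obtain N' :: nat where N': "x + qscale (of_nat N') u \<in> dual_cone n \<sigma>"
      using dual_cone_face_shift[OF assms(1-3), of x] insert.prems by auto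
    have "k + qscale (of_nat (N + N')) u \<in> dual_cone n \<sigma>" if "k \<in> insert x K" for k
    proof (cases "k = x")
      case True
      have eq: "k + qscale (of_nat (N + N')) u = (x + qscale (of_nat N') u) + qscale (of_nat N) u"
        by (simp add: True qvec.scale_left_distrib algebra_simps)
      show ?thesis unfolding eq by (rule dual_cone_add[OF N' dual_cone_scale[OF assms(2)]]) simp
    next
      case False
      have eq: "k + qscale (of_nat (N + N')) u = (k + qscale (of_nat N) u) + qscale (of_nat N') u"
        by (simp add: qvec.scale_left_distrib algebra_simps)
      have "k + qscale (of_nat N) u \<in> dual_cone n \<sigma>" using N False that by blast
      then show ?thesis unfolding eq by (rule dual_cone_add[OF _ dual_cone_scale[OF assms(2)]]) simp
    qed
    then show ?case by blast
  qed simp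
  then show thesis using that by blast
qed

text \<open>The coordinate ring of a face is that of \<open>\<sigma>\<close> with
  \<open>character u\<close> inverted, so a ring containing the latter and
  \<open>character (- u)\<close> contains it.\<close>

lemma face_chart_ring_subset:
  fixes R :: "'k::field torus_field set"
  assumes "polyhedral_cone n \<sigma>" "u \<in> dual_cone n \<sigma>" "u \<in> lattice_pts n"
    "\<tau> = {v \<in> \<sigma>. pairing u v = 0}"
    and R: "subring_of_field R" "chart_ring n \<sigma> \<subseteq> R" "character (- u) \<in> R"
  shows "chart_ring n \<tau> \<subseteq> R"
  unfolding chart_ring_def
proof (rule monomial_span_subset_subring[OF R(1)])
  show "scalar c \<in> R" for c using R(2) scalar_in_chart_ring by blast
  fix k assume k: "k \<in> dual_cone n \<tau> \<inter> lattice_pts n"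
  then obtain N :: nat where N: "k + qscale (of_nat N) u \<in> dual_cone n \<sigma>"
    using dual_cone_face_shift[OF assms(1,2,4)] by blast
  have "k + qscale (of_nat N) u \<in> lattice_pts n" using k assms(3) by (simp add: lattice_closed)
  then have "character (k + qscale (of_nat N) u) \<in> R"
    using N R(2) character_in_chart_ring_iff by blast
  then have "character (k + qscale (of_nat N) u) * character (- u) ^ N \<in> R"
    using R by (intro subring_mult subring_power)
  moreover have "character (k + qscale (of_nat N) u) * character (- u) ^ N = (character k :: 'k torus_field)"
    using character_nonzero[of u, where 'k='k]
    by (simp add: power_mult_distrib[symmetric] mult.assoc character_add character_power character_minus)
  ultimately show "character k \<in> R" by simp
qed

section \<open>Points of the toric variety\<close>

lemma orbit_closure_eq: "orbit_closure n \<sigma> = localize (chart_ring n \<sigma>) (face_ideal n \<sigma> \<sigma>)"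
  by (simp add: orbit_closure_def face_ideal_def)

lemma orbit_closure_in_chart: "orbit_closure n \<sigma> \<in> chart n \<sigma>"
  using prime_face_ideal[of \<sigma> \<sigma> n] by (auto simp: chart_iff orbit_closure_eq)

lemma orbit_closure_local: "local_subring (orbit_closure n \<sigma>)"
  by (rule chart_local[OF orbit_closure_in_chart])

lemma orbit_closure_max_Int: "max_ideal (orbit_closure n \<sigma>) \<inter> chart_ring n \<sigma> = face_ideal n \<sigma> \<sigma>"
  unfolding orbit_closure_eq
  by (rule max_ideal_localize_Int[OF subring_chart_ring prime_face_ideal]) simp

lemma orbit_closure_character_unit_iff:
  assumes "u \<in> dual_cone n \<sigma>" "u \<in> lattice_pts n"
  shows "(character u :: 'k::field torus_field) \<in> local_units (orbit_closure n \<sigma>) \<longleftrightarrow> u \<in> perp n \<sigma>"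
proof -
  let ?c = "character u :: 'k torus_field"
  have c: "?c \<in> chart_ring n \<sigma>" using assms by (simp add: character_in_chart_ring_iff)
  then have "?c \<in> orbit_closure n \<sigma>"
    using chart_ring_subset[OF orbit_closure_in_chart] by blast
  then have "?c \<in> max_ideal (orbit_closure n \<sigma>) \<longleftrightarrow> ?c \<notin> local_units (orbit_closure n \<sigma>)"
    by (rule in_max_ideal_iff)
  then have "?c \<in> local_units (orbit_closure n \<sigma>) \<longleftrightarrow> ?c \<notin> face_ideal n \<sigma> \<sigma>"
    using orbit_closure_max_Int[of n \<sigma>, where 'a='k] c by blast
  then show ?thesis using assms by (auto simp: character_in_face_ideal_iff)
qed

text \<open>A fraction in the small chart is expanded by the character of a large multiple
  \<open>s\<close> of \<open>u\<close>. This brings all exponents into the dual of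
  \<open>\<tau>\<close>, and as \<open>s\<close> is in \<open>\<sigma>\<^sup>\<bottom>\<close>, the
  denominator stays off the ideal.\<close>

lemma orbit_closure_eq_localize_face:
  assumes "polyhedral_cone n \<tau>" "is_face n \<sigma> \<tau>"
  shows "orbit_closure n \<sigma> = localize (chart_ring n \<tau>) (face_ideal n \<tau> \<sigma> :: 'k::field torus_field set)"
proof
  let ?A = "chart_ring n \<tau> :: 'k torus_field set" and ?B = "chart_ring n \<sigma> :: 'k torus_field set"
  obtain u where u: "u \<in> dual_cone n \<tau>" "u \<in> lattice_pts n" "\<sigma> = {v \<in> \<tau>. pairing u v = 0}"
    "u \<in> perp n \<sigma>" using face_lattice_functional[OF assms(2)] .
  have sub: "\<sigma> \<subseteq> \<tau>" by (rule face_subset[OF assms(2)])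
  show "localize ?A (face_ideal n \<tau> \<sigma>) \<subseteq> orbit_closure n \<sigma>"
  proof
    fix r :: "'k torus_field" assume "r \<in> localize ?A (face_ideal n \<tau> \<sigma>)"
    then obtain a b where ab: "a \<in> ?A" "b \<in> ?A" "b \<notin> face_ideal n \<tau> \<sigma>" "r = a / b"
      by (auto simp: localize_def)
    from ab(2) obtain q where q: "b = to_field q" "Poly_Mapping.keys q \<subseteq> dual_cone n \<tau> \<inter> lattice_pts n"
      unfolding chart_ring_def by (rule monomial_spanE)
    then have "b \<notin> face_ideal n \<sigma> \<sigma>" using ab(3) by (auto simp: face_ideal_def to_field_in_span_iff)
    then show "r \<in> orbit_closure n \<sigma>"
      using ab chart_ring_antimono[OF sub, of n, where 'a='k] by (auto simp: orbit_closure_eq localize_def)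
  qed
  show "orbit_closure n \<sigma> \<subseteq> localize ?A (face_ideal n \<tau> \<sigma>)"
  proof
    fix r :: "'k torus_field" assume "r \<in> orbit_closure n \<sigma>"
    then obtain a b where ab: "a \<in> ?B" "b \<in> ?B" "b \<notin> face_ideal n \<sigma> \<sigma>" "r = a / b"
      by (auto simp: orbit_closure_eq localize_def)
    from ab(1) obtain p where p: "a = to_field p" "Poly_Mapping.keys p \<subseteq> dual_cone n \<sigma> \<inter> lattice_pts n"
      unfolding chart_ring_def by (rule monomial_spanE)
    from ab(2) obtain q where q: "b = to_field q" "Poly_Mapping.keys q \<subseteq> dual_cone n \<sigma> \<inter> lattice_pts n"
      unfolding chart_ring_def by (rule monomial_spanE)
    obtain N :: nat where N: "\<And>k. k \<in> Poly_Mapping.keys p \<union> Poly_Mapping.keys q \<Longrightarrow>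
        k + qscale (of_nat N) u \<in> dual_cone n \<tau>"
      using face_shift_keys[OF assms(1) u(1,3), of "Poly_Mapping.keys p \<union> Poly_Mapping.keys q"] p q
      by auto
    define s where "s = qscale (of_nat N) u"
    have s: "s \<in> lattice_pts n" "s \<in> perp n \<sigma>" using u by (auto simp: s_def lattice_closed perp_closed)
    have keys: "to_field x * character s \<in> ?A"
      if x: "Poly_Mapping.keys x \<subseteq> lattice_pts n" "Poly_Mapping.keys x \<subseteq> Poly_Mapping.keys p \<union> Poly_Mapping.keys q"
      for x :: "qvec \<Rightarrow>\<^sub>0 'k"
    proof -
      have "Poly_Mapping.keys (x * Poly_Mapping.single s 1) \<subseteq> dual_cone n \<tau> \<inter> lattice_pts n"
        by (rule keys_mult_closed[of _ "Poly_Mapping.keys x" _ "{s}"])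
          (use x N s in \<open>auto simp: s_def[symmetric] lattice_add\<close>)
      then show ?thesis
        by (simp add: character_to_field to_field_mult[symmetric] chart_ring_def to_field_in_span_iff)
    qed
    have aA: "a * character s \<in> ?A" and bA: "b * character s \<in> ?A" using keys p q by auto
    \<comment> \<open>Translation by \<open>s\<close> or \<open>- s\<close> preserves the complement
      of \<open>\<sigma>\<^sup>\<bottom>\<close>. Undoing the shift would therefore put
      \<open>b\<close> into the ideal as well.\<close>
    have "b * character s \<notin> face_ideal n \<tau> \<sigma>"
    proof
      assume *: "b * character s \<in> face_ideal n \<tau> \<sigma>"
      have "Poly_Mapping.single s 1 * Poly_Mapping.single (- s) 1 = (1 :: qvec \<Rightarrow>\<^sub>0 'k)"
        by (simp add: mult_single)
      then have eq: "(q * Poly_Mapping.single s 1) * Poly_Mapping.single (- s) 1 = q"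
        by (simp only: mult.assoc mult_1_right)
      have "Poly_Mapping.keys ((q * Poly_Mapping.single s 1) * Poly_Mapping.single (- s) 1)
          \<subseteq> (- perp n \<sigma>)"
      proof (rule keys_mult_closed)
        show "Poly_Mapping.keys (q * Poly_Mapping.single s 1) \<subseteq> - perp n \<sigma>"
          using * by (auto simp: q character_to_field to_field_mult[symmetric] face_ideal_def to_field_in_span_iff)
        show "Poly_Mapping.keys (Poly_Mapping.single (- s) (1::'k)) \<subseteq> {- s}" by simp
        show "x + y \<in> - perp n \<sigma>" if "x \<in> - perp n \<sigma>" "y \<in> {- s}" for x y
          using that perp_closed(1)[of "x - s" n \<sigma> s] s by auto
      qed
      then have "Poly_Mapping.keys q \<subseteq> - perp n \<sigma>" by (simp only: eq)
      then show False using ab(3) q by (auto simp: face_ideal_def to_field_in_span_iff)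
    qed
    moreover have "r = (a * character s) / (b * character s)"
      using ab(4) character_nonzero[of s, where 'k='k] by simp
    ultimately show "r \<in> localize ?A (face_ideal n \<tau> \<sigma>)" using aA bA unfolding localize_def by blast
  qed
qed

lemma orbit_closure_face:
  assumes "polyhedral_cone n \<tau>" "is_face n \<sigma> \<tau>"
  shows "orbit_closure n \<sigma> \<in> chart n \<tau>"
    and "max_ideal (orbit_closure n \<sigma>) \<inter> chart_ring n \<tau> = face_ideal n \<tau> \<sigma>"
proof -
  note P = prime_face_ideal[OF face_subset[OF assms(2)]]
  show "orbit_closure n \<sigma> \<in> chart n \<tau>"
    unfolding chart_iff using P orbit_closure_eq_localize_face[OF assms] by blast
  show "max_ideal (orbit_closure n \<sigma>) \<inter> chart_ring n \<tau> = face_ideal n \<tau> \<sigma>"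
    unfolding orbit_closure_eq_localize_face[OF assms]
    by (rule max_ideal_localize_Int[OF subring_chart_ring P])
qed

lemma fan_separation:
  assumes "fan n \<Sigma>" "\<sigma> \<in> \<Sigma>" "\<tau> \<in> \<Sigma>"
  obtains u where "u \<in> lattice_pts n" "u \<in> dual_cone n \<sigma>" "- u \<in> dual_cone n \<tau>"
    "\<sigma> \<inter> \<tau> = {v \<in> \<sigma>. pairing u v = 0}" "\<sigma> \<inter> \<tau> = {v \<in> \<tau>. pairing u v = 0}"
proof -
  have "is_face n (\<sigma> \<inter> \<tau>) \<tau>" using fan_Int_face[OF assms(1,3,2)] by (simp add: Int_commute)
  then show thesis
    using separation[OF fan_polyhedral[OF assms(1,2)] fan_polyhedral[OF assms(1,3)]
        fan_Int_face[OF assms]] that by blast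
qed

text \<open>Separatedness: the character of the separating vector is regular on one chart and its
  inverse on the other, so it is a unit at a common point; inverting it gives the chart of the
  intersection.\<close>

lemma chart_overlap:
  assumes "fan n \<Sigma>" "\<sigma> \<in> \<Sigma>" "\<tau> \<in> \<Sigma>" "x \<in> chart n \<sigma>" "x \<in> chart n \<tau>"
  shows "x \<in> chart n (\<sigma> \<inter> \<tau>)"
proof -
  obtain u where u: "u \<in> lattice_pts n" "u \<in> dual_cone n \<sigma>" "- u \<in> dual_cone n \<tau>"
    "\<sigma> \<inter> \<tau> = {v \<in> \<sigma>. pairing u v = 0}" "\<sigma> \<inter> \<tau> = {v \<in> \<tau>. pairing u v = 0}"
    by (rule fan_separation[OF assms(1-3)])
  have "character (- u) \<in> x" using character_in_point[OF assms(5) u(3)] u(1) by (simp add: lattice_minus)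
  then have "chart_ring n (\<sigma> \<inter> \<tau>) \<subseteq> x"
    by (rule face_chart_ring_subset[OF fan_polyhedral[OF assms(1,2)] u(2,1,4)
          local_subring_subring[OF chart_local[OF assms(4)]] chart_ring_subset[OF assms(4)]])
  then show ?thesis using chart_intermediate[OF assms(4)] by blast
qed

text \<open>The separating character is a unit at the generic point of V(\<open>\<sigma>\<close>),
  hence its exponent is orthogonal to \<open>\<sigma>\<close>, so the face
  \<open>\<sigma> \<inter> \<tau>\<close> it cuts out is all of \<open>\<sigma>\<close>.\<close>

lemma orbit_closure_in_chart_iff:
  assumes "fan n \<Sigma>" "\<sigma> \<in> \<Sigma>" "\<tau> \<in> \<Sigma>"
  shows "(orbit_closure n \<sigma> :: 'k::field point) \<in> chart n \<tau> \<longleftrightarrow> \<sigma> \<subseteq> \<tau>"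
proof
  assume x: "(orbit_closure n \<sigma> :: 'k point) \<in> chart n \<tau>"
  obtain u where u: "u \<in> lattice_pts n" "u \<in> dual_cone n \<sigma>" "- u \<in> dual_cone n \<tau>"
    "\<sigma> \<inter> \<tau> = {v \<in> \<sigma>. pairing u v = 0}" "\<sigma> \<inter> \<tau> = {v \<in> \<tau>. pairing u v = 0}"
    by (rule fan_separation[OF assms(1-3)])
  have "character (- u) \<in> (orbit_closure n \<sigma> :: 'k point)"
    using character_in_point[OF x u(3)] u(1) by (simp add: lattice_minus)
  moreover have "character u \<in> (orbit_closure n \<sigma> :: 'k point)"
    by (rule character_in_point[OF orbit_closure_in_chart u(2,1)])
  ultimately have "character u \<in> local_units (orbit_closure n \<sigma> :: 'k point)"
    by (simp add: local_units_def character_nonzero character_minus)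
  then have "u \<in> perp n \<sigma>" using orbit_closure_character_unit_iff[OF u(2,1)] by blast
  then show "\<sigma> \<subseteq> \<tau>" using u(4) by (auto simp: perp_def)
next
  assume "\<sigma> \<subseteq> \<tau>"
  then show "(orbit_closure n \<sigma> :: 'k point) \<in> chart n \<tau>"
    using orbit_closure_face(1)[OF fan_polyhedral fan_subset_face] assms by blast
qed

lemma orbit_closure_inj:
  assumes "fan n \<Sigma>" "\<sigma> \<in> \<Sigma>" "\<tau> \<in> \<Sigma>" "(orbit_closure n \<sigma> :: 'k::field point) = orbit_closure n \<tau>"
  shows "\<sigma> = \<tau>"
proof
  have "(orbit_closure n \<sigma> :: 'k point) \<in> chart n \<tau>" unfolding assms(4) by (rule orbit_closure_in_chart)
  then show "\<sigma> \<subseteq> \<tau>" using orbit_closure_in_chart_iff[OF assms(1-3)] by blast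
  have "(orbit_closure n \<tau> :: 'k point) \<in> chart n \<sigma>"
    unfolding assms(4)[symmetric] by (rule orbit_closure_in_chart)
  then show "\<tau> \<subseteq> \<sigma>" using orbit_closure_in_chart_iff[OF assms(1,3,2)] by blast
qed

text \<open>The last two conclusions say that \<open>x\<close> lies in the orbit of \<open>\<tau>\<close>.\<close>

lemma point_in_orbit:
  assumes "polyhedral_cone n \<sigma>" "x \<in> chart n \<sigma>"
  obtains \<tau> where "is_face n \<tau> \<sigma>" "x \<in> chart n \<tau>" "face_ideal n \<tau> \<tau> \<subseteq> max_ideal x"
proof -
  note loc = chart_local[OF assms(2)]
  note R = local_subring_subring[OF loc]
  obtain G where G: "finite G" "G \<subseteq> lattice_pts n" "\<sigma> = conic G"
    using assms(1) by (rule polyhedral_lattice_generators)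
  define S where "S = {u \<in> dual_cone n \<sigma> \<inter> lattice_pts n. character u \<in> local_units x}"
  have zero: "0 \<in> S"
    using local_units_one[OF R] by (simp add: S_def dual_cone_zero lattice_zero character_zero)
  have add: "u + v \<in> S" if "u \<in> S" "v \<in> S" for u v
    using that local_units_mult[OF R] by (auto simp: S_def dual_cone_add lattice_add character_add)
  have sum: "sum f I \<in> S" if "\<And>i. i \<in> I \<Longrightarrow> f i \<in> S" for f :: "qvec \<Rightarrow> qvec" and I
    using that by (induction I rule: infinite_finite_induct) (auto simp: zero add)
  define B where "B = {g \<in> G. \<exists>u\<in>S. pairing u g \<noteq> 0}"
  have "\<forall>g\<in>B. \<exists>u. u \<in> S \<and> pairing u g \<noteq> 0" by (auto simp: B_def)
  from bchoice[OF this] obtain f where f: "\<forall>g\<in>B. f g \<in> S \<and> pairing (f g) g \<noteq> 0" ..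
  \<comment> \<open>\<open>f\<close> picks an element of \<open>S\<close> for each generator on
    which \<open>S\<close> does not vanish identically. By nonnegativity, the sum vanishes exactly
    on the generators killed by all of \<open>S\<close>, so the single \<open>w\<close> defines the
    face belonging to \<open>S\<close>.\<close>
  define w where "w = (\<Sum>g\<in>B. f g)"
  have wS: "w \<in> S" unfolding w_def using sum f by blast
  have nonneg: "0 \<le> pairing u v" if "u \<in> S" "v \<in> \<sigma>" for u v using that by (auto simp: S_def dual_cone_def)
  have G\<sigma>: "g \<in> \<sigma>" if "g \<in> G" for g using that G conic_generator by blast
  have w0: "pairing u g = 0" if "u \<in> S" "g \<in> G" "pairing w g = 0" for u g
  proof (rule ccontr)
    assume "pairing u g \<noteq> 0"
    then have gB: "g \<in> B" using that by (auto simp: B_def)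
    have "(\<Sum>h\<in>B. pairing (f h) g) = 0" using that(3) by (simp add: w_def pairing_sum_left)
    moreover have "finite B" using G by (simp add: B_def)
    moreover have "\<And>h. h \<in> B \<Longrightarrow> 0 \<le> pairing (f h) g" using f nonneg G\<sigma>[OF that(2)] by blast
    ultimately have "\<forall>h\<in>B. pairing (f h) g = 0" by (simp add: sum_nonneg_eq_0_iff)
    then show False using f gB by blast
  qed
  define \<tau> where "\<tau> = {v \<in> \<sigma>. pairing w v = 0}"
  have w: "w \<in> dual_cone n \<sigma>" "w \<in> lattice_pts n" "character w \<in> local_units x" using wS by (auto simp: S_def)
  have "is_face n \<tau> \<sigma>" using w by (auto simp: is_face_def \<tau>_def)
  have "character (- w) \<in> x" using w(3) by (simp add: character_minus local_units_def)
  then have sub: "chart_ring n \<tau> \<subseteq> x"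
    by (rule face_chart_ring_subset[OF assms(1) w(1,2) \<tau>_def R chart_ring_subset[OF assms(2)]])
  then have x\<tau>: "x \<in> chart n \<tau>" by (rule chart_intermediate[OF assms(2) face_subset[OF \<open>is_face n \<tau> \<sigma>\<close>]])
  have S\<tau>: "pairing u v = 0" if "u \<in> S" "v \<in> \<tau>" for u v
  proof -
    have "v \<in> conic {g \<in> G. pairing w g = 0}"
      using that(2) G nonneg[OF wS G\<sigma>] by (intro conic_pairing_eq_0) (auto simp: \<tau>_def)
    then show ?thesis by (rule conic_pairing_zero) (use w0 that in auto)
  qed
  have "face_ideal n \<tau> \<tau> \<subseteq> max_ideal x"
    unfolding face_ideal_def
  proof (rule monomial_span_subset_ideal[OF local_subring_ideal[OF loc] scalar_in_chart[OF assms(2)]])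
    fix k assume k: "k \<in> (dual_cone n \<tau> - perp n \<tau>) \<inter> lattice_pts n"
    show "character k \<in> max_ideal x"
    proof (rule ccontr)
      assume "character k \<notin> max_ideal x"
      moreover have "character k \<in> x" using k sub character_in_chart_ring_iff by blast
      ultimately have ku: "character k \<in> local_units x" by (simp add: max_ideal_def)
      \<comment> \<open>Shifted by a multiple of \<open>w\<close>, a unit exponent \<open>k\<close>
        lands in \<open>S\<close>. Since \<open>S\<close> vanishes on \<open>\<tau>\<close>, so does
        \<open>k\<close>, contrary to its choice.\<close>
      obtain N :: nat where N: "k + qscale (of_nat N) w \<in> dual_cone n \<sigma>"
        using dual_cone_face_shift[OF assms(1) w(1) \<tau>_def] k by blast
      have "k + qscale (of_nat N) w \<in> S"
        using N k w ku R by (auto simp: S_def lattice_closed character_add character_power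
            intro!: local_units_mult local_units_power)
      then have "pairing k v = 0" if "v \<in> \<tau>" for v
        using S\<tau>[of _ v] that by (fastforce simp: \<tau>_def pairing_linear)
      then show False using k lattice_qspace by (auto simp: perp_def)
    qed
  qed
  then show thesis using that x\<tau> \<open>is_face n \<tau> \<sigma>\<close> by blast
qed

section \<open>Subvarieties of codimension one in an orbit closure\<close>

text \<open>Larger primes have smaller local rings, and contraction recovers the primes; thus
  specialization becomes inclusion of rings within a common chart.\<close>

lemma in_closure_iff:
  "in_closure n \<Sigma> v w \<longleftrightarrow> (\<exists>\<sigma>\<in>\<Sigma>. v \<in> chart n \<sigma> \<and> w \<in> chart n \<sigma> \<and> w \<subseteq> v)"
proof
  assume "in_closure n \<Sigma> v w"
  then obtain \<sigma> P Q where *: "\<sigma> \<in> \<Sigma>" "prime_in (chart_ring n \<sigma>) P" "prime_in (chart_ring n \<sigma>) Q"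
    "P \<subseteq> Q" "v = localize (chart_ring n \<sigma>) P" "w = localize (chart_ring n \<sigma>) Q"
    by (auto simp: in_closure_def chart_primes_iff)
  have "w \<subseteq> v" using * by (auto simp: localize_def)
  then show "\<exists>\<sigma>\<in>\<Sigma>. v \<in> chart n \<sigma> \<and> w \<in> chart n \<sigma> \<and> w \<subseteq> v" using * chart_iff by blast
next
  assume "\<exists>\<sigma>\<in>\<Sigma>. v \<in> chart n \<sigma> \<and> w \<in> chart n \<sigma> \<and> w \<subseteq> v"
  then obtain \<sigma> where *: "\<sigma> \<in> \<Sigma>" "v \<in> chart n \<sigma>" "w \<in> chart n \<sigma>" "w \<subseteq> v" by blast
  let ?A = "chart_ring n \<sigma>"
  have "max_ideal v \<inter> ?A \<subseteq> max_ideal w \<inter> ?A"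
    using max_ideal_mono[OF *(4)] chart_ring_subset[OF *(3)] by blast
  moreover have "max_ideal v \<inter> ?A \<in> chart_primes n \<sigma>" "max_ideal w \<inter> ?A \<in> chart_primes n \<sigma>"
    unfolding chart_primes_iff by (rule chart_prime[OF *(2)], rule chart_prime[OF *(3)])
  ultimately show "in_closure n \<Sigma> v w"
    unfolding in_closure_def
    using *(1) chart_localize[OF *(2), symmetric] chart_localize[OF *(3), symmetric] by blast
qed

lemma in_closure_subset: "in_closure n \<Sigma> v w \<Longrightarrow> w \<subseteq> v"
  by (auto simp: in_closure_iff)

lemma localize_antimono: "P \<subseteq> Q \<Longrightarrow> localize A Q \<subseteq> localize A P"
  by (auto simp: localize_def)

lemma orbit_closure_mono:
  assumes "fan n \<Sigma>" "\<sigma> \<in> \<Sigma>" "\<tau> \<in> \<Sigma>" "\<sigma> \<subseteq> \<tau>"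
  shows "(orbit_closure n \<tau> :: 'k::field point) \<subseteq> orbit_closure n \<sigma>"
proof -
  have "face_ideal n \<tau> \<sigma> \<subseteq> (face_ideal n \<tau> \<tau> :: 'k torus_field set)"
    using perp_antimono[OF assms(4), of n] unfolding face_ideal_def monomial_span_eq by blast
  then show ?thesis
    unfolding orbit_closure_eq_localize_face[OF fan_polyhedral[OF assms(1,3)] fan_subset_face[OF assms]]
      orbit_closure_eq[of n \<tau>] by (rule localize_antimono)
qed

lemma in_closure_orbit_closure:
  assumes "fan n \<Sigma>" "\<sigma> \<in> \<Sigma>" "\<tau> \<in> \<Sigma>" "\<sigma> \<subseteq> \<tau>"
  shows "in_closure n \<Sigma> (orbit_closure n \<sigma> :: 'k::field point) (orbit_closure n \<tau>)"
  unfolding in_closure_iff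
  using assms(3) orbit_closure_mono[OF assms] orbit_closure_in_chart
    orbit_closure_face(1)[OF fan_polyhedral[OF assms(1,3)] fan_subset_face[OF assms]] by blast

text \<open>The point lies in the orbit of some \<open>\<tau>\<close> containing
  \<open>\<sigma>\<close>. If \<open>\<tau> \<noteq> \<sigma>\<close>, then V(\<open>\<tau>\<close>)
  sits between, so it must be the point itself, and a proper face of \<open>\<tau>\<close> strictly
  above \<open>\<sigma>\<close> would give a forbidden intermediate point.\<close>

lemma codim_one_orbit_closure_cases:
  assumes fan: "fan n \<Sigma>" and \<sigma>: "\<sigma> \<in> \<Sigma>"
    and w: "codim_one n \<Sigma> (orbit_closure n \<sigma> :: 'k::field point) w"
  shows "w \<in> chart n \<sigma> \<or> (\<exists>\<tau>\<in>\<Sigma>. is_facet n \<sigma> \<tau> \<and> w = orbit_closure n \<tau>)"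
proof -
  let ?V = "\<lambda>\<sigma>. orbit_closure n \<sigma> :: 'k point"
  obtain \<rho> where \<rho>: "\<rho> \<in> \<Sigma>" "?V \<sigma> \<in> chart n \<rho>" "w \<in> chart n \<rho>" and wv: "w \<subseteq> ?V \<sigma>"
    using w by (auto simp: codim_one_def in_closure_iff)
  obtain \<tau> where \<tau>: "is_face n \<tau> \<rho>" "w \<in> chart n \<tau>" "face_ideal n \<tau> \<tau> \<subseteq> max_ideal w"
    by (rule point_in_orbit[OF fan_polyhedral[OF fan \<rho>(1)] \<rho>(3)])
  have \<tau>\<Sigma>: "\<tau> \<in> \<Sigma>" using fan_face[OF fan \<rho>(1) \<tau>(1)] .
  have "chart_ring n \<tau> \<subseteq> ?V \<sigma>" using chart_ring_subset[OF \<tau>(2)] wv by blast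
  then have "?V \<sigma> \<in> chart n \<tau>" by (rule chart_intermediate[OF \<rho>(2) face_subset[OF \<tau>(1)]])
  then have \<sigma>\<tau>: "\<sigma> \<subseteq> \<tau>" using orbit_closure_in_chart_iff[OF fan \<sigma> \<tau>\<Sigma>] by blast
  show ?thesis
  proof (cases "\<tau> = \<sigma>")
    case True
    then show ?thesis using \<tau>(2) by simp
  next
    case False
    have "w \<subseteq> ?V \<tau>"
    proof -
      have "w = localize (chart_ring n \<tau>) (max_ideal w \<inter> chart_ring n \<tau>)"
        using chart_localize[OF \<tau>(2)] by simp
      also have "\<dots> \<subseteq> ?V \<tau>"
        unfolding orbit_closure_eq using \<tau>(3) face_ideal_subset by (intro localize_antimono) blast
      finally show ?thesis .
    qed
    then have "in_closure n \<Sigma> (?V \<tau>) w"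
      unfolding in_closure_iff using \<tau>(2) \<tau>\<Sigma> orbit_closure_in_chart by blast
    moreover have "in_closure n \<Sigma> (?V \<sigma>) (?V \<tau>)" by (rule in_closure_orbit_closure[OF fan \<sigma> \<tau>\<Sigma> \<sigma>\<tau>])
    moreover have "?V \<tau> \<noteq> ?V \<sigma>" using orbit_closure_inj[OF fan \<tau>\<Sigma> \<sigma>] False by blast
    ultimately have w\<tau>: "w = ?V \<tau>" using w by (auto simp: codim_one_def)
    have "is_facet n \<sigma> \<tau>"
      unfolding is_facet_def proper_face_def
    proof (intro conjI allI impI)
      show "is_face n \<sigma> \<tau>" by (rule fan_subset_face[OF fan \<sigma> \<tau>\<Sigma> \<sigma>\<tau>])
      show "\<sigma> \<noteq> \<tau>" using False by simp
      fix \<kappa> assume \<kappa>: "(is_face n \<kappa> \<tau> \<and> \<kappa> \<noteq> \<tau>) \<and> \<sigma> \<subseteq> \<kappa>"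
      then have \<kappa>\<Sigma>: "\<kappa> \<in> \<Sigma>" using fan_face[OF fan \<tau>\<Sigma>] by blast
      have "in_closure n \<Sigma> (?V \<sigma>) (?V \<kappa>)" using in_closure_orbit_closure[OF fan \<sigma> \<kappa>\<Sigma>] \<kappa> by blast
      moreover have "in_closure n \<Sigma> (?V \<kappa>) w"
        unfolding w\<tau> using in_closure_orbit_closure[OF fan \<kappa>\<Sigma> \<tau>\<Sigma>] \<kappa> face_subset by blast
      ultimately have "?V \<kappa> = ?V \<sigma> \<or> ?V \<kappa> = ?V \<tau>" using w by (auto simp: codim_one_def w\<tau>)
      then show "\<kappa> = \<sigma>" using orbit_closure_inj[OF fan \<kappa>\<Sigma>] \<sigma> \<tau>\<Sigma> \<kappa> by blast
    qed
    then show ?thesis using w\<tau> \<tau>\<Sigma> by blast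
  qed
qed

text \<open>
  Modulo the ideal of \<open>V(\<sigma>)\<close>, an element of the chart ring of \<open>\<tau>\<close> is a polynomial in the character
  \<open>u\<close> over the group algebra of \<open>\<tau>\<^sup>\<bottom>\<close>; the exponent \<open>j\<close> is the least degree that occurs.
\<close>

lemma facet_normal_form:
  fixes a :: "'k::field torus_field"
  assumes \<sigma>\<tau>: "\<sigma> \<subseteq> \<tau>" and u: "u \<in> lattice_pts n" "u \<in> dual_cone n \<tau>" "u \<in> perp n \<sigma>" "u \<notin> perp n \<tau>"
    "\<forall>l\<in>perp n \<sigma> \<inter> lattice_pts n. \<exists>j::int. l - qscale (of_int j) u \<in> perp n \<tau>"
    and a: "a \<in> chart_ring n \<tau>" "a \<notin> face_ideal n \<tau> \<sigma>"
  obtains j b where "b \<in> chart_ring n \<tau>" "b \<notin> face_ideal n \<tau> \<tau>"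
    "a - character u ^ j * b \<in> face_ideal n \<tau> \<sigma>"
proof -
  let ?D = "dual_cone n \<tau> \<inter> lattice_pts n"
  from a(1) obtain p where p: "a = to_field p" "Poly_Mapping.keys p \<subseteq> ?D"
    unfolding chart_ring_def by (rule monomial_spanE)
  obtain q r where qr: "p = q + r" "Poly_Mapping.keys q = Poly_Mapping.keys p \<inter> perp n \<sigma>"
    "Poly_Mapping.keys r = Poly_Mapping.keys p - perp n \<sigma>" by (rule poly_mapping_split)
  have r: "to_field r \<in> face_ideal n \<tau> \<sigma>" using p qr by (auto simp: face_ideal_def to_field_in_span_iff)
  have "q \<noteq> 0"
  proof
    assume "q = 0"
    then have "a = to_field r" using p(1) qr(1) by simp
    then show False using a(2) r by simp
  qed
  then have qne: "Poly_Mapping.keys q \<noteq> {}" by simp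
  obtain x where x: "x \<in> \<tau>" "pairing u x > 0"
    using u(2,4) by (auto simp: dual_cone_def perp_def order_less_le)
  \<comment> \<open>The coefficient is a priori an integer; evaluation at \<open>x\<close>, where
    \<open>k\<close> is nonnegative and \<open>u\<close> is positive, excludes negative
    values.\<close>
  have "\<exists>j::nat. k - qscale (of_nat j) u \<in> perp n \<tau>" if k: "k \<in> Poly_Mapping.keys q" for k
  proof -
    obtain j :: int where j: "k - qscale (of_int j) u \<in> perp n \<tau>" using u(5) k qr(2) p(2) by blast
    have "0 \<le> pairing k x" using k qr(2) p(2) x(1) by (auto simp: dual_cone_def)
    also have "pairing k x = of_int j * pairing u x" using j x(1) by (simp add: perp_def pairing_linear)
    finally have "j \<ge> 0" using x(2) by (simp add: zero_le_mult_iff)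
    then show ?thesis using j by (intro exI[of _ "nat j"]) simp
  qed
  then have "\<forall>k\<in>Poly_Mapping.keys q. \<exists>j::nat. k - qscale (of_nat j) u \<in> perp n \<tau>" by blast
  from bchoice[OF this] obtain h :: "qvec \<Rightarrow> nat"
    where h: "\<forall>k\<in>Poly_Mapping.keys q. k - qscale (of_nat (h k)) u \<in> perp n \<tau>" ..
  define j where "j = Min (h ` Poly_Mapping.keys q)"
  have jle: "j \<le> h k" if "k \<in> Poly_Mapping.keys q" for k unfolding j_def using that by (intro Min_le) auto
  have "j \<in> h ` Poly_Mapping.keys q" unfolding j_def using qne by (intro Min_in) auto
  then obtain k0 where k0: "k0 \<in> Poly_Mapping.keys q" "j = h k0" by auto
  define s where "s = qscale (of_nat j) u"
  \<comment> \<open>Dividing by the minimal power keeps all exponents in the dual cone, while the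
    exponent \<open>k0\<close> attaining the minimum is moved into
    \<open>\<tau>\<^sup>\<bottom>\<close>; the latter keeps \<open>b\<close> off the ideal of
    V(\<open>\<tau>\<close>).\<close>
  define b where "b = Poly_Mapping.single (- s) 1 * q"
  have keys_b: "Poly_Mapping.keys b \<subseteq> ?D"
    unfolding b_def
  proof (rule keys_mult_closed)
    fix x k assume "x \<in> {- s}" "k \<in> Poly_Mapping.keys q"
    then have x: "x = - s" and k: "k \<in> Poly_Mapping.keys q" by auto
    have "k - s = (k - qscale (of_nat (h k)) u) + qscale (of_nat (h k) - of_nat j) u"
      by (simp add: s_def qvec.scale_left_diff_distrib)
    also have "\<dots> \<in> dual_cone n \<tau>"
      using h k jle[OF k] perp_subset_dual_cone u(2) by (intro dual_cone_add dual_cone_scale) auto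
    finally have "k - s \<in> dual_cone n \<tau>" .
    moreover have "k - s \<in> lattice_pts n"
      using k qr(2) p(2) u(1) by (auto simp: s_def intro!: lattice_diff lattice_scale)
    ultimately show "x + k \<in> ?D" by (simp add: x)
  qed auto
  have "Poly_Mapping.single s 1 * b = (Poly_Mapping.single s 1 * Poly_Mapping.single (- s) 1) * q"
    by (simp only: b_def mult.assoc)
  also have "Poly_Mapping.single s 1 * Poly_Mapping.single (- s) 1 = (1 :: qvec \<Rightarrow>\<^sub>0 'k)"
    by (simp add: mult_single)
  finally have q: "Poly_Mapping.single s 1 * b = q" by simp
  have tb: "character u ^ j * to_field b = to_field q"
    unfolding q[symmetric] to_field_mult character_to_field[symmetric] s_def character_power ..
  show thesis
  proof (rule that[of "to_field b" j])
    show "to_field b \<in> chart_ring n \<tau>" using keys_b by (simp add: chart_ring_def to_field_in_span_iff)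
    show "to_field b \<notin> face_ideal n \<tau> \<tau>"
    proof
      assume "to_field b \<in> face_ideal n \<tau> \<tau>"
      then have "Poly_Mapping.keys b \<subseteq> - perp n \<tau>" by (auto simp: face_ideal_def to_field_in_span_iff)
      moreover have "Poly_Mapping.keys q \<subseteq> {s + k |k. k \<in> Poly_Mapping.keys b}"
        unfolding q[symmetric] using keys_mult[of "Poly_Mapping.single s 1" b] by auto
      ultimately obtain k where k: "k0 = s + k" "k \<notin> perp n \<tau>" using k0(1) by blast
      have "k0 - s \<in> perp n \<tau>" using h k0 by (simp add: s_def)
      then show False using k by simp
    qed
    show "a - character u ^ j * to_field b \<in> face_ideal n \<tau> \<sigma>"
      using r by (simp add: tb p(1) qr(1) to_field_add)
  qed
qed

text \<open>An intermediate point is a prime \<open>Q\<close> between the two face ideals. If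
  \<open>Q\<close> contains \<open>character u\<close>, it contains every character in the larger
  ideal; if not, the normal form shows that it cannot exceed the smaller one.\<close>

lemma codim_one_facet:
  assumes fan: "fan n \<Sigma>" and \<tau>: "\<tau> \<in> \<Sigma>" and facet: "is_facet n \<sigma> \<tau>"
  shows "codim_one n \<Sigma> (orbit_closure n \<sigma> :: 'k::field point) (orbit_closure n \<tau>)"
  unfolding codim_one_def
proof (intro conjI allI impI)
  let ?V = "\<lambda>\<sigma>. orbit_closure n \<sigma> :: 'k point" and ?A = "chart_ring n \<tau> :: 'k torus_field set"
  have face: "is_face n \<sigma> \<tau>" "\<sigma> \<noteq> \<tau>" using facet by (auto simp: is_facet_def proper_face_def)
  have \<sigma>: "\<sigma> \<in> \<Sigma>" by (rule fan_face[OF fan \<tau> face(1)])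
  have \<sigma>\<tau>: "\<sigma> \<subseteq> \<tau>" by (rule face_subset[OF face(1)])
  note poly = fan_polyhedral[OF fan \<tau>]
  show "in_closure n \<Sigma> (?V \<sigma>) (?V \<tau>)" by (rule in_closure_orbit_closure[OF fan \<sigma> \<tau> \<sigma>\<tau>])
  show "?V \<tau> \<noteq> ?V \<sigma>" using orbit_closure_inj[OF fan \<tau> \<sigma>] face(2) by blast
  fix x assume x: "in_closure n \<Sigma> (?V \<sigma>) x \<and> in_closure n \<Sigma> x (?V \<tau>)"
  then have sub: "x \<subseteq> ?V \<sigma>" "?V \<tau> \<subseteq> x" by (auto dest: in_closure_subset)
  obtain \<rho> where \<rho>: "\<rho> \<in> \<Sigma>" "x \<in> chart n \<rho>" "?V \<tau> \<in> chart n \<rho>"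
    using x by (auto simp: in_closure_iff)
  have "\<tau> \<subseteq> \<rho>" using \<rho>(3) orbit_closure_in_chart_iff[OF fan \<tau> \<rho>(1)] by blast
  moreover have "?A \<subseteq> x" using chart_ring_subset[OF orbit_closure_in_chart] sub(2) by blast
  ultimately have x\<tau>: "x \<in> chart n \<tau>" by (rule chart_intermediate[OF \<rho>(2)])
  define Q where "Q = max_ideal x \<inter> ?A"
  have Q: "prime_in ?A Q" "localize ?A Q = x"
    unfolding Q_def by (rule chart_prime[OF x\<tau>], rule chart_localize[OF x\<tau>])
  note IQ = prime_in_ideal[OF Q(1)]
  have \<sigma>Q: "face_ideal n \<tau> \<sigma> \<subseteq> Q"
    unfolding orbit_closure_face(2)[OF poly face(1), symmetric] Q_def
    using max_ideal_mono[OF sub(1)] \<open>?A \<subseteq> x\<close> by blast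
  have Q\<tau>: "Q \<subseteq> face_ideal n \<tau> \<tau>"
    unfolding orbit_closure_max_Int[symmetric] Q_def
    using max_ideal_mono[OF sub(2)] chart_ring_subset[OF orbit_closure_in_chart[of n \<tau>]] by blast
  obtain u where u: "u \<in> lattice_pts n" "u \<in> dual_cone n \<tau>" "u \<in> perp n \<sigma>" "u \<notin> perp n \<tau>"
    "\<sigma> = {v \<in> \<tau>. pairing u v = 0}"
    "\<forall>l\<in>perp n \<sigma> \<inter> lattice_pts n. \<exists>j::int. l - qscale (of_int j) u \<in> perp n \<tau>"
    by (rule facet_lattice_generator[OF poly facet])
  show "x = ?V \<sigma> \<or> x = ?V \<tau>"
  proof (cases "character u \<in> Q")
    case True
    have "face_ideal n \<tau> \<tau> \<subseteq> Q"
      unfolding face_ideal_def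
    proof (rule monomial_span_subset_ideal[OF IQ scalar_in_chart_ring])
      fix k assume k: "k \<in> (dual_cone n \<tau> - perp n \<tau>) \<inter> lattice_pts n"
      show "character k \<in> Q"
      proof (cases "k \<in> perp n \<sigma>")
        case False
        then show ?thesis using \<sigma>Q k character_in_face_ideal_iff by blast
      next
        case k\<sigma>: True
        then obtain j :: int where j: "k - qscale (of_int j) u \<in> perp n \<tau>" using u(6) k by blast
        obtain v where v: "v \<in> \<tau>" "pairing u v > 0"
          using u(2,4) by (auto simp: dual_cone_def perp_def order_less_le)
        have kv: "pairing k v = of_int j * pairing u v" using j v(1) by (simp add: perp_def pairing_linear)
        have "0 \<le> pairing k v" using k v(1) by (auto simp: dual_cone_def)
        then have "j \<ge> 0" using v(2) by (simp add: kv zero_le_mult_iff)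
        moreover have "j \<noteq> 0" using j k by auto
        ultimately have j1: "j \<ge> 1" by simp
        \<comment> \<open>As \<open>j\<close> is at least 1, a factor \<open>character u\<close> can
          be split off inside the chart ring.\<close>
        have "k - u = (k - qscale (of_int j) u) + qscale (of_int (j - 1)) u"
          by (simp add: qvec.scale_left_diff_distrib)
        also have "\<dots> \<in> dual_cone n \<tau>"
          using j j1 perp_subset_dual_cone u(2) by (intro dual_cone_add dual_cone_scale) auto
        finally have "character (k - u) \<in> ?A"
          using k u(1) by (simp add: character_in_chart_ring_iff lattice_diff)
        then have "character (k - u) * character u \<in> Q" using True by (intro ideal_in_mult_left[OF IQ])
        then show ?thesis by (simp add: character_add[symmetric])
      qed
    qed
    then have "Q = face_ideal n \<tau> \<tau>" using Q\<tau> by blast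
    then show ?thesis using Q(2) by (simp add: orbit_closure_eq)
  next
    case False
    have "Q \<subseteq> face_ideal n \<tau> \<sigma>"
    proof
      fix a assume aQ: "a \<in> Q"
      then have aA: "a \<in> ?A" using ideal_in_subset[OF IQ] by blast
      show "a \<in> face_ideal n \<tau> \<sigma>"
      proof (rule ccontr)
        assume "a \<notin> face_ideal n \<tau> \<sigma>"
        then obtain j b where b: "b \<in> ?A" "b \<notin> face_ideal n \<tau> \<tau>"
          "a - character u ^ j * b \<in> face_ideal n \<tau> \<sigma>"
          using facet_normal_form[OF \<sigma>\<tau> u(1-4,6) aA] by blast
        have "a - character u ^ j * b \<in> Q" using b(3) \<sigma>Q by blast
        from ideal_in_diff[OF subring_chart_ring IQ aQ this]
        have "a - (a - character u ^ j * b) \<in> Q" .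
        then have "character u ^ j * b \<in> Q" by simp
        moreover have "character u \<in> ?A - Q" using False u by (simp add: character_in_chart_ring_iff)
        then have "character u ^ j \<in> ?A - Q" by (rule prime_in_power[OF subring_chart_ring Q(1)])
        ultimately have "b \<in> Q" using Q(1) b(1) by (auto simp: prime_in_def)
        then show False using b(2) Q\<tau> by blast
      qed
    qed
    then have "Q = face_ideal n \<tau> \<sigma>" using \<sigma>Q by blast
    then show ?thesis using Q(2) orbit_closure_eq_localize_face[OF poly face(1), where 'k='k] by simp
  qed
qed

text \<open>The normal form passes from the chart ring to its localization because denominators off
  the ideal of V(\<open>\<tau>\<close>) are units there.\<close>

lemma uniformizer_facet:
  assumes fan: "fan n \<Sigma>" and \<tau>: "\<tau> \<in> \<Sigma>" and facet: "is_facet n \<sigma> \<tau>"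
    and u: "u \<in> lattice_pts n" "u \<in> dual_cone n \<tau>" "u \<in> perp n \<sigma>" "u \<notin> perp n \<tau>"
    "\<forall>l\<in>perp n \<sigma> \<inter> lattice_pts n. \<exists>j::int. l - qscale (of_int j) u \<in> perp n \<tau>"
  shows "uniformizer (orbit_closure n \<sigma>) (orbit_closure n \<tau>) (character u :: 'k::field torus_field)"
proof
  let ?v = "orbit_closure n \<sigma> :: 'k point" and ?w = "orbit_closure n \<tau> :: 'k point"
  let ?A = "chart_ring n \<tau> :: 'k torus_field set" and ?t = "character u :: 'k torus_field"
  have face: "is_face n \<sigma> \<tau>" using facet by (auto simp: is_facet_def proper_face_def)
  have \<sigma>: "\<sigma> \<in> \<Sigma>" by (rule fan_face[OF fan \<tau> face])
  have \<sigma>\<tau>: "\<sigma> \<subseteq> \<tau>" by (rule face_subset[OF face])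
  note poly = fan_polyhedral[OF fan \<tau>]
  note v_eq = orbit_closure_eq_localize_face[OF poly face, where 'k='k]
  note P\<tau> = prime_face_ideal[OF order.refl[of \<tau>], of n, where 'k='k]
  note A = subring_chart_ring[of n \<tau>, where 'a='k]
  show loc: "local_subring ?v" "local_subring ?w" by (rule orbit_closure_local)+
  show wv: "?w \<subseteq> ?v" by (rule orbit_closure_mono[OF fan \<sigma> \<tau> \<sigma>\<tau>])
  have Aw: "?A \<subseteq> ?w" by (rule chart_ring_subset[OF orbit_closure_in_chart])
  have "?t \<in> face_ideal n \<tau> \<tau>" using u by (simp add: character_in_face_ideal_iff)
  then show "?t \<in> max_ideal ?w" using orbit_closure_max_Int[of n \<tau>, where 'a='k] by blast
  show "?t \<in> local_units ?v" by (rule character_unit_point[OF orbit_closure_in_chart u(3,1)])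
  note P\<sigma> = prime_face_ideal[OF \<sigma>\<tau>, of n, where 'k='k]
  have max_v: "max_ideal ?v \<inter> ?A = face_ideal n \<tau> \<sigma>" by (rule orbit_closure_face(2)[OF poly face])
  {
    fix a assume a: "a \<in> ?w - max_ideal ?v"
    then obtain \<alpha> \<beta> where \<alpha>\<beta>: "\<alpha> \<in> ?A" "\<beta> \<in> ?A - face_ideal n \<tau> \<tau>" "\<beta> \<noteq> 0" "a = \<alpha> / \<beta>"
      using localizeE[OF A P\<tau>] by (auto simp: orbit_closure_eq[of n \<tau>])
    have "1 / \<beta> \<in> local_units ?w"
      unfolding orbit_closure_eq divide_in_units_localize_iff[OF A P\<tau> subring_one[OF A] \<alpha>\<beta>(2)]
      using prime_in_one[OF A P\<tau>] by blast
    then have \<beta>v: "1 / \<beta> \<in> ?v" using wv local_units_mem by blast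
    have "\<alpha> \<notin> face_ideal n \<tau> \<sigma>"
    proof
      assume "\<alpha> \<in> face_ideal n \<tau> \<sigma>"
      then have "\<alpha> \<in> max_ideal ?v" using max_v by blast
      then have "\<alpha> * (1 / \<beta>) \<in> max_ideal ?v"
        by (rule ideal_in_mult_right[OF local_subring_ideal[OF loc(1)] _ \<beta>v])
      then show False using a \<alpha>\<beta>(4) by simp
    qed
    then obtain j b where b: "b \<in> ?A" "b \<notin> face_ideal n \<tau> \<tau>" "\<alpha> - ?t ^ j * b \<in> face_ideal n \<tau> \<sigma>"
      using facet_normal_form[OF \<sigma>\<tau> u \<alpha>\<beta>(1)] by blast
    have "b / \<beta> \<in> local_units ?w"
      unfolding orbit_closure_eq divide_in_units_localize_iff[OF A P\<tau> b(1) \<alpha>\<beta>(2)] by (rule b(2))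
    moreover have "a - ?t ^ j * (b / \<beta>) = (\<alpha> - ?t ^ j * b) * (1 / \<beta>)"
      using \<alpha>\<beta>(3,4) by (simp add: field_simps)
    moreover have "(\<alpha> - ?t ^ j * b) * (1 / \<beta>) \<in> max_ideal ?v"
      using b(3) max_v by (intro ideal_in_mult_right[OF local_subring_ideal[OF loc(1)] _ \<beta>v]) blast
    ultimately show "\<exists>j. \<exists>s\<in>local_units ?w. a - ?t ^ j * s \<in> max_ideal ?v" by metis
  next
    fix r assume r: "r \<in> local_units ?v"
    then have "r \<in> ?v" by (rule local_units_mem)
    then obtain a b where ab: "a \<in> ?A" "b \<in> ?A - face_ideal n \<tau> \<sigma>" "b \<noteq> 0" "r = a / b"
      unfolding v_eq by (rule localizeE[OF A P\<sigma>])
    have "a \<notin> face_ideal n \<tau> \<sigma>"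
      using r unfolding v_eq ab(4) divide_in_units_localize_iff[OF A P\<sigma> ab(1,2)] .
    then have "a \<in> ?w - max_ideal ?v" "b \<in> ?w - max_ideal ?v" using ab Aw max_v by blast+
    moreover have "b * r - a = 0" using ab by simp
    ultimately show "\<exists>a\<in>?w - max_ideal ?v. \<exists>b\<in>?w - max_ideal ?v. b * r - a \<in> max_ideal ?v"
      using ideal_in_zero[OF local_subring_ideal[OF loc(1)]] by metis
  }
qed

text \<open>Modulo \<open>\<tau>\<^sup>\<bottom>\<close>, \<open>l\<close> is \<open>j\<close> times
  the uniformizer's exponent, which pairs to 1 with the normal generator; the remaining character is
  a unit at V(\<open>\<tau>\<close>). The factor \<open>r\<close> allows for the rational function
  by which the given equation at the generic point deviates from a character.\<close>

lemma ord_along_facet: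
  assumes fan: "fan n \<Sigma>" and \<tau>: "\<tau> \<in> \<Sigma>" and facet: "is_facet n \<sigma> \<tau>"
    and l: "l \<in> perp n \<sigma>" "l \<in> lattice_pts n"
    and r: "r \<in> local_units (orbit_closure n \<sigma> :: 'k::field point)"
  shows "of_int (ord_along (orbit_closure n \<sigma>) (orbit_closure n \<tau>) (character l * r))
    = pairing l (normal_gen n \<tau> \<sigma>) + of_int (ord_along (orbit_closure n \<sigma>) (orbit_closure n \<tau>) r)"
proof -
  obtain u where u: "u \<in> lattice_pts n" "u \<in> dual_cone n \<tau>" "u \<in> perp n \<sigma>" "u \<notin> perp n \<tau>"
    "\<sigma> = {v \<in> \<tau>. pairing u v = 0}"
    "\<forall>l\<in>perp n \<sigma> \<inter> lattice_pts n. \<exists>j::int. l - qscale (of_int j) u \<in> perp n \<tau>"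
    "pairing u (normal_gen n \<tau> \<sigma>) = 1" "normal_gen n \<tau> \<sigma> \<in> qvec.span \<tau>"
    by (rule normal_gen[OF fan_polyhedral[OF fan \<tau>] facet])
  let ?v = "orbit_closure n \<sigma> :: 'k point" and ?w = "orbit_closure n \<tau> :: 'k point"
  interpret uniformizer ?v ?w "character u"
    by (rule uniformizer_facet[OF fan \<tau> facet u(1-4,6)])
  obtain j :: int where j: "l - qscale (of_int j) u \<in> perp n \<tau>" using u(6) l by blast
  define e where "e = l - qscale (of_int j) u"
  have le: "l = e + qscale (of_int j) u" by (simp add: e_def)
  have "pairing e (normal_gen n \<tau> \<sigma>) = 0" using perp_span[OF j u(8)] by (simp add: e_def)
  then have pj: "pairing l (normal_gen n \<tau> \<sigma>) = of_int j" using u(7) by (simp add: le pairing_linear)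
  have e: "character e \<in> local_units ?w"
    using l u(1) by (intro character_unit_point[OF orbit_closure_in_chart])
      (auto simp: e_def j intro!: lattice_diff lattice_scale)
  have tj: "character u powi j \<in> local_units ?v"
    unfolding character_powi[symmetric] using u
    by (intro character_unit_point[OF orbit_closure_in_chart]) (auto simp: perp_closed lattice_scale)
  have "character l * r = character e * (character u powi j * r)"
    by (simp add: le character_add character_powi)
  then have "ord_along ?v ?w (character l * r) = ord_along ?v ?w (character e * (character u powi j * r))"
    by (rule arg_cong)
  also have "\<dots> = ord_along ?v ?w (character u powi j * r)" by (rule ord_along_unit_mult[OF v w wv e])
  also have "\<dots> = j + ord_along ?v ?w r" using ord_along_mult[OF tj r] ord_along_t_powi by simp
  finally show ?thesis using pj by simp
qed

section \<open>Dimension of orbit closures\<close>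

text \<open>Gaussian elimination: an equation with a nonzero coefficient at \<open>h\<close> is used
  to eliminate the unknown \<open>h\<close>, so that one equation and one unknown disappear
  together.\<close>

lemma homogeneous_system_nontrivial_solution:
  fixes T :: "'j \<Rightarrow> 'x \<Rightarrow> 'k::field"
  assumes "finite F" "finite J" "card F < card J"
  shows "\<exists>c. (\<exists>g\<in>J. c g \<noteq> 0) \<and> (\<forall>x\<in>F. (\<Sum>g\<in>J. c g * T g x) = 0)"
  using assms
proof (induction F arbitrary: J T rule: finite_induct)
  case empty
  then obtain g where "g \<in> J" by fastforce
  then show ?case by (intro exI[of _ "\<lambda>_. 1"]) auto
next
  case (insert x F)
  show ?case
  proof (cases "\<forall>g\<in>J. T g x = 0")
    case True
    have "card F < card J" using insert by simp
    from insert.IH[OF insert.prems(1) this, of T] True show ?thesis by fastforce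
  next
    case False
    then obtain h where h: "h \<in> J" "T h x \<noteq> 0" by blast
    define J' where "J' = J - {h}"
    have J': "finite J'" "card F < card J'" "J = insert h J'" "h \<notin> J'"
      using insert h by (auto simp: J'_def)
    define T' where "T' g y = T g y - T g x / T h x * T h y" for g y
    obtain c where c: "\<exists>g\<in>J'. c g \<noteq> 0" "\<forall>y\<in>F. (\<Sum>g\<in>J'. c g * T' g y) = 0"
      using insert.IH[OF J'(1,2), of T'] by blast
    define d where "d = c(h := - (\<Sum>g\<in>J'. c g * (T g x / T h x)))"
    have sum: "(\<Sum>g\<in>J. d g * T g y) = (\<Sum>g\<in>J'. c g * T' g y)" for y
    proof -
      have "(\<Sum>g\<in>J. d g * T g y) = d h * T h y + (\<Sum>g\<in>J'. d g * T g y)"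
        using J' by simp
      also have "(\<Sum>g\<in>J'. d g * T g y) = (\<Sum>g\<in>J'. c g * T g y)"
        using J'(4) by (intro sum.cong) (auto simp: d_def)
      also have "d h * T h y = - (\<Sum>g\<in>J'. c g * (T g x / T h x * T h y))"
        by (simp add: d_def sum_distrib_right mult.assoc)
      finally show ?thesis by (simp add: T'_def right_diff_distrib sum_subtractf)
    qed
    have "T' g x = 0" for g using h(2) by (simp add: T'_def)
    then have "\<forall>y\<in>insert x F. (\<Sum>g\<in>J. d g * T g y) = 0" using c(2) by (auto simp: sum)
    moreover have "\<exists>g\<in>J. d g \<noteq> 0" using c(1) J' by (auto simp: d_def)
    ultimately show ?thesis by blast
  qed
qed

lemma lookup_single_0_mult:
  "Poly_Mapping.lookup (Poly_Mapping.single 0 c * p) x = c * Poly_Mapping.lookup p (x::qvec)"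
  by (simp add: mult_map_scale_conv_mult[symmetric] Poly_Mapping.map.rep_eq when_def)

lemma poly_mapping_linear_relation:
  fixes T :: "'j \<Rightarrow> qvec \<Rightarrow>\<^sub>0 'k::field"
  assumes "finite F" "finite J" "card F < card J" "\<And>g. g \<in> J \<Longrightarrow> Poly_Mapping.keys (T g) \<subseteq> F"
  obtains c where "\<exists>g\<in>J. c g \<noteq> 0" "(\<Sum>g\<in>J. Poly_Mapping.single 0 (c g) * T g) = 0"
proof -
  obtain c where c: "\<exists>g\<in>J. c g \<noteq> 0" "\<forall>x\<in>F. (\<Sum>g\<in>J. c g * Poly_Mapping.lookup (T g) x) = 0"
    using homogeneous_system_nontrivial_solution[OF assms(1-3), of "\<lambda>g. Poly_Mapping.lookup (T g)"]
    by blast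
  have "(\<Sum>g\<in>J. Poly_Mapping.single 0 (c g) * T g) = 0"
  proof (rule poly_mapping_eqI)
    fix x
    have "(\<Sum>g\<in>J. c g * Poly_Mapping.lookup (T g) x) = 0"
    proof (cases "x \<in> F")
      case False
      then have "Poly_Mapping.lookup (T g) x = 0" if "g \<in> J" for g
        using assms(4)[OF that] by (auto simp: in_keys_iff)
      then show ?thesis by simp
    qed (use c(2) in blast)
    then show "Poly_Mapping.lookup (\<Sum>g\<in>J. Poly_Mapping.single 0 (c g) * T g) x = Poly_Mapping.lookup 0 x"
      by (simp add: lookup_sum lookup_single_0_mult)
  qed
  then show thesis using c(1) that by blast
qed

text \<open>Clearing denominators gives a rational basis of lattice vectors; it need not generate
  the lattice.\<close>

lemma perp_lattice_basis:
  obtains B where "finite B" "B \<subseteq> perp n \<sigma> \<inter> lattice_pts n" "qvec.independent B"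
    "perp n \<sigma> \<subseteq> qvec.span B" "card B = qvec.dim (perp n \<sigma>)"
proof -
  obtain B where B: "B \<subseteq> perp n \<sigma> \<inter> lattice_pts n" "qvec.independent B"
    "perp n \<sigma> \<inter> lattice_pts n \<subseteq> qvec.span B"
    by (rule qvec.maximal_independent_subset)
  have span: "perp n \<sigma> \<subseteq> qvec.span B"
  proof
    fix x assume x: "x \<in> perp n \<sigma>"
    obtain d :: nat where d: "d > 0" "qscale (of_nat d) x \<in> lattice_pts n"
      using scale_to_lattice[OF perp_qspace[OF x]] .
    have "qscale (of_nat d) x \<in> qvec.span B" using B(3) d x by (auto simp: perp_closed)
    then have "qscale (1 / of_nat d) (qscale (of_nat d) x) \<in> qvec.span B" by (rule qvec.span_scale)
    then show "x \<in> qvec.span B" using d(1) by simp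
  qed
  have "card B = qvec.dim (perp n \<sigma>)"
    using B span by (intro qvec.basis_card_eq_dim) auto
  moreover have "finite B"
    using qspace_independent_card_le(1)[of B n] B lattice_qspace by blast
  ultimately show thesis using that B span by blast
qed

definition exponent :: "nat \<Rightarrow> (nat \<Rightarrow> nat) \<Rightarrow> nat \<Rightarrow>\<^sub>0 nat" where
  "exponent d g = (\<Sum>i<d. Poly_Mapping.single i (g i))"

lemma lookup_exponent: "Poly_Mapping.lookup (exponent d g) i = (if i < d then g i else 0)"
proof -
  have "Poly_Mapping.lookup (exponent d g) i = (\<Sum>j<d. if j = i then g j else 0)"
    unfolding exponent_def lookup_sum by (intro sum.cong) (auto simp: lookup_single when_def)
  then show ?thesis by simp
qed

lemma keys_exponent: "Poly_Mapping.keys (exponent d g) \<subseteq> {..<d}"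
  by (auto simp: in_keys_iff lookup_exponent split: if_splits)

lemma character_sum: "character (\<Sum>i\<in>I. f i) = (\<Prod>i\<in>I. character (f i))"
  by (induction I rule: infinite_finite_induct) (simp_all add: character_zero character_add)

text \<open>Characters of such a basis: linear independence sends distinct multi-indices to distinct
  exponents, so nothing cancels, and a nonzero polynomial with exponents in
  \<open>\<sigma>\<^sup>\<bottom>\<close> is off the ideal of the orbit closure.\<close>

lemma residually_alg_indep_orbit_closure:
  "\<exists>a. residually_alg_indep (orbit_closure n \<sigma> :: 'k::field point) (qvec.dim (perp n \<sigma>)) a"
proof -
  let ?V = "orbit_closure n \<sigma> :: 'k point"
  obtain B where B: "finite B" "B \<subseteq> perp n \<sigma> \<inter> lattice_pts n" "qvec.independent B"
    "perp n \<sigma> \<subseteq> qvec.span B" "card B = qvec.dim (perp n \<sigma>)" by (rule perp_lattice_basis)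
  define r where "r = card B"
  obtain f where f: "bij_betw f {..<r} B"
    using ex_bij_betw_nat_finite[OF B(1)] by (auto simp: r_def atLeast0LessThan)
  have fB: "f i \<in> perp n \<sigma>" "f i \<in> lattice_pts n" if "i < r" for i
    using bij_betwE[OF f] B(2) that by auto
  have inj: "inj_on f {..<r}" using f by (rule bij_betw_imp_inj_on)
  define \<phi> where "\<phi> e = (\<Sum>i<r. qscale (of_nat (Poly_Mapping.lookup e i)) (f i))" for e :: "nat \<Rightarrow>\<^sub>0 nat"
  have \<phi>: "\<phi> e \<in> perp n \<sigma>" "\<phi> e \<in> lattice_pts n" for e
    unfolding \<phi>_def using fB by (auto intro!: perp_closed lattice_sum lattice_scale)
  have \<phi>_inj: "e = e'" if e: "Poly_Mapping.keys e \<subseteq> {..<r}" "Poly_Mapping.keys e' \<subseteq> {..<r}" "\<phi> e = \<phi> e'" for e e'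
  proof (rule poly_mapping_eqI)
    fix i
    define c where "c x = rat_of_nat (Poly_Mapping.lookup e (inv_into {..<r} f x))
      - of_nat (Poly_Mapping.lookup e' (inv_into {..<r} f x))" for x
    have "(\<Sum>x\<in>B. qscale (c x) x) = (\<Sum>i<r. qscale (c (f i)) (f i))"
      using sum.reindex_bij_betw[OF f, of "\<lambda>x. qscale (c x) x"] by simp
    also have "\<dots> = \<phi> e - \<phi> e'"
      unfolding \<phi>_def sum_subtractf[symmetric] using inj
      by (intro sum.cong) (auto simp: c_def qvec.scale_left_diff_distrib)
    also have "\<dots> = 0" using e(3) by simp
    finally have 0: "(\<Sum>x\<in>B. qscale (c x) x) = 0" .
    show "Poly_Mapping.lookup e i = Poly_Mapping.lookup e' i"
    proof (cases "i < r")
      case True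
      then have "f i \<in> B" using bij_betwE[OF f] by auto
      then have "c (f i) = 0" using qvec.independentD[OF B(3,1) order.refl 0] by blast
      then show ?thesis using True inj by (simp add: c_def)
    next
      case False
      then have "i \<notin> Poly_Mapping.keys e" "i \<notin> Poly_Mapping.keys e'" using e by auto
      then show ?thesis by (simp add: in_keys_iff)
    qed
  qed
  have "residually_alg_indep ?V r (\<lambda>i. character (f i))"
    unfolding residually_alg_indep_def
  proof (intro conjI allI impI)
    fix i assume "i < r"
    then show "character (f i) \<in> ?V"
      using character_unit_point[OF orbit_closure_in_chart fB] local_units_mem by blast
  next
    fix p :: "(nat \<Rightarrow>\<^sub>0 nat) \<Rightarrow>\<^sub>0 'k"
    assume p: "p \<noteq> 0 \<and> (\<forall>e\<in>Poly_Mapping.keys p. Poly_Mapping.keys e \<subseteq> {..<r})"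
    define q where "q = (\<Sum>e\<in>Poly_Mapping.keys p. Poly_Mapping.single (\<phi> e) (Poly_Mapping.lookup p e))"
    have "(\<Prod>i<r. character (f i) ^ Poly_Mapping.lookup e i) = (character (\<phi> e) :: 'k torus_field)" for e
      by (simp add: \<phi>_def character_sum character_power)
    then have eq: "(\<Sum>e\<in>Poly_Mapping.keys p. scalar (Poly_Mapping.lookup p e) *
        (\<Prod>i<r. character (f i) ^ Poly_Mapping.lookup e i)) = to_field q"
      by (simp add: q_def to_field_sum scalar_to_field character_to_field to_field_mult[symmetric] mult_single)
    have "Poly_Mapping.keys p \<noteq> {}" using p by simp
    then obtain e0 where e0: "e0 \<in> Poly_Mapping.keys p" by blast
    have "Poly_Mapping.lookup q (\<phi> e0) = (\<Sum>e\<in>Poly_Mapping.keys p. if e = e0 then Poly_Mapping.lookup p e else 0)"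
      unfolding q_def lookup_sum using p e0 \<phi>_inj
      by (intro sum.cong) (auto simp: lookup_single when_def)
    also have "\<dots> = Poly_Mapping.lookup p e0" using e0 by simp
    finally have q0: "\<phi> e0 \<in> Poly_Mapping.keys q" using e0 by (simp add: in_keys_iff)
    have qk: "Poly_Mapping.keys q \<subseteq> perp n \<sigma> \<inter> lattice_pts n"
      unfolding q_def using \<phi> by (intro order.trans[OF keys_sum]) (auto split: if_splits)
    have "to_field q \<in> chart_ring n \<sigma>"
      using qk perp_subset_dual_cone[of n \<sigma>] by (auto simp: chart_ring_def to_field_in_span_iff)
    moreover have "to_field q \<notin> face_ideal n \<sigma> \<sigma>"
      using q0 \<phi>(1)[of e0] by (auto simp: face_ideal_def to_field_in_span_iff)
    ultimately have "to_field q \<notin> max_ideal ?V"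
      using orbit_closure_max_Int[of n \<sigma>, where 'a='k] by blast
    then show "(\<Sum>e\<in>Poly_Mapping.keys p. scalar (Poly_Mapping.lookup p e) *
        (\<Prod>i<r. character (f i) ^ Poly_Mapping.lookup e i)) \<notin> max_ideal ?V"
      by (simp only: eq not_False_eq_True)
  qed
  then show ?thesis using B(5) by (auto simp: r_def)
qed

text \<open>
  Monomials of degree at most \<open>L\<close> in the given functions lie in the span of the characters in a box
  whose size is linear in \<open>L\<close>; comparing cardinalities bounds the transcendence degree by the rank.
\<close>

definition box :: "qvec set \<Rightarrow> nat \<Rightarrow> nat \<Rightarrow> qvec set" where
  "box B N L = (\<lambda>z. \<Sum>b\<in>B. qscale (of_int (z b) / of_nat N) b) ` (B \<rightarrow>\<^sub>E {- int L..int L})"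

lemma box_finite: "finite B \<Longrightarrow> finite (box B N L)"
  and box_card: "finite B \<Longrightarrow> card (box B N L) \<le> (2 * L + 1) ^ card B"
proof -
  assume B: "finite B"
  have fin: "finite (B \<rightarrow>\<^sub>E {- int L..int L})" using B by (intro finite_PiE) auto
  then show "finite (box B N L)" by (simp add: box_def)
  have "card (box B N L) \<le> card (B \<rightarrow>\<^sub>E {- int L..int L})"
    unfolding box_def by (rule card_image_le[OF fin])
  also have "\<dots> = (nat (2 * int L + 1)) ^ card B" using B by (simp add: card_PiE)
  also have "nat (2 * int L + 1) = 2 * L + 1" by simp
  finally show "card (box B N L) \<le> (2 * L + 1) ^ card B" .
qed

lemma boxI:
  assumes "x = (\<Sum>b\<in>B. qscale (of_int (z b) / of_nat N) b)" "\<And>b. b \<in> B \<Longrightarrow> \<bar>z b\<bar> \<le> int L"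
  shows "x \<in> box B N L"
  unfolding box_def
proof (rule image_eqI[of _ _ "restrict z B"])
  show "x = (\<Sum>b\<in>B. qscale (of_int (restrict z B b) / of_nat N) b)"
    unfolding assms(1) by (intro sum.cong) auto
  show "restrict z B \<in> B \<rightarrow>\<^sub>E {- int L..int L}" using assms(2) by (fastforce simp: abs_le_iff)
qed

lemma boxE:
  assumes "x \<in> box B N L"
  obtains z where "x = (\<Sum>b\<in>B. qscale (of_int (z b) / of_nat N) b)" "\<forall>b\<in>B. \<bar>z b\<bar> \<le> int L"
  using assms unfolding box_def by (force simp: abs_le_iff)

lemma box_zero: "0 \<in> box B N L"
  by (rule boxI[where z = "\<lambda>_. 0"]) auto

lemma box_add: "x \<in> box B N L \<Longrightarrow> y \<in> box B N L' \<Longrightarrow> x + y \<in> box B N (L + L')"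
proof -
  assume x: "x \<in> box B N L" and y: "y \<in> box B N L'"
  obtain z where z: "x = (\<Sum>b\<in>B. qscale (of_int (z b) / of_nat N) b)" "\<forall>b\<in>B. \<bar>z b\<bar> \<le> int L"
    using x by (rule boxE)
  obtain z' where z': "y = (\<Sum>b\<in>B. qscale (of_int (z' b) / of_nat N) b)" "\<forall>b\<in>B. \<bar>z' b\<bar> \<le> int L'"
    using y by (rule boxE)
  show ?thesis
  proof (rule boxI)
    show "x + y = (\<Sum>b\<in>B. qscale (of_int (z b + z' b) / of_nat N) b)"
      by (simp add: z z' add_divide_distrib qvec.scale_left_distrib sum.distrib)
    show "\<bar>z b + z' b\<bar> \<le> int (L + L')" if "b \<in> B" for b
      using bspec[OF z(2) that] bspec[OF z'(2) that] abs_triangle_ineq[of "z b" "z' b"] by simp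
  qed
qed

text \<open>\<open>N\<close> is a common denominator of all coefficients, and \<open>L\<close>
  bounds the resulting numerators.\<close>

lemma finite_subset_box:
  assumes B: "finite B" and S: "finite S" "S \<subseteq> qvec.span B"
  obtains N L where "S \<subseteq> box B N L"
proof -
  have "\<forall>x\<in>S. \<exists>c. x = (\<Sum>b\<in>B. qscale (c b) b)" using S(2) qvec.span_finite[OF B] by auto
  from bchoice[OF this] obtain c where c: "\<forall>x\<in>S. x = (\<Sum>b\<in>B. qscale (c x b) b)" ..
  have "finite ((\<lambda>(x, b). c x b) ` (S \<times> B))" using S B by simp
  from finite_clear_denominators[OF this]
  obtain N :: nat where N: "N > 0" "\<forall>y\<in>(\<lambda>(x, b). c x b) ` (S \<times> B). of_nat N * y \<in> \<int>" by blast
  define z where "z x b = \<lfloor>of_nat N * c x b\<rfloor>" for x b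
  have z: "of_int (z x b) = of_nat N * c x b" if "x \<in> S" "b \<in> B" for x b
    using N(2) that by (auto simp: z_def)
  define L where "L = (\<Sum>(x, b)\<in>S \<times> B. nat \<bar>z x b\<bar>)"
  have "S \<subseteq> box B N L"
  proof
    fix x assume x: "x \<in> S"
    show "x \<in> box B N L"
    proof (rule boxI)
      have "x = (\<Sum>b\<in>B. qscale (c x b) b)" using c x by blast
      also have "\<dots> = (\<Sum>b\<in>B. qscale (of_int (z x b) / of_nat N) b)"
        using z[OF x] N(1) by (intro sum.cong) auto
      finally show "x = (\<Sum>b\<in>B. qscale (of_int (z x b) / of_nat N) b)" .
      fix b assume b: "b \<in> B"
      have "(\<lambda>(x, b). nat \<bar>z x b\<bar>) (x, b) \<le> L"
        unfolding L_def using S B x b by (intro member_le_sum) auto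
      then show "\<bar>z x b\<bar> \<le> int L" by simp
    qed
  qed
  then show thesis by (rule that)
qed

lemma keys_power_box:
  assumes "Poly_Mapping.keys p \<subseteq> box B N L"
  shows "Poly_Mapping.keys (p ^ k :: qvec \<Rightarrow>\<^sub>0 'k::field) \<subseteq> box B N (k * L)"
proof (induction k)
  case 0
  then show ?case by (simp add: box_zero)
next
  case (Suc k)
  show ?case
    using keys_mult_closed[OF assms Suc, of "box B N (Suc k * L)"] box_add[of _ B N L _ "k * L"] by simp
qed

lemma keys_prod_box:
  assumes "\<And>i. i \<in> I \<Longrightarrow> Poly_Mapping.keys (p i) \<subseteq> box B N (L i)"
  shows "Poly_Mapping.keys (\<Prod>i\<in>I. p i :: qvec \<Rightarrow>\<^sub>0 'k::field) \<subseteq> box B N (\<Sum>i\<in>I. L i)"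
  using assms
proof (induction I rule: infinite_finite_induct)
  case (insert i I)
  then have "Poly_Mapping.keys (p i) \<subseteq> box B N (L i)" "Poly_Mapping.keys (prod p I) \<subseteq> box B N (sum L I)"
    by auto
  from keys_mult_closed[OF this, of "box B N (L i + sum L I)"] box_add insert show ?case by simp
qed (simp_all add: box_zero)

lemma mult_cong_ideal:
  assumes "ideal_in A I" "x - x' \<in> I" "y - y' \<in> I" "x' \<in> A" "y \<in> A"
  shows "x * y - x' * y' \<in> I"
proof -
  have "x * y - x' * y' = (x - x') * y + x' * (y - y')" by (simp add: algebra_simps)
  also have "\<dots> \<in> I"
    using assms by (intro ideal_in_add[OF assms(1)] ideal_in_mult_left[OF assms(1)] ideal_in_mult_right[OF assms(1)])
  finally show ?thesis .
qed

lemma power_cong_ideal: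
  assumes "subring_of_field A" "ideal_in A I" "x - x' \<in> I" "x' \<in> A" "x \<in> A"
  shows "x ^ k - x' ^ k \<in> I"
proof (induction k)
  case 0
  then show ?case using ideal_in_zero[OF assms(2)] by simp
next
  case (Suc k)
  have "x * x ^ k - x' * x' ^ k \<in> I"
    by (rule mult_cong_ideal[OF assms(2,3) Suc assms(4) subring_power[OF assms(1,5)]])
  then show ?case by simp
qed

lemma prod_cong_ideal:
  assumes "subring_of_field A" "ideal_in A I"
    "\<And>i. i \<in> K \<Longrightarrow> x i - x' i \<in> I \<and> x' i \<in> A \<and> x i \<in> A"
  shows "prod x K - prod x' K \<in> I"
  using assms(3)
proof (induction K rule: infinite_finite_induct)
  case (insert i K)
  have "x i * prod x K - x' i * prod x' K \<in> I"
    using insert by (intro mult_cong_ideal[OF assms(2)] subring_prod[OF assms(1)]) auto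
  then show ?case using insert by simp
qed (simp_all add: ideal_in_zero[OF assms(2)])

text \<open>After multiplication by a common denominator \<open>\<beta>\<close>, the functions are
  congruent to Laurent polynomials \<open>p i\<close> with exponents in
  \<open>\<sigma>\<^sup>\<bottom>\<close>. With more functions than the rank, the monomials
  outnumber the available characters; a linear relation among them is an algebraic relation among
  the functions.\<close>

lemma residually_alg_indep_orbit_closure_le:
  assumes indep: "residually_alg_indep (orbit_closure n \<sigma> :: 'k::field point) d a"
  shows "d \<le> qvec.dim (perp n \<sigma>)"
proof (rule ccontr)
  assume "\<not> d \<le> qvec.dim (perp n \<sigma>)"
  let ?V = "orbit_closure n \<sigma> :: 'k point" and ?A = "chart_ring n \<sigma> :: 'k torus_field set"
  let ?P = "face_ideal n \<sigma> \<sigma> :: 'k torus_field set"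
  obtain B where B: "finite B" "B \<subseteq> perp n \<sigma> \<inter> lattice_pts n" "qvec.independent B"
    "perp n \<sigma> \<subseteq> qvec.span B" "card B = qvec.dim (perp n \<sigma>)" by (rule perp_lattice_basis)
  define r where "r = card B"
  have dr: "r < d" using \<open>\<not> d \<le> _\<close> B(5) by (simp add: r_def)
  note A = subring_chart_ring[of n \<sigma>, where 'a='k]
  note P = prime_face_ideal[OF order.refl[of \<sigma>], of n, where 'k='k]
  note I = prime_in_ideal[OF P]
  have "\<forall>i\<in>{..<d}. \<exists>\<beta>. \<beta> \<in> ?A - ?P \<and> a i * \<beta> \<in> ?A"
  proof
    fix i assume "i \<in> {..<d}"
    then have "a i \<in> ?V" using indep by (simp add: residually_alg_indep_def)
    then obtain \<alpha> \<beta> where "\<alpha> \<in> ?A" "\<beta> \<in> ?A - ?P" "\<beta> \<noteq> 0" "a i = \<alpha> / \<beta>"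
      unfolding orbit_closure_eq by (rule localizeE[OF A P])
    then show "\<exists>\<beta>. \<beta> \<in> ?A - ?P \<and> a i * \<beta> \<in> ?A" by (intro exI[of _ \<beta>]) simp
  qed
  from bchoice[OF this] obtain b where b: "\<forall>i\<in>{..<d}. b i \<in> ?A - ?P \<and> a i * b i \<in> ?A" ..
  define \<beta> where "\<beta> = (\<Prod>i<d. b i)"
  have \<beta>: "\<beta> \<in> ?A - ?P" unfolding \<beta>_def using b by (intro prime_in_prod[OF A P]) auto
  have a\<beta>: "a i * \<beta> \<in> ?A" if i: "i < d" for i
  proof -
    have "\<beta> = b i * (\<Prod>j\<in>{..<d} - {i}. b j)" unfolding \<beta>_def using i by (intro prod.remove) auto
    then have "a i * \<beta> = (a i * b i) * (\<Prod>j\<in>{..<d} - {i}. b j)" by (simp add: mult.assoc)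
    also have "\<dots> \<in> ?A"
    proof (rule subring_mult[OF A])
      show "a i * b i \<in> ?A" using b i by blast
      show "(\<Prod>j\<in>{..<d} - {i}. b j) \<in> ?A" using b by (intro subring_prod[OF A]) auto
    qed
    finally show ?thesis .
  qed
  have reduce: "\<exists>p. Poly_Mapping.keys p \<subseteq> perp n \<sigma> \<and> to_field p \<in> ?A \<and> x - to_field p \<in> ?P" if x: "x \<in> ?A" for x
  proof -
    from x obtain p where p: "x = to_field p" "Poly_Mapping.keys p \<subseteq> dual_cone n \<sigma> \<inter> lattice_pts n"
      unfolding chart_ring_def by (rule monomial_spanE)
    obtain p0 p1 where p01: "p = p0 + p1" "Poly_Mapping.keys p0 = Poly_Mapping.keys p \<inter> perp n \<sigma>"
      "Poly_Mapping.keys p1 = Poly_Mapping.keys p - perp n \<sigma>" by (rule poly_mapping_split)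
    have "x - to_field p0 = to_field p1" by (simp add: p(1) p01(1) to_field_add)
    moreover have "to_field p1 \<in> ?P" "to_field p0 \<in> ?A"
      using p(2) p01(2,3) by (auto simp: face_ideal_def chart_ring_def to_field_in_span_iff)
    ultimately show ?thesis using p01(2) by (intro exI[of _ p0]) simp
  qed
  have "\<forall>i\<in>{..<d}. \<exists>p. Poly_Mapping.keys p \<subseteq> perp n \<sigma> \<and> to_field p \<in> ?A \<and> a i * \<beta> - to_field p \<in> ?P"
    using reduce a\<beta> by blast
  from bchoice[OF this] obtain p
    where p: "\<forall>i\<in>{..<d}. Poly_Mapping.keys (p i) \<subseteq> perp n \<sigma> \<and> to_field (p i) \<in> ?A \<and> a i * \<beta> - to_field (p i) \<in> ?P" ..
  obtain q where q: "Poly_Mapping.keys q \<subseteq> perp n \<sigma>" "to_field q \<in> ?A" "\<beta> - to_field q \<in> ?P"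
    using reduce \<beta> by blast
  define S where "S = Poly_Mapping.keys q \<union> (\<Union>i<d. Poly_Mapping.keys (p i))"
  have "finite S" by (simp add: S_def)
  moreover have "S \<subseteq> qvec.span B" using p q(1) B(4) by (auto simp: S_def)
  ultimately obtain N K where K: "S \<subseteq> box B N K" using finite_subset_box[OF B(1)] by blast
  \<comment> \<open>With \<open>M = d * D\<close>, the box has at most
    \<open>((2 * (d * K) + 1) * (D + 1)) ^ r\<close>, that is \<open>D * (D + 1) ^ r\<close>,
    elements. This is fewer than \<open>(D + 1) ^ Suc r\<close>, hence fewer than the
    \<open>(D + 1) ^ d\<close> exponent vectors in \<open>J\<close>.\<close>
  define D where "D = (2 * (d * K) + 1) ^ r"
  define M where "M = d * D"
  define J where "J = {..<d} \<rightarrow>\<^sub>E {..D}"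
  have J: "finite J" "card J = (D + 1) ^ d" by (simp_all add: J_def finite_PiE card_PiE)
  have sumJ: "(\<Sum>i<d. g i) \<le> M" if "g \<in> J" for g
  proof -
    have "(\<Sum>i<d. g i) \<le> (\<Sum>i<d. D)" using that by (intro sum_mono) (auto simp: J_def)
    then show ?thesis by (simp add: M_def)
  qed
  \<comment> \<open>Homogenization: powers of \<open>q\<close>, the residue of
    \<open>\<beta>\<close>, raise all monomials to the same degree \<open>M\<close>, so one factor
    \<open>\<beta> ^ M\<close> clears every denominator.\<close>
  define T where "T g = (\<Prod>i<d. p i ^ g i) * q ^ (M - (\<Sum>i<d. g i))" for g
  have keysT: "Poly_Mapping.keys (T g) \<subseteq> box B N (M * K)" if g: "g \<in> J" for g
  proof -
    have "Poly_Mapping.keys (p i ^ g i) \<subseteq> box B N (g i * K)" if "i \<in> {..<d}" for i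
      using K that by (intro keys_power_box) (auto simp: S_def)
    then have 1: "Poly_Mapping.keys (\<Prod>i<d. p i ^ g i) \<subseteq> box B N (\<Sum>i<d. g i * K)"
      by (rule keys_prod_box)
    have 2: "Poly_Mapping.keys (q ^ (M - (\<Sum>i<d. g i))) \<subseteq> box B N ((M - (\<Sum>i<d. g i)) * K)"
      using K by (intro keys_power_box) (auto simp: S_def)
    have "(\<Sum>i<d. g i * K) + (M - (\<Sum>i<d. g i)) * K = ((\<Sum>i<d. g i) + (M - (\<Sum>i<d. g i))) * K"
      by (simp only: sum_distrib_right[symmetric] add_mult_distrib)
    then have "(\<Sum>i<d. g i * K) + (M - (\<Sum>i<d. g i)) * K = M * K" using sumJ[OF g] by simp
    then show ?thesis
      unfolding T_def using keys_mult_closed[OF 1 2, of "box B N (M * K)"] box_add by metis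
  qed
  have "card (box B N (M * K)) \<le> (2 * (M * K) + 1) ^ r" unfolding r_def by (rule box_card[OF B(1)])
  also have "\<dots> \<le> ((2 * (d * K) + 1) * (D + 1)) ^ r"
    by (intro power_mono) (auto simp: M_def algebra_simps)
  also have "\<dots> = D * (D + 1) ^ r" by (simp only: D_def power_mult_distrib)
  also have "\<dots> < (D + 1) * (D + 1) ^ r" by simp
  also have "\<dots> = (D + 1) ^ Suc r" by simp
  also have "\<dots> \<le> (D + 1) ^ d" using dr by (intro power_increasing) auto
  finally have lt: "card (box B N (M * K)) < card J" using J by simp
  obtain c where c: "\<exists>g\<in>J. c g \<noteq> 0" "(\<Sum>g\<in>J. Poly_Mapping.single 0 (c g) * T g) = 0"
    by (rule poly_mapping_linear_relation[OF box_finite[OF B(1)] J(1) lt keysT])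
  \<comment> \<open>The linear relation read as a polynomial in \<open>d\<close> variables;
    \<open>exponent d\<close> is injective on \<open>J\<close>, so its coefficients are the
    \<open>c g\<close>.\<close>
  define R where "R = (\<Sum>g\<in>J. Poly_Mapping.single (exponent d g) (c g))"
  have exp_inj: "g = g'" if "g \<in> J" "g' \<in> J" "exponent d g = exponent d g'" for g g'
  proof (rule PiE_ext)
    show "g \<in> {..<d} \<rightarrow>\<^sub>E {..D}" "g' \<in> {..<d} \<rightarrow>\<^sub>E {..D}" using that by (auto simp: J_def)
    show "g i = g' i" if "i \<in> {..<d}" for i
      using \<open>exponent d g = exponent d g'\<close> lookup_exponent[of d g i] lookup_exponent[of d g' i] that by simp
  qed
  have lookupR: "Poly_Mapping.lookup R (exponent d g) = c g" if "g \<in> J" for g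
  proof -
    have "Poly_Mapping.lookup R (exponent d g) = (\<Sum>g'\<in>J. if g' = g then c g' else 0)"
      unfolding R_def lookup_sum using exp_inj that
      by (intro sum.cong) (auto simp: lookup_single when_def)
    then show ?thesis using J that by simp
  qed
  have keysR: "Poly_Mapping.keys R \<subseteq> exponent d ` J"
    unfolding R_def by (intro order.trans[OF keys_sum]) (auto split: if_splits)
  define E where "E = (\<Sum>g\<in>J. scalar (c g) * (\<Prod>i<d. a i ^ g i))"
  have "(\<Sum>e\<in>Poly_Mapping.keys R. scalar (Poly_Mapping.lookup R e) * (\<Prod>i<d. a i ^ Poly_Mapping.lookup e i))
      = (\<Sum>e\<in>exponent d ` J. scalar (Poly_Mapping.lookup R e) * (\<Prod>i<d. a i ^ Poly_Mapping.lookup e i))"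
    using J keysR by (intro sum.mono_neutral_left) (auto simp: in_keys_iff scalar_to_field to_field_zero)
  also have "\<dots> = (\<Sum>g\<in>J. scalar (Poly_Mapping.lookup R (exponent d g)) *
      (\<Prod>i<d. a i ^ Poly_Mapping.lookup (exponent d g) i))"
    by (subst sum.reindex) (auto simp: inj_on_def exp_inj)
  also have "\<dots> = E" unfolding E_def by (intro sum.cong) (auto simp: lookupR lookup_exponent)
  finally have RE: "(\<Sum>e\<in>Poly_Mapping.keys R. scalar (Poly_Mapping.lookup R e) *
      (\<Prod>i<d. a i ^ Poly_Mapping.lookup e i)) = E" .
  have "R \<noteq> 0" using c(1) lookupR by (metis lookup_zero)
  then have "E \<notin> max_ideal ?V"
    using indep keysR keys_exponent unfolding residually_alg_indep_def RE[symmetric] by blast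
  moreover have "E \<in> max_ideal ?V"
  proof -
    have summand: "scalar (c g) * (\<Prod>i<d. a i ^ g i) * \<beta> ^ M - to_field (Poly_Mapping.single 0 (c g) * T g) \<in> ?P"
      if g: "g \<in> J" for g
    proof -
      have "\<beta> ^ M = \<beta> ^ (\<Sum>i<d. g i) * \<beta> ^ (M - (\<Sum>i<d. g i))"
        using sumJ[OF g] by (simp add: power_add[symmetric])
      then have "(\<Prod>i<d. a i ^ g i) * \<beta> ^ M = (\<Prod>i<d. (a i * \<beta>) ^ g i) * \<beta> ^ (M - (\<Sum>i<d. g i))"
        by (simp add: power_mult_distrib prod.distrib power_sum mult.assoc)
      moreover have "(\<Prod>i<d. (a i * \<beta>) ^ g i) * \<beta> ^ (M - (\<Sum>i<d. g i))
          - (\<Prod>i<d. to_field (p i) ^ g i) * to_field q ^ (M - (\<Sum>i<d. g i)) \<in> ?P"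
        using p q \<beta> a\<beta>
        by (intro mult_cong_ideal[OF I] prod_cong_ideal[OF A I] power_cong_ideal[OF A I]
            subring_prod[OF A] subring_power[OF A] conjI) auto
      ultimately have "(\<Prod>i<d. a i ^ g i) * \<beta> ^ M - to_field (T g) \<in> ?P"
        by (simp add: T_def to_field_mult to_field_prod to_field_power)
      then have "scalar (c g) * ((\<Prod>i<d. a i ^ g i) * \<beta> ^ M - to_field (T g)) \<in> ?P"
        by (rule ideal_in_mult_left[OF I _ scalar_in_chart_ring])
      then show ?thesis by (simp add: to_field_mult scalar_to_field right_diff_distrib mult.assoc)
    qed
    \<comment> \<open>The subtracted term is 0 by the relation; distributing it makes each summand
      an element of the ideal.\<close>
    have "E * \<beta> ^ M = (\<Sum>g\<in>J. scalar (c g) * (\<Prod>i<d. a i ^ g i) * \<beta> ^ M)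
        - to_field (\<Sum>g\<in>J. Poly_Mapping.single 0 (c g) * T g)"
      by (simp add: E_def sum_distrib_right c(2) to_field_zero)
    also have "\<dots> = (\<Sum>g\<in>J. scalar (c g) * (\<Prod>i<d. a i ^ g i) * \<beta> ^ M
        - to_field (Poly_Mapping.single 0 (c g) * T g))"
      by (simp add: to_field_sum sum_subtractf)
    also have "\<dots> \<in> ?P" by (intro ideal_in_sum[OF I] summand)
    finally have "E * \<beta> ^ M \<in> ?P" .
    moreover have \<beta>M: "\<beta> ^ M \<in> ?A - ?P" by (rule prime_in_power[OF A P \<beta>])
    ultimately have "(E * \<beta> ^ M) / \<beta> ^ M \<in> max_ideal ?V"
      unfolding orbit_closure_eq by (rule max_ideal_localizeI[OF A P])
    then show ?thesis using prime_in_nonzero[OF P \<beta>] by simp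
  qed
  ultimately show False by simp
qed

lemma point_dim_orbit_closure:
  assumes "\<sigma> \<subseteq> qspace n"
  shows "int (point_dim (orbit_closure n \<sigma> :: 'k::field point)) = int n - int (cone_dim \<sigma>)"
proof -
  have "point_dim (orbit_closure n \<sigma> :: 'k point) = qvec.dim (perp n \<sigma>)"
    unfolding point_dim_def
    using residually_alg_indep_orbit_closure residually_alg_indep_orbit_closure_le
    by (intro cSup_eq_maximum) auto
  then show ?thesis using dim_perp[OF assms] by simp
qed

section \<open>Cartier multiples of equivariant divisors\<close>

text \<open>It makes the choice in \<open>intersection_class\<close> meaningful. Each point gets the
  character of some chart containing it; the choice is harmless, since an overlap of charts is the
  chart of the common face, where the two exponents differ by an element of its
  \<open>perp\<close>.\<close>

lemma ex_cartier_multiple: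
  assumes fan: "fan n \<Sigma>" and m: "equivariant_Q_cartier n \<Sigma> m"
  shows "\<exists>d f. d > 0 \<and> is_cartier_multiple n \<Sigma> d m (f :: 'k::field point \<Rightarrow> 'k torus_field)"
proof -
  have "finite (m ` \<Sigma>)" "m ` \<Sigma> \<subseteq> qspace n"
    using fan_finite[OF fan] m by (auto simp: equivariant_Q_cartier_def)
  then obtain d :: nat where d: "d > 0" "\<forall>v\<in>m ` \<Sigma>. qscale (of_nat d) v \<in> lattice_pts n"
    using lattice_clear_denominators by blast
  define U where "U \<sigma> = qscale (of_nat d) (m \<sigma>)" for \<sigma>
  have U: "U \<sigma> \<in> lattice_pts n" if "\<sigma> \<in> \<Sigma>" for \<sigma> using d(2) that by (auto simp: U_def)
  have overlap: "character (U \<sigma>) / character (U \<tau>) \<in> local_units x"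
    if \<sigma>: "\<sigma> \<in> \<Sigma>" and \<tau>: "\<tau> \<in> \<Sigma>" and x: "x \<in> chart n \<sigma>" "x \<in> chart n \<tau>"
    for \<sigma> \<tau> and x :: "'k point"
  proof -
    have f\<sigma>: "is_face n (\<sigma> \<inter> \<tau>) \<sigma>" by (rule fan_Int_face[OF fan \<sigma> \<tau>])
    have f\<tau>: "is_face n (\<sigma> \<inter> \<tau>) \<tau>" using fan_Int_face[OF fan \<tau> \<sigma>] by (simp add: Int_commute)
    have "\<sigma> \<inter> \<tau> \<in> \<Sigma>" by (rule fan_face[OF fan \<sigma> f\<sigma>])
    then have "m \<sigma> - m (\<sigma> \<inter> \<tau>) \<in> perp n (\<sigma> \<inter> \<tau>)" "m \<tau> - m (\<sigma> \<inter> \<tau>) \<in> perp n (\<sigma> \<inter> \<tau>)"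
      using m \<sigma> \<tau> f\<sigma> f\<tau> by (auto simp: equivariant_Q_cartier_def)
    then have "(m \<sigma> - m (\<sigma> \<inter> \<tau>)) - (m \<tau> - m (\<sigma> \<inter> \<tau>)) \<in> perp n (\<sigma> \<inter> \<tau>)" by (rule perp_closed(2))
    then have "qscale (of_nat d) (m \<sigma> - m \<tau>) \<in> perp n (\<sigma> \<inter> \<tau>)" by (simp add: perp_closed)
    then have "U \<sigma> - U \<tau> \<in> perp n (\<sigma> \<inter> \<tau>)" by (simp add: U_def qvec.scale_right_diff_distrib)
    then have "character (U \<sigma> - U \<tau>) \<in> local_units x"
      using character_unit_point[OF chart_overlap[OF fan \<sigma> \<tau> x]] U \<sigma> \<tau> by (simp add: lattice_diff)
    then show ?thesis by (simp add: character_diff)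
  qed
  define S where "S x = (SOME \<sigma>. \<sigma> \<in> \<Sigma> \<and> x \<in> chart n \<sigma>)" for x :: "'k point"
  have S: "S x \<in> \<Sigma> \<and> x \<in> chart n (S x)" if "\<sigma> \<in> \<Sigma>" "x \<in> chart n \<sigma>" for \<sigma> and x :: "'k point"
    unfolding S_def by (rule someI[of "\<lambda>\<sigma>. \<sigma> \<in> \<Sigma> \<and> x \<in> chart n \<sigma>"]) (use that in blast)
  define f where "f x = (character (U (S x)) :: 'k torus_field)" for x :: "'k point"
  have "cartier_divisor n \<Sigma> f"
    unfolding cartier_divisor_def
  proof (intro ballI conjI)
    fix x :: "'k point" assume "x \<in> toric_variety n \<Sigma>"
    then have x: "S x \<in> \<Sigma>" "x \<in> chart n (S x)" using S by (auto simp: toric_variety_def)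
    have "f x = character (U (S x)) / character 0" by (simp add: f_def character_zero)
    moreover have "character (U (S x)) \<in> monomial_span (lattice_pts n)"
      "character 0 \<in> monomial_span (lattice_pts n)"
      using U[OF x(1)] by (simp_all add: character_in_span_iff lattice_zero)
    ultimately show "f x \<in> function_field n - {0}"
      unfolding function_field_def f_def using character_nonzero by blast
    let ?A = "chart_ring n (S x) :: 'k torus_field set"
    let ?P = "max_ideal x \<inter> ?A"
    have P: "?P \<in> chart_primes n (S x)" unfolding chart_primes_iff by (rule chart_prime[OF x(2)])
    \<comment> \<open>With \<open>g = 1\<close> the neighbourhood of \<open>x\<close> is the entire
      chart.\<close>
    have one: "1 \<in> ?A - ?P" by (rule prime_in_one[OF subring_chart_ring chart_prime[OF x(2)]])
    have unit: "f x / f (localize ?A Q) \<in> local_units (localize ?A Q)"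
      if "Q \<in> chart_primes n (S x)" for Q
    proof -
      have y: "localize ?A Q \<in> chart n (S x)" using that by (simp add: chart_def)
      show ?thesis unfolding f_def using S[OF x(1) y] by (intro overlap[OF x(1) _ y]) auto
    qed
    show "\<exists>\<sigma>\<in>\<Sigma>. \<exists>P\<in>chart_primes n \<sigma>. \<exists>g\<in>chart_ring n \<sigma> - P.
        x = localize (chart_ring n \<sigma>) P \<and>
        (\<forall>Q\<in>chart_primes n \<sigma>. g \<notin> Q \<longrightarrow>
          f x / f (localize (chart_ring n \<sigma>) Q) \<in> local_units (localize (chart_ring n \<sigma>) Q))"
    proof (intro bexI[OF _ x(1)] bexI[OF _ P] bexI[OF _ one] conjI ballI impI)
      show "x = localize ?A ?P" by (rule chart_localize[OF x(2), symmetric])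
    qed (rule unit)
  qed
  moreover have "\<exists>u\<in>lattice_pts n. u - qscale (of_nat d) (m \<sigma>) \<in> perp n \<sigma> \<and>
      (\<forall>x\<in>chart n \<sigma>. f x / character u \<in> local_units x)" if \<sigma>: "\<sigma> \<in> \<Sigma>" for \<sigma>
  proof (intro bexI[of _ "U \<sigma>"] conjI ballI)
    show "U \<sigma> - qscale (of_nat d) (m \<sigma>) \<in> perp n \<sigma>" by (simp add: U_def perp_closed)
    show "f x / character (U \<sigma>) \<in> local_units x" if x: "x \<in> chart n \<sigma>" for x
      unfolding f_def using S[OF \<sigma> x] by (intro overlap[OF _ \<sigma> _ x]) auto
  qed (rule U[OF \<sigma>])
  ultimately have "is_cartier_multiple n \<Sigma> d m f" by (simp add: is_cartier_multiple_def)
  then show ?thesis using d(1) by blast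
qed

lemma intersection_class_cartier_multiple:
  assumes "fan n \<Sigma>" "equivariant_Q_cartier n \<Sigma> m"
  obtains d f where "d > 0" "is_cartier_multiple n \<Sigma> d m f"
    "(intersection_class n \<Sigma> k m z :: ('k::field point \<Rightarrow> rat) set)
      = chow_class n \<Sigma> (k - 1) (\<lambda>w. cartier_dot n \<Sigma> f z w / of_nat d)"
proof -
  let ?p = "SOME p :: nat \<times> ('k point \<Rightarrow> 'k torus_field).
    case p of (d, f) \<Rightarrow> d > 0 \<and> is_cartier_multiple n \<Sigma> d m f"
  obtain d f where df: "?p = (d, f)" by fastforce
  have "case ?p of (d, f) \<Rightarrow> d > 0 \<and> is_cartier_multiple n \<Sigma> d m f"
    by (rule someI_ex) (use ex_cartier_multiple[OF assms, where 'k='k] in auto)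
  then show thesis using df by (intro that[of d f]) (simp_all add: intersection_class_def)
qed

section \<open>Rational equivalence\<close>

lemma module_rat_functions: "module (\<lambda>c f v. c * f v :: rat)"
  by unfold_locales (auto simp: fun_eq_iff algebra_simps)

lemma rationally_trivial_add:
  "f \<in> rationally_trivial n \<Sigma> k \<Longrightarrow> g \<in> rationally_trivial n \<Sigma> k \<Longrightarrow> f + g \<in> rationally_trivial n \<Sigma> k"
  unfolding rationally_trivial_def by (rule module.span_add[OF module_rat_functions])

lemma rationally_trivial_diff:
  "f \<in> rationally_trivial n \<Sigma> k \<Longrightarrow> g \<in> rationally_trivial n \<Sigma> k \<Longrightarrow> f - g \<in> rationally_trivial n \<Sigma> k"
  unfolding rationally_trivial_def by (rule module.span_diff[OF module_rat_functions])

lemma rationally_trivial_scale: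
  "f \<in> rationally_trivial n \<Sigma> k \<Longrightarrow> (\<lambda>v. c * f v) \<in> rationally_trivial n \<Sigma> k"
  unfolding rationally_trivial_def by (rule module.span_scale[OF module_rat_functions])

lemma rationally_trivial_sum:
  "(\<And>i. i \<in> I \<Longrightarrow> f i \<in> rationally_trivial n \<Sigma> k) \<Longrightarrow> (\<lambda>v. \<Sum>i\<in>I. f i v) \<in> rationally_trivial n \<Sigma> k"
proof -
  assume "\<And>i. i \<in> I \<Longrightarrow> f i \<in> rationally_trivial n \<Sigma> k"
  then have "(\<Sum>i\<in>I. f i) \<in> rationally_trivial n \<Sigma> k"
    unfolding rationally_trivial_def by (rule module.span_sum[OF module_rat_functions])
  moreover have "(\<Sum>i\<in>I. f i) = (\<lambda>v. \<Sum>i\<in>I. f i v)"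
    by (induction I rule: infinite_finite_induct) (auto simp: fun_eq_iff)
  ultimately show ?thesis by simp
qed

lemma rationally_trivial_weil_divisor:
  "v \<in> toric_variety n \<Sigma> \<Longrightarrow> int (point_dim v) = k + 1 \<Longrightarrow> r \<in> local_units v \<Longrightarrow>
    weil_divisor n \<Sigma> v (\<lambda>_. r) \<in> rationally_trivial n \<Sigma> k"
  unfolding rationally_trivial_def by (rule module.span_base[OF module_rat_functions]) blast

lemma chow_class_eqI:
  assumes "y - z \<in> rationally_trivial n \<Sigma> k"
  shows "chow_class n \<Sigma> k y = chow_class n \<Sigma> k z"
proof -
  have "w - y \<in> rationally_trivial n \<Sigma> k \<longleftrightarrow> w - z \<in> rationally_trivial n \<Sigma> k" for w
    using rationally_trivial_add[of "w - y" n \<Sigma> k, OF _ assms]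
      rationally_trivial_diff[of "w - z" n \<Sigma> k, OF _ assms] by auto
  then show ?thesis by (simp add: chow_class_def)
qed

section \<open>The cycle-level action\<close>

text \<open>
  Let \<open>\<chi>\<^sup>u\<close> be the local equation of the Cartier divisor on \<open>U\<^sub>\<sigma>\<close>, so that \<open>f v = \<chi>\<^sup>u e\<close> at the generic
  point \<open>v\<close> of \<open>V(\<sigma>)\<close> with a rational function \<open>e\<close> on \<open>V(\<sigma>)\<close>. The \<open>\<Psi>(\<sigma>)\<close>-component \<open>p\<close> of \<open>m\<^sub>\<tau>\<close> is the
  same for all \<open>\<tau> \<succ> \<sigma>\<close>, so \<open>q = u - d p\<close> lies in \<open>\<sigma>\<^sup>\<bottom>\<close>; the divisors of \<open>1/e\<close> and of (a
  multiple of) \<open>\<chi>\<^sup>q\<close> account for the difference of the two cycles.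
\<close>

lemma weil_divisor_orbit_closure:
  fixes f :: "'k::field point \<Rightarrow> 'k torus_field"
  assumes fan: "fan n \<Sigma>" and \<Psi>: "choice_of_complements n \<Sigma> \<Psi>" and m: "equivariant_Q_cartier n \<Sigma> m"
    and f: "is_cartier_multiple n \<Sigma> d m f"
    and \<sigma>: "\<sigma> \<in> \<Sigma>" and dim: "int (cone_dim \<sigma>) = int n - k"
  shows "(\<lambda>w. weil_divisor n \<Sigma> (orbit_closure n \<sigma>) (\<lambda>x. f x / f (orbit_closure n \<sigma>)) w
      - of_nat d * (\<Sum>\<tau> | \<tau> \<in> \<Sigma> \<and> is_facet n \<sigma> \<tau>.
          if w = orbit_closure n \<tau> then pairing (complement_proj n \<Psi> \<sigma> (m \<tau>)) (normal_gen n \<tau> \<sigma>) else 0))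
    \<in> rationally_trivial n \<Sigma> (k - 1)"
    (is "?diff \<in> _")
proof -
  let ?V = "\<lambda>\<sigma>. orbit_closure n \<sigma> :: 'k point"
  define v where "v = ?V \<sigma>"
  have poly: "polyhedral_cone n \<sigma>" by (rule fan_polyhedral[OF fan \<sigma>])
  have \<sigma>q: "\<sigma> \<subseteq> qspace n" by (rule polyhedral_subset_qspace[OF poly])
  have "\<forall>\<tau>\<in>\<Sigma>. \<exists>u. u \<in> lattice_pts n \<and> u - qscale (of_nat d) (m \<tau>) \<in> perp n \<tau> \<and>
      (\<forall>x\<in>chart n \<tau>. f x / character u \<in> local_units x)"
    using f by (auto simp: is_cartier_multiple_def)
  from bchoice[OF this] obtain U where U: "\<forall>\<tau>\<in>\<Sigma>. U \<tau> \<in> lattice_pts n \<and>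
      U \<tau> - qscale (of_nat d) (m \<tau>) \<in> perp n \<tau> \<and> (\<forall>x\<in>chart n \<tau>. f x / character (U \<tau>) \<in> local_units x)" ..
  have local_eq: "\<exists>s\<in>local_units x. f x = s * character (U \<tau>)" if "\<tau> \<in> \<Sigma>" "x \<in> chart n \<tau>" for \<tau> x
  proof (rule bexI)
    show "f x / character (U \<tau>) \<in> local_units x" using U that by blast
    show "f x = f x / character (U \<tau>) * character (U \<tau>)" by (simp add: character_nonzero)
  qed
  have v_chart: "v \<in> chart n \<sigma>" unfolding v_def by (rule orbit_closure_in_chart)
  have v_local: "local_subring v" by (rule chart_local[OF v_chart])
  obtain e where e: "e \<in> local_units v" "f v = e * character (U \<sigma>)" using local_eq[OF \<sigma> v_chart] by blast
  \<comment> \<open>The deviation of the given equation at the generic point from the character. Its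
    divisor on V(\<open>\<sigma>\<close>) is rationally trivial, so orders of \<open>e'\<close> are
    never evaluated.\<close>
  define e' where "e' = inverse e"
  have e': "e' \<in> local_units v" unfolding e'_def by (rule local_units_inverse[OF e(1)])
  define y where "y \<tau> = complement_proj n \<Psi> \<sigma> (m \<tau>)" for \<tau>
  have \<Psi>\<sigma>: "qvec.subspace (\<Psi> \<sigma>)" "\<Psi> \<sigma> \<subseteq> qspace n" "qvec.dim (\<Psi> \<sigma>) = cone_dim \<sigma>"
    "\<Psi> \<sigma> \<inter> perp n \<sigma> = {0}"
    using \<Psi> \<sigma> unfolding choice_of_complements_def by blast+
  have y: "y \<tau> \<in> perp n \<sigma>" "m \<tau> - y \<tau> \<in> \<Psi> \<sigma>" if "\<tau> \<in> \<Sigma>" for \<tau>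
    unfolding y_def using complement_proj[where \<Psi> = \<Psi>, OF \<sigma>q \<Psi>\<sigma>] m that
    by (auto simp: equivariant_Q_cartier_def)
  define p where "p = m \<sigma> - y \<sigma>"
  have m_perp: "m \<tau> - m \<sigma> \<in> perp n \<sigma>" if "\<tau> \<in> \<Sigma>" "is_face n \<sigma> \<tau>" for \<tau>
    using m that \<sigma> by (auto simp: equivariant_Q_cartier_def)
  \<comment> \<open>The difference of two such components lies in \<open>\<Psi> \<sigma>\<close>
    and, since \<open>m \<tau>\<close> and \<open>m \<sigma>\<close> agree on
    \<open>\<sigma>\<close>, also in \<open>\<sigma>\<^sup>\<bottom>\<close>.\<close>
  have p: "m \<tau> - y \<tau> = p" if \<tau>: "\<tau> \<in> \<Sigma>" "is_face n \<sigma> \<tau>" for \<tau>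
  proof -
    have "(m \<tau> - y \<tau>) - p \<in> \<Psi> \<sigma>"
      using y(2)[OF \<tau>(1)] y(2)[OF \<sigma>] \<Psi> \<sigma>
      by (auto simp: p_def choice_of_complements_def intro: qvec.subspace_diff)
    moreover have "(m \<tau> - y \<tau>) - p = (m \<tau> - m \<sigma>) - (y \<tau> - y \<sigma>)" by (simp add: p_def)
    then have "(m \<tau> - y \<tau>) - p \<in> perp n \<sigma>"
      using m_perp[OF \<tau>] y(1)[OF \<tau>(1)] y(1)[OF \<sigma>] by (simp only: perp_closed)
    ultimately have "(m \<tau> - y \<tau>) - p \<in> {0}" using \<Psi>\<sigma>(4) by blast
    then show ?thesis by simp
  qed
  define q where "q = U \<sigma> - qscale (of_nat d) p"
  have "q = (U \<sigma> - qscale (of_nat d) (m \<sigma>)) + qscale (of_nat d) (y \<sigma>)"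
    by (simp add: q_def p_def qvec.scale_right_diff_distrib)
  also have "\<dots> \<in> perp n \<sigma>" using U \<sigma> perp_closed(1)[OF _ perp_closed(4)[OF y(1)[OF \<sigma>]]] by blast
  finally have q: "q \<in> perp n \<sigma>" .
  obtain N :: nat where N: "N > 0" "qscale (of_nat N) q \<in> lattice_pts n"
    using scale_to_lattice[OF perp_qspace[OF q]] .
  define l where "l = qscale (of_nat N) q"
  have l: "l \<in> perp n \<sigma>" "l \<in> lattice_pts n" using N q by (simp_all add: l_def perp_closed)
  have l_unit: "character l \<in> local_units v" by (rule character_unit_point[OF v_chart l])
  define W where "W r = weil_divisor n \<Sigma> v (\<lambda>_. r)" for r
  have "?diff w = W e' w - 1 / of_nat N * W (character l) w" for w
  proof (cases "codim_one n \<Sigma> v w")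
    case False
    \<comment> \<open>Everything vanishes here: the divisors by definition, the sum because its
      points V(\<open>\<tau>\<close>) do have codimension one.\<close>
    then have "w \<noteq> ?V \<tau>" if "\<tau> \<in> \<Sigma>" "is_facet n \<sigma> \<tau>" for \<tau>
      using codim_one_facet[OF fan that] by (auto simp: v_def)
    then show ?thesis using False by (simp add: W_def weil_divisor_def v_def[symmetric])
  next
    case True
    then have wv: "w \<subseteq> v" by (auto simp: codim_one_def dest: in_closure_subset)
    have W: "W r w = of_int (ord_along v w r)" for r using True by (simp add: W_def weil_divisor_def)
    have cases: "w \<in> chart n \<sigma> \<or> (\<exists>\<tau>\<in>\<Sigma>. is_facet n \<sigma> \<tau> \<and> w = ?V \<tau>)"
      by (rule codim_one_orbit_closure_cases[OF fan \<sigma> True[unfolded v_def]])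
    show ?thesis
    proof (cases "w \<in> chart n \<sigma>")
      case w\<sigma>: True
      have wl: "local_subring w" by (rule chart_local[OF w\<sigma>])
      have "w \<noteq> ?V \<tau>" if "\<tau> \<in> \<Sigma>" "is_facet n \<sigma> \<tau>" for \<tau>
      proof
        assume "w = ?V \<tau>"
        then have "\<tau> \<subseteq> \<sigma>" using w\<sigma> orbit_closure_in_chart_iff[OF fan that(1) \<sigma>] by blast
        then show False using that(2) by (auto simp: is_facet_def proper_face_def dest: face_subset)
      qed
      moreover obtain s where s: "s \<in> local_units w" "f w = s * character (U \<sigma>)"
        using local_eq[OF \<sigma> w\<sigma>] by blast
      \<comment> \<open>In the chart of \<open>\<sigma>\<close>, one character serves at both points
        and cancels, leaving the order of \<open>e'\<close> on either side.\<close>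
      moreover have "f w / f v = s * e'"
        using s(2) e(2) character_nonzero[of "U \<sigma>", where 'k='k] by (simp add: e'_def divide_inverse)
      moreover have "ord_along v w (character l) = 0"
        by (rule ord_along_unit[OF v_local wl wv character_unit_point[OF w\<sigma> l]])
      ultimately show ?thesis
        using True ord_along_unit_mult[OF v_local wl wv s(1), of e']
        by (simp add: W weil_divisor_def v_def[symmetric])
    next
      case False
      then obtain \<tau> where \<tau>: "\<tau> \<in> \<Sigma>" "is_facet n \<sigma> \<tau>" "w = ?V \<tau>" using cases by blast
      have face: "is_face n \<sigma> \<tau>" using \<tau>(2) by (simp add: is_facet_def proper_face_def)
      have w\<tau>: "w \<in> chart n \<tau>" unfolding \<tau>(3) by (rule orbit_closure_in_chart)
      have wl: "local_subring w" by (rule chart_local[OF w\<tau>])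
      let ?n = "normal_gen n \<tau> \<sigma>"
      obtain s where s: "s \<in> local_units w" "f w = s * character (U \<tau>)"
        using local_eq[OF \<tau>(1) w\<tau>] by blast
      have iff: "w = ?V \<tau>' \<longleftrightarrow> \<tau>' = \<tau>" if "\<tau>' \<in> \<Sigma>" for \<tau>'
        using orbit_closure_inj[OF fan \<tau>(1) that, where 'k='k] \<tau>(3) by blast
      have "(\<Sum>\<tau>' | \<tau>' \<in> \<Sigma> \<and> is_facet n \<sigma> \<tau>'. if w = ?V \<tau>' then pairing (y \<tau>') (normal_gen n \<tau>' \<sigma>) else 0)
          = (\<Sum>\<tau>' | \<tau>' \<in> \<Sigma> \<and> is_facet n \<sigma> \<tau>'. if \<tau>' = \<tau> then pairing (y \<tau>') (normal_gen n \<tau>' \<sigma>) else 0)"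
        using iff by (intro sum.cong) simp_all
      also have "\<dots> = pairing (y \<tau>) ?n" using \<tau> fan_finite[OF fan] by simp
      finally have sum: "(\<Sum>\<tau>' | \<tau>' \<in> \<Sigma> \<and> is_facet n \<sigma> \<tau>'.
          if w = ?V \<tau>' then pairing (y \<tau>') (normal_gen n \<tau>' \<sigma>) else 0) = pairing (y \<tau>) ?n" .
      have perp_sub: "perp n \<tau> \<subseteq> perp n \<sigma>" by (rule perp_antimono[OF face_subset[OF face]])
      have "U \<tau> - U \<sigma> = (U \<tau> - qscale (of_nat d) (m \<tau>)) - (U \<sigma> - qscale (of_nat d) (m \<sigma>))
          + qscale (of_nat d) (m \<tau> - m \<sigma>)"
        by (simp add: qvec.scale_right_diff_distrib)
      also have "\<dots> \<in> perp n \<sigma>"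
        using U \<tau>(1) \<sigma> perp_sub
        by (intro perp_closed(1)[OF perp_closed(2) perp_closed(4)[OF m_perp[OF \<tau>(1) face]]]) blast+
      finally have UU: "U \<tau> - U \<sigma> \<in> perp n \<sigma>" "U \<tau> - U \<sigma> \<in> lattice_pts n"
        using U \<tau>(1) \<sigma> by (auto simp: lattice_diff)
      have "f w / f v = s * (character (U \<tau> - U \<sigma>) * e')"
        using s(2) e(2) by (simp add: e'_def character_diff divide_inverse)
      then have "ord_along v w (f w / f v) = ord_along v w (s * (character (U \<tau> - U \<sigma>) * e'))"
        by (rule arg_cong)
      also have "\<dots> = ord_along v w (character (U \<tau> - U \<sigma>) * e')"
        by (rule ord_along_unit_mult[OF v_local wl wv s(1)])
      also have "of_int (ord_along v w (character (U \<tau> - U \<sigma>) * e'))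
          = pairing (U \<tau> - U \<sigma>) ?n + of_int (ord_along v w e')"
        using ord_along_facet[OF fan \<tau>(1,2) UU, of e'] e' by (simp add: v_def \<tau>(3))
      finally have 1: "of_int (ord_along v w (f w / f v)) = pairing (U \<tau> - U \<sigma>) ?n + of_int (ord_along v w e')" .
      have one: "1 \<in> local_units w" "1 \<in> local_units v"
        using local_subring_subring[OF wl] local_subring_subring[OF v_local] by (auto simp: local_units_one)
      have "of_int (ord_along v w (character l * 1)) = pairing l ?n + of_int (ord_along v w 1)"
        using ord_along_facet[OF fan \<tau>(1,2) l, of 1] one by (simp add: v_def \<tau>(3))
      then have 2: "of_int (ord_along v w (character l)) = of_nat N * pairing q ?n"
        using ord_along_unit[OF v_local wl wv one(1)] by (simp add: l_def pairing_linear)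
      \<comment> \<open>Pairing with the normal generator is insensitive to the ambiguity of
        \<open>U \<tau>\<close> modulo \<open>\<tau>\<^sup>\<bottom>\<close>.\<close>
      have "?n \<in> qvec.span \<tau>" using normal_gen[OF fan_polyhedral[OF fan \<tau>(1)] \<tau>(2)] by blast
      then have "pairing (U \<tau> - qscale (of_nat d) (m \<tau>)) ?n = 0" using perp_span U \<tau>(1) by blast
      moreover have "y \<tau> = m \<tau> - p" using p[OF \<tau>(1) face] by (simp add: algebra_simps)
      ultimately have 3: "of_nat d * pairing (y \<tau>) ?n = pairing (U \<tau> - U \<sigma>) ?n + pairing q ?n"
        by (simp add: q_def pairing_linear right_diff_distrib)
      \<comment> \<open>Subtracting fact 3 from fact 1 leaves the order of \<open>e'\<close> minus
        \<open>pairing q ?n\<close>, and by fact 2 the latter is the order of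
        \<open>character l\<close> divided by \<open>N\<close>.\<close>
      show ?thesis
        using True 1 2 3 N(1) unfolding W y_def[symmetric] sum
        by (simp add: weil_divisor_def v_def[symmetric])
    qed
  qed
  then have "?diff = W e' - (\<lambda>w. 1 / of_nat N * W (character l) w)" by (simp add: fun_eq_iff)
  also have "\<dots> \<in> rationally_trivial n \<Sigma> (k - 1)"
  proof (intro rationally_trivial_diff rationally_trivial_scale)
    have "v \<in> toric_variety n \<Sigma>" using v_chart \<sigma> by (auto simp: toric_variety_def)
    moreover have "int (point_dim v) = k - 1 + 1"
      using point_dim_orbit_closure[OF \<sigma>q, where 'k='k] dim by (simp add: v_def)
    ultimately show "W e' \<in> rationally_trivial n \<Sigma> (k - 1)" "W (character l) \<in> rationally_trivial n \<Sigma> (k - 1)"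
      unfolding W_def using e' l_unit by (auto intro: rationally_trivial_weil_divisor)
  qed
  finally show ?thesis .
qed

section \<open>Invariant cycles inside the cycles on the variety\<close>

lemma geometric_cycle_orbit_closure:
  assumes "fan n \<Sigma>" "\<sigma> \<in> \<Sigma>"
  shows "geometric_cycle n \<Sigma> z (orbit_closure n \<sigma> :: 'k::field point) = z \<sigma>"
proof -
  have "geometric_cycle n \<Sigma> z (orbit_closure n \<sigma> :: 'k point) = (\<Sum>\<tau>\<in>\<Sigma>. if \<tau> = \<sigma> then z \<tau> else 0)"
    unfolding geometric_cycle_def using orbit_closure_inj[OF assms, where 'k='k]
    by (intro sum.cong) auto
  then show ?thesis using assms fan_finite by simp
qed

lemma geometric_cycle_support:
  assumes "geometric_cycle n \<Sigma> z v \<noteq> 0"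
  obtains \<sigma> where "\<sigma> \<in> \<Sigma>" "v = orbit_closure n \<sigma>" "z \<sigma> \<noteq> 0"
proof -
  obtain \<sigma> where "\<sigma> \<in> \<Sigma>" "(if v = orbit_closure n \<sigma> then z \<sigma> else 0) \<noteq> 0"
    by (rule sum.not_neutral_contains_not_neutral[OF assms[unfolded geometric_cycle_def]])
  then show thesis by (cases "v = orbit_closure n \<sigma>") (simp_all add: that)
qed

lemma geometric_cycle_in_cycles:
  assumes "fan n \<Sigma>" "z \<in> invariant_cycles n \<Sigma> k"
  shows "(geometric_cycle n \<Sigma> z :: 'k::field point \<Rightarrow> rat) \<in> cycles n \<Sigma> k"
  unfolding cycles_def
proof (intro CollectI conjI allI impI)
  have "{v :: 'k point. geometric_cycle n \<Sigma> z v \<noteq> 0} \<subseteq> orbit_closure n ` \<Sigma>"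
    by (auto elim: geometric_cycle_support)
  then show "finite {v :: 'k point. geometric_cycle n \<Sigma> z v \<noteq> 0}"
    using fan_finite[OF assms(1)] finite_subset by blast
  fix v :: "'k point" assume "geometric_cycle n \<Sigma> z v \<noteq> 0"
  then obtain \<sigma> where \<sigma>: "\<sigma> \<in> \<Sigma>" "v = orbit_closure n \<sigma>" "z \<sigma> \<noteq> 0" by (rule geometric_cycle_support)
  show "v \<in> toric_variety n \<Sigma>" using \<sigma> orbit_closure_in_chart by (auto simp: toric_variety_def)
  show "int (point_dim v) = k"
    using point_dim_orbit_closure[OF polyhedral_subset_qspace[OF fan_polyhedral[OF assms(1) \<sigma>(1)]], where 'k='k]
      assms(2) \<sigma> by (auto simp: invariant_cycles_def)
qed

lemma cartier_dot_geometric_cycle: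
  assumes "fan n \<Sigma>"
  shows "cartier_dot n \<Sigma> f (geometric_cycle n \<Sigma> z) w = (\<Sum>\<sigma>\<in>\<Sigma>. z \<sigma> *
    weil_divisor n \<Sigma> (orbit_closure n \<sigma> :: 'k::field point) (\<lambda>x. f x / f (orbit_closure n \<sigma>)) w)"
proof -
  let ?g = "geometric_cycle n \<Sigma> z :: 'k point \<Rightarrow> rat"
  have "cartier_dot n \<Sigma> f ?g w = (\<Sum>v\<in>orbit_closure n ` \<Sigma>. ?g v * weil_divisor n \<Sigma> v (\<lambda>x. f x / f v) w)"
    unfolding cartier_dot_def using fan_finite[OF assms]
    by (intro sum.mono_neutral_left) (auto elim: geometric_cycle_support)
  also have "\<dots> = (\<Sum>\<sigma>\<in>\<Sigma>. ?g (orbit_closure n \<sigma>) *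
      weil_divisor n \<Sigma> (orbit_closure n \<sigma>) (\<lambda>x. f x / f (orbit_closure n \<sigma>)) w)"
    by (subst sum.reindex) (auto simp: inj_on_def dest: orbit_closure_inj[OF assms])
  finally show ?thesis by (simp add: geometric_cycle_orbit_closure[OF assms])
qed

text \<open>Regroups the action by its source \<open>\<sigma>\<close> instead of its target
  \<open>\<tau>\<close>, so that it can be compared with one orbit closure at a time.\<close>

lemma geometric_cycle_psi_action:
  assumes "finite \<Sigma>"
  shows "geometric_cycle n \<Sigma> (psi_action n \<Sigma> \<Psi> m z) (w :: 'k::field point) = (\<Sum>\<sigma>\<in>\<Sigma>. z \<sigma> *
    (\<Sum>\<tau> | \<tau> \<in> \<Sigma> \<and> is_facet n \<sigma> \<tau>. if w = orbit_closure n \<tau>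
      then pairing (complement_proj n \<Psi> \<sigma> (m \<tau>)) (normal_gen n \<tau> \<sigma>) else 0))"
proof -
  define c where "c \<sigma> \<tau> = (if w = orbit_closure n \<tau> \<and> is_facet n \<sigma> \<tau>
    then pairing (complement_proj n \<Psi> \<sigma> (m \<tau>)) (normal_gen n \<tau> \<sigma>) else 0)" for \<sigma> \<tau>
  have "geometric_cycle n \<Sigma> (psi_action n \<Sigma> \<Psi> m z) w = (\<Sum>\<tau>\<in>\<Sigma>. \<Sum>\<sigma>\<in>\<Sigma>. z \<sigma> * c \<sigma> \<tau>)"
    unfolding geometric_cycle_def
  proof (intro sum.cong refl)
    fix \<tau> assume \<tau>: "\<tau> \<in> \<Sigma>"
    have "psi_action n \<Sigma> \<Psi> m z \<tau> = (\<Sum>\<sigma>\<in>\<Sigma>. if is_facet n \<sigma> \<tau>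
        then z \<sigma> * pairing (complement_proj n \<Psi> \<sigma> (m \<tau>)) (normal_gen n \<tau> \<sigma>) else 0)"
      using \<tau> assms by (simp add: psi_action_def sum.inter_filter)
    then show "(if w = orbit_closure n \<tau> then psi_action n \<Sigma> \<Psi> m z \<tau> else 0) = (\<Sum>\<sigma>\<in>\<Sigma>. z \<sigma> * c \<sigma> \<tau>)"
      by (auto simp: c_def intro!: sum.cong)
  qed
  also have "\<dots> = (\<Sum>\<sigma>\<in>\<Sigma>. z \<sigma> * (\<Sum>\<tau>\<in>\<Sigma>. c \<sigma> \<tau>))"
    by (subst sum.swap) (simp add: sum_distrib_left)
  also have "\<dots> = (\<Sum>\<sigma>\<in>\<Sigma>. z \<sigma> * (\<Sum>\<tau> | \<tau> \<in> \<Sigma> \<and> is_facet n \<sigma> \<tau>. if w = orbit_closure n \<tau>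
      then pairing (complement_proj n \<Psi> \<sigma> (m \<tau>)) (normal_gen n \<tau> \<sigma>) else 0))"
  proof (rule sum.cong[OF refl])
    fix \<sigma> assume "\<sigma> \<in> \<Sigma>"
    have "(\<Sum>\<tau>\<in>\<Sigma>. c \<sigma> \<tau>) = (\<Sum>\<tau> | \<tau> \<in> \<Sigma> \<and> is_facet n \<sigma> \<tau>. if w = orbit_closure n \<tau>
        then pairing (complement_proj n \<Psi> \<sigma> (m \<tau>)) (normal_gen n \<tau> \<sigma>) else 0)"
      using assms by (intro sum.mono_neutral_cong_right) (auto simp: c_def)
    then show "z \<sigma> * (\<Sum>\<tau>\<in>\<Sigma>. c \<sigma> \<tau>) = z \<sigma> * (\<Sum>\<tau> | \<tau> \<in> \<Sigma> \<and> is_facet n \<sigma> \<tau>. if w = orbit_closure n \<tau>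
        then pairing (complement_proj n \<Psi> \<sigma> (m \<tau>)) (normal_gen n \<tau> \<sigma>) else 0)"
      by (rule arg_cong)
  qed
  finally show ?thesis .
qed

theorem proposition4p2:
  fixes n :: nat and \<Sigma> :: "cone set" and \<Psi> :: "cone \<Rightarrow> qvec set"
    and m :: "cone \<Rightarrow> qvec" and k :: int and z :: "cone \<Rightarrow> rat"
  assumes "fan n \<Sigma>"
    and "choice_of_complements n \<Sigma> \<Psi>"
    and "equivariant_Q_cartier n \<Sigma> m"
    and "z \<in> invariant_cycles n \<Sigma> k"
  shows "chow_class n \<Sigma> (k - 1) (geometric_cycle n \<Sigma> (psi_action n \<Sigma> \<Psi> m z)) =
           (intersection_class n \<Sigma> k m (geometric_cycle n \<Sigma> z) :: ('k::field point \<Rightarrow> rat) set)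
       \<and> (\<forall>\<Phi> :: ('k point \<Rightarrow> rat) set \<Rightarrow> ('k point \<Rightarrow> rat) set.
            is_chow_intersection n \<Sigma> k m \<Phi> \<longrightarrow>
            chow_class n \<Sigma> (k - 1) (geometric_cycle n \<Sigma> (psi_action n \<Sigma> \<Psi> m z)) =
              \<Phi> (chow_class n \<Sigma> k (geometric_cycle n \<Sigma> z)))"
proof -
  let ?z = "geometric_cycle n \<Sigma> z :: 'k point \<Rightarrow> rat"
  let ?Dz = "geometric_cycle n \<Sigma> (psi_action n \<Sigma> \<Psi> m z) :: 'k point \<Rightarrow> rat"
  obtain d f where df: "d > 0" "is_cartier_multiple n \<Sigma> d m f"
    "(intersection_class n \<Sigma> k m ?z :: ('k point \<Rightarrow> rat) set)
      = chow_class n \<Sigma> (k - 1) (\<lambda>w. cartier_dot n \<Sigma> f ?z w / of_nat d)"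
    by (rule intersection_class_cartier_multiple[OF assms(1,3)])
  define a where "a \<sigma> w = weil_divisor n \<Sigma> (orbit_closure n \<sigma>) (\<lambda>x. f x / f (orbit_closure n \<sigma>)) w"
    for \<sigma> and w :: "'k point"
  define b where "b \<sigma> w = (\<Sum>\<tau> | \<tau> \<in> \<Sigma> \<and> is_facet n \<sigma> \<tau>. if w = orbit_closure n \<tau>
      then pairing (complement_proj n \<Psi> \<sigma> (m \<tau>)) (normal_gen n \<tau> \<sigma>) else 0)"
    for \<sigma> and w :: "'k point"
  \<comment> \<open>The sign turns the geometric divisor minus the combinatorial one into the
    difference in the order demanded by \<open>chow_class_eqI\<close>.\<close>
  have "(\<lambda>w. - z \<sigma> / of_nat d * (a \<sigma> w - of_nat d * b \<sigma> w)) \<in> rationally_trivial n \<Sigma> (k - 1)"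
    if \<sigma>: "\<sigma> \<in> \<Sigma>" for \<sigma>
  proof (cases "z \<sigma> = 0")
    case True
    \<comment> \<open>The dimension of \<open>\<sigma>\<close> is unknown in this case, so
      triviality comes from the zero cycle, written as an empty sum.\<close>
    have "(\<lambda>w::'k point. \<Sum>i\<in>{}. 0) \<in> rationally_trivial n \<Sigma> (k - 1)"
      by (rule rationally_trivial_sum) simp
    then show ?thesis by (simp add: True)
  next
    case False
    then have "int (cone_dim \<sigma>) = int n - k" using assms(4) by (simp add: invariant_cycles_def)
    then show ?thesis
      unfolding a_def b_def
      by (intro rationally_trivial_scale weil_divisor_orbit_closure[OF assms(1-3) df(2) \<sigma>])
  qed
  then have "(\<lambda>w. \<Sum>\<sigma>\<in>\<Sigma>. - z \<sigma> / of_nat d * (a \<sigma> w - of_nat d * b \<sigma> w)) \<in> rationally_trivial n \<Sigma> (k - 1)"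
    by (rule rationally_trivial_sum)
  also have "(\<lambda>w. \<Sum>\<sigma>\<in>\<Sigma>. - z \<sigma> / of_nat d * (a \<sigma> w - of_nat d * b \<sigma> w))
      = ?Dz - (\<lambda>w. cartier_dot n \<Sigma> f ?z w / of_nat d)"
  proof
    fix w :: "'k point"
    have "- z \<sigma> / of_nat d * (a \<sigma> w - of_nat d * b \<sigma> w) = z \<sigma> * b \<sigma> w - z \<sigma> * a \<sigma> w / of_nat d" for \<sigma>
      using df(1) by (simp add: field_simps)
    then show "(\<Sum>\<sigma>\<in>\<Sigma>. - z \<sigma> / of_nat d * (a \<sigma> w - of_nat d * b \<sigma> w))
        = (?Dz - (\<lambda>w. cartier_dot n \<Sigma> f ?z w / of_nat d)) w"
      by (simp add: cartier_dot_geometric_cycle[OF assms(1)]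
          geometric_cycle_psi_action[OF fan_finite[OF assms(1)]] a_def[symmetric] b_def[symmetric]
          sum_subtractf sum_divide_distrib)
  qed
  finally have eq: "chow_class n \<Sigma> (k - 1) ?Dz = intersection_class n \<Sigma> k m ?z"
    unfolding df(3) by (rule chow_class_eqI)
  moreover have "\<Phi> (chow_class n \<Sigma> k ?z) = intersection_class n \<Sigma> k m ?z"
    if "is_chow_intersection n \<Sigma> k m \<Phi>" for \<Phi> :: "('k point \<Rightarrow> rat) set \<Rightarrow> ('k point \<Rightarrow> rat) set"
    using that geometric_cycle_in_cycles[OF assms(1,4), where 'k='k] by (simp add: is_chow_intersection_def)
  ultimately show ?thesis by simp
qed

end
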